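(* Let $1<p<\infty$, and let $(\Omega,d,\mu)$ be a bounded, locally compact, non-complete metric measure space such that $\Omega$ is a uniform domain in its completion, $\mu$ is doubling, and $(\Omega,d,\mu)$ supports a $p$-Poincaré inequality. Let $\partial\Omega=\overline\Omega\setminus\Omega$ carry a Borel regular measure $\nu$ that is $\Theta$-codimensional to $\mu$ for some $0<\Theta<p$, and put $\theta=1-\Theta/p$. For $L\in(HB^\theta_{p,p}(\partial\Omega))^*$ let $u_L\in HN^{1,p}(\Omega)$ be the solution to the Neumann problem with boundary data $L$. Then the (Neumann-to-Dirichlet) map $$\mathrm{NtD}:(HB^\theta_{p,p}(\partial\Omega))^*\to HB^\theta_{p,p}(\partial\Omega),\qquad \mathrm{NtD}(L):=\mathrm{Tr}(u_L),$$ is well defined and bounded, with $$\|\mathrm{NtD}\|:=\sup_{\|L\|=1}\|\mathrm{Tr}(u_L)\|_{HB^\theta_{p,p}(\partial\Omega)}\le\left[(2p)^{\frac1{p-1}}+\frac{2(p-1)}{p}\right]\|\mathrm{Tr}\|^{\frac{p}{p-1}}.$$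
   Context: **Domain.** $\overline\Omega$ is the completion of $\Omega$ and $\partial\Omega=\overline\Omega\setminus\Omega$. $\Omega$ is a uniform domain if there is $C\ge1$ such that every pair $x\ne y$ in $\Omega$ is joined by a curve $\gamma$ in $\Omega$ with length $\ell(\gamma)\le C\,d(x,y)$ and, for every $z$ on $\gamma$ and subcurves $\gamma_{x,z},\gamma_{z,y}$ of $\gamma$ from $x$ to $z$ and from $z$ to $y$, $\min\{\ell(\gamma_{x,z}),\ell(\gamma_{z,y})\}\le C\,\mathrm{dist}(z,\partial\Omega)$. $\mu$ is a Borel regular measure with $0<\mu(B)<\infty$ for all balls $B$; it is doubling if $\mu(2B)\le C\mu(B)$ for all balls. **Upper gradients, Poincaré.** A Borel $g:\Omega\to[0,\infty]$ is an upper gradient of $u:\Omega\to\mathbb R$ if $|u(y)-u(x)|\le\int_\gamma g\,ds$ for every non-constant compact rectifiable curve $\gamma$ joining $x,y$; it is a $p$-weak upper gradient if this holds for all such curves except a family $\Gamma$ for which there is a nonnegative Borel $\rho\in L^p(\Omega)$ with $\int_\gamma\rho\,ds=\infty$ for all $\gamma\in\Gamma$. The $p$-Poincaré inequality: there are $C>0,\lambda\ge1$ with $\frac1{\mu(B)}\int_B|u-u_B|\,d\mu\le C\,\mathrm{rad}(B)\big(\frac1{\mu(\lambda B)}\int_{\lambda B}g^p\,d\mu\big)^{1/p}$ for all balls $B$, all $u$ and all upper gradients $g$ of $u$, where $u_B=\frac1{\mu(B)}\int_Bu\,d\mu$. **Codimension.** $\nu$ is $\Theta$-codimensional to $\mu$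 if there is $C>0$ with $C^{-1}\mu(B(x,r)\cap\Omega)r^{-\Theta}\le\nu(B(x,r)\cap\partial\Omega)\le C\mu(B(x,r)\cap\Omega)r^{-\Theta}$ for all $x\in\partial\Omega$, $0<r<2\,\mathrm{diam}(\partial\Omega)$. Balls are balls of $\overline\Omega$; $\nu$ is regarded as a measure on $\overline\Omega$ supported on $\partial\Omega$. **Sobolev spaces.** $N^{1,p}(\Omega)$ is the space of functions in $L^p(\Omega)$ having a $p$-weak upper gradient in $L^p(\Omega)$, normed by $\|u\|_{L^p}+\inf_g\|g\|_{L^p}$ (infimum over $p$-weak upper gradients $g$ of $u$), modulo functions of norm zero. $HN^{1,p}(\Omega)$ is the quotient of $N^{1,p}(\Omega)$ by constant functions, with norm $\inf_g\|g\|_{L^p(\Omega)}$. **Cheeger gradient.** Fix a Cheeger differential structure on $\Omega$ of some dimension $N$: countably many measurable coordinate patches $\Omega_\alpha$ of positive measure covering $\mu$-almost all of $\Omega$, Lipschitz maps $\varphi_\alpha:\Omega_\alpha\to\mathbb R^N$, and measurable inner products $\langle\cdot,\cdot\rangle_x$ on $\mathbb R^N$, so that each $u\in N^{1,p}(\Omega)$ has, for $\mu$-a.e. $x\in\Omega_\alpha$, a vector $\nabla u(x)\in\mathbb R^N$ with $\operatorname{ess\,lim\,sup}_{\Omega_\alpha\ni y\to x}|u(y)-u(x)-\langle\nabla u(x),\varphi_\alpha(y)-\varphi_\alpha(x)\rangle_x|/d(x,y)=0$. The map $u\mapsto\nabla u$ is linear, and the structure is chosen so that $|\nabla u(x)|=\langle\nabla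 u(x),\nabla u(x)\rangle_x^{1/2}$ is comparable, with uniform constants, $\mu$-a.e. to the minimal $p$-weak upper gradient of $u$. $\nabla u$ is well defined for $u\in HN^{1,p}(\Omega)$. **Besov space.** $\dot B^\theta_{p,p}(\partial\Omega)$ is the set of measurable $f$ on $\partial\Omega$ with $$\|f\|^p_{HB^\theta_{p,p}(\partial\Omega)}=\int_{\partial\Omega}\int_{\partial\Omega}\frac{|f(y)-f(x)|^p}{d(y,x)^{\theta p}\,\nu(B(y,d(y,x)))}\,d\nu(x)\,d\nu(y)<\infty,$$ and $HB^\theta_{p,p}(\partial\Omega)=\dot B^\theta_{p,p}(\partial\Omega)/\mathbb R$ (modulo constants), with this norm. $(HB^\theta_{p,p}(\partial\Omega))^*$ is its dual (bounded linear functionals), with dual norm $\|L\|=\sup\{|L(g)|:\|g\|_{HB^\theta_{p,p}(\partial\Omega)}\le1\}$. **Trace (known result of Malý).** When $1<p<\infty$, $\Omega$ is a bounded, locally compact, non-complete metric space that is a uniform domain in its completion, $\mu$ is doubling, $(\Omega,d,\mu)$ supports a $p$-Poincaré inequality, $\nu$ is a Borel regular measure on $\partial\Omega$ that is $\Theta$-codimensional to $\mu$ with $0<\Theta<p$, and $\theta=1-\Theta/p$, there is a surjective bounded linear trace operator $\mathrm{Tr}:N^{1,p}(\Omega)\to\dot B^\theta_{p,p}(\partial\Omega)$, where $\mathrm{Tr}(u)(\xi)$ is characterized for $\nu$-a.e. $\xi$ by $\lim_{r\to0^+}\frac1{\mu(B(\xi,r))}\int_{B(\xi,r)}|u-\mathrm{Tr}(u)(\xi)|\,d\mu=0$.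 It induces a bounded linear operator $\mathrm{Tr}:HN^{1,p}(\Omega)\to HB^\theta_{p,p}(\partial\Omega)$, used here. $\|\mathrm{Tr}\|$ denotes its operator norm with respect to the Cheeger energy: $\|\mathrm{Tr}(u)\|_{HB^\theta_{p,p}(\partial\Omega)}\le\|\mathrm{Tr}\|\,\|\nabla u\|_{L^p(\Omega)}$. **Neumann problem.** For $L\in(HB^\theta_{p,p}(\partial\Omega))^*$, a solution to the Neumann problem with boundary data $L$ is $u_L\in HN^{1,p}(\Omega)$ with $\frac1p\int_\Omega|\nabla u_L|^p\,d\mu-L(\mathrm{Tr}(u_L))\le\frac1p\int_\Omega|\nabla v|^p\,d\mu-L(\mathrm{Tr}(v))$ for all $v\in HN^{1,p}(\Omega)$. *)

theory Defs
  imports "HOL-Analysis.Analysis"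
begin

text \<open>
  The metric space \<open>\<Omega>\<close> is a subset of a complete metric space \<open>'a\<close>, so that its completion is
  \<open>closure \<Omega>\<close>.  The measures \<open>\<mu>\<close> and \<open>\<nu>\<close> satisfy \<open>space \<mu> = \<Omega>\<close> and \<open>space \<nu> = bdry \<Omega>\<close>;
  most definitions below therefore refer to \<open>\<Omega>\<close> as \<open>space \<mu>\<close>.  Functions on \<open>\<Omega>\<close> or on its
  boundary have type \<open>'a \<Rightarrow> real\<close>, and their values elsewhere are irrelevant.
\<close>

definition bdry :: "'a::metric_space set \<Rightarrow> 'a set" where
  "bdry \<Omega> = closure \<Omega> - \<Omega>"

text \<open>Every Borel set is measurable, and every measurable set has a Borel hull of equal measure.
  The sigma-algebra may be anything between the Borel sets and their completion.\<close>

definition borel_regular_on :: "'a::metric_space set \<Rightarrow> 'a measure \<Rightarrow> bool" where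
  "borel_regular_on X M \<longleftrightarrow>
     space M = X \<and> sets (restrict_space borel X) \<subseteq> sets M \<and>
     (\<forall>A\<in>sets M. \<exists>B\<in>sets (restrict_space borel X). A \<subseteq> B \<and> emeasure M B = emeasure M A)"

definition finite_positive_on_balls :: "'a::metric_space measure \<Rightarrow> bool" where
  "finite_positive_on_balls \<mu> \<longleftrightarrow>
     (\<forall>x\<in>space \<mu>. \<forall>r>0. 0 < emeasure \<mu> (ball x r \<inter> space \<mu>) \<and>
                          emeasure \<mu> (ball x r \<inter> space \<mu>) < \<infinity>)"

definition doubling :: "'a::metric_space measure \<Rightarrow> bool" where
  "doubling \<mu> \<longleftrightarrow>
     (\<exists>C::real. 0 < C \<and> (\<forall>x\<in>space \<mu>. \<forall>r>0.
        emeasure \<mu> (ball x (2 * r) \<inter> space \<mu>) \<le> ennreal C * emeasure \<mu> (ball x r \<inter> space \<mu>)))"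

text \<open>Powers of extended nonnegative numbers with a positive exponent.\<close>

definition epowr :: "ennreal \<Rightarrow> real \<Rightarrow> ennreal" where
  "epowr x a = (if x = \<infinity> then \<infinity> else ennreal (enn2real x powr a))"

definition Lp_norm :: "'a measure \<Rightarrow> real \<Rightarrow> ('a \<Rightarrow> ennreal) \<Rightarrow> ennreal" where
  "Lp_norm M p g = epowr (\<integral>\<^sup>+x. epowr (g x) p \<partial>M) (1 / p)"


subsection \<open>Curves\<close>

text \<open>Length of the restriction of \<open>\<gamma>\<close> to \<open>{a..b}\<close>.\<close>

definition curve_length :: "(real \<Rightarrow> 'a::metric_space) \<Rightarrow> real \<Rightarrow> real \<Rightarrow> ennreal" where
  "curve_length \<gamma> a b =
     (SUP ts\<in>{ts. sorted ts \<and> set ts \<subseteq> {a..b}}.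
        \<Sum>i<length ts - 1. ennreal (dist (\<gamma> (ts ! i)) (\<gamma> (ts ! Suc i))))"

definition curves :: "'a::metric_space set \<Rightarrow> (real \<Rightarrow> 'a) set" where
  "curves \<Omega> = {\<gamma>. path \<gamma> \<and> path_image \<gamma> \<subseteq> \<Omega> \<and> curve_length \<gamma> 0 1 < \<infinity> \<and>
                  \<not> (\<forall>t\<in>{0..1}. \<gamma> t = \<gamma> 0)}"

text \<open>The choice of \<open>t\<close> is immaterial: \<open>\<gamma>\<close> is constant between any two choices.\<close>

definition arclength_param :: "(real \<Rightarrow> 'a::metric_space) \<Rightarrow> real \<Rightarrow> 'a" where
  "arclength_param \<gamma> s = \<gamma> (SOME t. t \<in> {0..1} \<and> curve_length \<gamma> 0 t = ennreal s)"

definition line_integral :: "(real \<Rightarrow> 'a::metric_space) \<Rightarrow> ('a \<Rightarrow> ennreal) \<Rightarrow> ennreal" where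
  "line_integral \<gamma> g =
     (\<integral>\<^sup>+s\<in>{0..enn2real (curve_length \<gamma> 0 1)}. g (arclength_param \<gamma> s) \<partial>lborel)"

definition uniform_domain :: "'a::metric_space set \<Rightarrow> bool" where
  "uniform_domain \<Omega> \<longleftrightarrow>
     (\<exists>C::real. 1 \<le> C \<and> (\<forall>x\<in>\<Omega>. \<forall>y\<in>\<Omega>. x \<noteq> y \<longrightarrow>
        (\<exists>\<gamma>. path \<gamma> \<and> path_image \<gamma> \<subseteq> \<Omega> \<and> pathstart \<gamma> = x \<and> pathfinish \<gamma> = y \<and>
             curve_length \<gamma> 0 1 \<le> ennreal (C * dist x y) \<and>
             (\<forall>t\<in>{0..1}. min (curve_length \<gamma> 0 t) (curve_length \<gamma> t 1)
                          \<le> ennreal (C * infdist (\<gamma> t) (bdry \<Omega>))))))"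


subsection \<open>Upper gradients and the Poincare inequality\<close>

definition ug_inequality :: "('a::metric_space \<Rightarrow> real) \<Rightarrow> ('a \<Rightarrow> ennreal) \<Rightarrow> (real \<Rightarrow> 'a) \<Rightarrow> bool" where
  "ug_inequality u g \<gamma> \<longleftrightarrow>
     ennreal \<bar>u (pathfinish \<gamma>) - u (pathstart \<gamma>)\<bar> \<le> line_integral \<gamma> g"

definition upper_gradient :: "'a::metric_space set \<Rightarrow> ('a \<Rightarrow> real) \<Rightarrow> ('a \<Rightarrow> ennreal) \<Rightarrow> bool" where
  "upper_gradient \<Omega> u g \<longleftrightarrow>
     g \<in> borel_measurable (restrict_space borel \<Omega>) \<and> (\<forall>\<gamma>\<in>curves \<Omega>. ug_inequality u g \<gamma>)"

definition exceptional_family :: "'a::metric_space measure \<Rightarrow> real \<Rightarrow> (real \<Rightarrow> 'a) set \<Rightarrow> bool" where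
  "exceptional_family \<mu> p \<Gamma> \<longleftrightarrow>
     (\<exists>\<rho>\<in>borel_measurable (restrict_space borel (space \<mu>)).
        Lp_norm \<mu> p \<rho> < \<infinity> \<and> (\<forall>\<gamma>\<in>\<Gamma>. line_integral \<gamma> \<rho> = \<infinity>))"

definition weak_upper_gradient ::
    "'a::metric_space measure \<Rightarrow> real \<Rightarrow> ('a \<Rightarrow> real) \<Rightarrow> ('a \<Rightarrow> ennreal) \<Rightarrow> bool" where
  "weak_upper_gradient \<mu> p u g \<longleftrightarrow>
     g \<in> borel_measurable (restrict_space borel (space \<mu>)) \<and>
     (\<exists>\<Gamma>. exceptional_family \<mu> p \<Gamma> \<and> (\<forall>\<gamma>\<in>curves (space \<mu>) - \<Gamma>. ug_inequality u g \<gamma>))"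

definition minimal_weak_upper_gradient ::
    "'a::metric_space measure \<Rightarrow> real \<Rightarrow> ('a \<Rightarrow> real) \<Rightarrow> ('a \<Rightarrow> ennreal) \<Rightarrow> bool" where
  "minimal_weak_upper_gradient \<mu> p u g \<longleftrightarrow>
     weak_upper_gradient \<mu> p u g \<and> Lp_norm \<mu> p g < \<infinity> \<and>
     (\<forall>h. weak_upper_gradient \<mu> p u h \<and> Lp_norm \<mu> p h < \<infinity> \<longrightarrow> (AE x in \<mu>. g x \<le> h x))"

text \<open>The inequality is required for measurable \<open>u\<close> that are integrable on the ball in question,
  so that its mean value \<open>m\<close> over \<open>B\<close> makes sense.\<close>

definition poincare_inequality :: "'a::metric_space measure \<Rightarrow> real \<Rightarrow> bool" where
  "poincare_inequality \<mu> p \<longleftrightarrow>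
     (\<exists>C::real. \<exists>c::real. 0 < C \<and> 1 \<le> c \<and>
       (\<forall>x\<in>space \<mu>. \<forall>r>0. \<forall>u g.
          let B = ball x r \<inter> space \<mu>; B' = ball x (c * r) \<inter> space \<mu>;
              m = (LINT z:B|\<mu>. u z) / measure \<mu> B
          in u \<in> borel_measurable \<mu> \<and> set_integrable \<mu> B u \<and> upper_gradient (space \<mu>) u g \<longrightarrow>
             (\<integral>\<^sup>+z\<in>B. ennreal \<bar>u z - m\<bar> \<partial>\<mu>) / emeasure \<mu> B
               \<le> ennreal (C * r) * epowr ((\<integral>\<^sup>+z\<in>B'. epowr (g z) p \<partial>\<mu>) / emeasure \<mu> B') (1 / p)))"

definition codimensional :: "real \<Rightarrow> 'a::metric_space measure \<Rightarrow> 'a measure \<Rightarrow> bool" where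
  "codimensional \<Theta> \<nu> \<mu> \<longleftrightarrow>
     (\<exists>C::real. 0 < C \<and>
       (\<forall>x\<in>bdry (space \<mu>). \<forall>r. 0 < r \<and> r < 2 * diameter (bdry (space \<mu>)) \<longrightarrow>
          ennreal (r powr (- \<Theta>) / C) * emeasure \<mu> (ball x r \<inter> space \<mu>)
            \<le> emeasure \<nu> (ball x r \<inter> bdry (space \<mu>)) \<and>
          emeasure \<nu> (ball x r \<inter> bdry (space \<mu>))
            \<le> ennreal (C * r powr (- \<Theta>)) * emeasure \<mu> (ball x r \<inter> space \<mu>)))"


subsection \<open>Quotient spaces\<close>

text \<open>The common value of \<open>F\<close> on the members of an equivalence class.\<close>

definition on_class :: "('b \<Rightarrow> 'c) \<Rightarrow> 'b set \<Rightarrow> 'c" where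
  "on_class F U = the_elem (F ` U)"


subsection \<open>Sobolev spaces\<close>

text \<open>Members of \<open>N1p\<close> are everywhere defined functions; functions whose difference has norm zero
  are identified in \<open>HN_rel\<close>, together with functions that differ by a constant.\<close>

definition N1p :: "'a::metric_space measure \<Rightarrow> real \<Rightarrow> ('a \<Rightarrow> real) set" where
  "N1p \<mu> p = {u \<in> borel_measurable \<mu>.
     Lp_norm \<mu> p (\<lambda>x. ennreal \<bar>u x\<bar>) < \<infinity> \<and>
     (\<exists>g. weak_upper_gradient \<mu> p u g \<and> Lp_norm \<mu> p g < \<infinity>)}"

definition N1p_norm :: "'a::metric_space measure \<Rightarrow> real \<Rightarrow> ('a \<Rightarrow> real) \<Rightarrow> ennreal" where
  "N1p_norm \<mu> p u =
     Lp_norm \<mu> p (\<lambda>x. ennreal \<bar>u x\<bar>) + (INF g\<in>{g. weak_upper_gradient \<mu> p u g}. Lp_norm \<mu> p g)"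

definition HN_rel :: "'a::metric_space measure \<Rightarrow> real \<Rightarrow> (('a \<Rightarrow> real) \<times> ('a \<Rightarrow> real)) set" where
  "HN_rel \<mu> p = {(u, v). u \<in> N1p \<mu> p \<and> v \<in> N1p \<mu> p \<and> (\<exists>c. N1p_norm \<mu> p (\<lambda>x. u x - v x - c) = 0)}"

definition HN :: "'a::metric_space measure \<Rightarrow> real \<Rightarrow> ('a \<Rightarrow> real) set set" where
  "HN \<mu> p = N1p \<mu> p // HN_rel \<mu> p"


subsection \<open>Cheeger differential structures\<close>

definition ess_limsup_at ::
    "'a::metric_space measure \<Rightarrow> 'a set \<Rightarrow> 'a \<Rightarrow> ('a \<Rightarrow> ennreal) \<Rightarrow> ennreal" where
  "ess_limsup_at M A x f =
     (INF r\<in>{0<..}. Inf {z. AE y in M. y \<in> A \<and> 0 < dist y x \<and> dist y x < r \<longrightarrow> f y \<le> z})"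

definition inner_product_form :: "('b::real_vector \<Rightarrow> 'b \<Rightarrow> real) \<Rightarrow> bool" where
  "inner_product_form h \<longleftrightarrow> bilinear h \<and> (\<forall>v w. h v w = h w v) \<and> (\<forall>v. v \<noteq> 0 \<longrightarrow> 0 < h v v)"

definition grad_length ::
    "('a \<Rightarrow> real ^ 'n \<Rightarrow> real ^ 'n \<Rightarrow> real) \<Rightarrow> (('a \<Rightarrow> real) \<Rightarrow> 'a \<Rightarrow> real ^ 'n) \<Rightarrow>
     ('a \<Rightarrow> real) \<Rightarrow> 'a \<Rightarrow> real" where
  "grad_length ip grad u x = sqrt (ip x (grad u x) (grad u x))"

text \<open>The patches are \<open>patch \<alpha>\<close> for \<open>\<alpha> \<in> I\<close>, with coordinate maps \<open>chart \<alpha>\<close>; \<open>ip x\<close> is the inner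
  product at \<open>x\<close>, and \<open>grad u x\<close> is the vector \<open>\<nabla>u(x)\<close>.  The operator \<open>grad\<close> is part of the
  structure because the differentiability condition need not determine it.\<close>

definition cheeger_structure ::
    "'a::metric_space measure \<Rightarrow> real \<Rightarrow> nat set \<Rightarrow> (nat \<Rightarrow> 'a set) \<Rightarrow> (nat \<Rightarrow> 'a \<Rightarrow> real ^ 'n) \<Rightarrow>
     ('a \<Rightarrow> real ^ 'n \<Rightarrow> real ^ 'n \<Rightarrow> real) \<Rightarrow> (('a \<Rightarrow> real) \<Rightarrow> 'a \<Rightarrow> real ^ 'n) \<Rightarrow> bool" where
  "cheeger_structure \<mu> p I patch chart ip grad \<longleftrightarrow>
     (\<forall>\<alpha>\<in>I. patch \<alpha> \<in> sets \<mu> \<and> 0 < emeasure \<mu> (patch \<alpha>) \<and>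
             (\<exists>K. K-lipschitz_on (patch \<alpha>) (chart \<alpha>))) \<and>
     (AE x in \<mu>. x \<in> (\<Union>\<alpha>\<in>I. patch \<alpha>)) \<and>
     (\<forall>x\<in>space \<mu>. inner_product_form (ip x)) \<and>
     (\<forall>v w. (\<lambda>x. ip x v w) \<in> borel_measurable \<mu>) \<and>
     (\<forall>u\<in>N1p \<mu> p. grad u \<in> borel_measurable \<mu> \<and>
        (\<forall>\<alpha>\<in>I. AE x in \<mu>. x \<in> patch \<alpha> \<longrightarrow>
           ess_limsup_at \<mu> (patch \<alpha>) x
             (\<lambda>y. ennreal (\<bar>u y - u x - ip x (grad u x) (chart \<alpha> y - chart \<alpha> x)\<bar> / dist x y)) = 0)) \<and>
     (\<forall>u\<in>N1p \<mu> p. \<forall>v\<in>N1p \<mu> p. \<forall>a b. AE x in \<mu>.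
        grad (\<lambda>z. a * u z + b * v z) x = a *\<^sub>R grad u x + b *\<^sub>R grad v x) \<and>
     (\<exists>C::real. 1 \<le> C \<and> (\<forall>u\<in>N1p \<mu> p. \<exists>g. minimal_weak_upper_gradient \<mu> p u g \<and>
        (AE x in \<mu>. ennreal (grad_length ip grad u x) \<le> ennreal C * g x \<and>
                    g x \<le> ennreal (C * grad_length ip grad u x))))"

definition cheeger_energy ::
    "'a::metric_space measure \<Rightarrow> real \<Rightarrow> ('a \<Rightarrow> real ^ 'n \<Rightarrow> real ^ 'n \<Rightarrow> real) \<Rightarrow>
     (('a \<Rightarrow> real) \<Rightarrow> 'a \<Rightarrow> real ^ 'n) \<Rightarrow> ('a \<Rightarrow> real) set \<Rightarrow> real" where
  "cheeger_energy \<mu> p ip grad U = on_class (\<lambda>u. LINT x|\<mu>. grad_length ip grad u x powr p) U"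


subsection \<open>Besov spaces\<close>

text \<open>The diagonal does not contribute to the integral, since \<open>0 / 0 = 0\<close> in \<open>ennreal\<close>.\<close>

definition besov_energy :: "'a::metric_space measure \<Rightarrow> real \<Rightarrow> real \<Rightarrow> ('a \<Rightarrow> real) \<Rightarrow> ennreal" where
  "besov_energy \<nu> p \<theta> f =
     (\<integral>\<^sup>+y. (\<integral>\<^sup>+x. ennreal (\<bar>f y - f x\<bar> powr p) /
                (ennreal (dist y x powr (\<theta> * p)) * emeasure \<nu> (ball y (dist y x) \<inter> space \<nu>)) \<partial>\<nu>) \<partial>\<nu>)"

definition Besov :: "'a::metric_space measure \<Rightarrow> real \<Rightarrow> real \<Rightarrow> ('a \<Rightarrow> real) set" where
  "Besov \<nu> p \<theta> = {f \<in> borel_measurable \<nu>. besov_energy \<nu> p \<theta> f < \<infinity>}"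

definition besov_norm :: "'a::metric_space measure \<Rightarrow> real \<Rightarrow> real \<Rightarrow> ('a \<Rightarrow> real) \<Rightarrow> real" where
  "besov_norm \<nu> p \<theta> f = enn2real (besov_energy \<nu> p \<theta> f) powr (1 / p)"

definition HB_rel ::
    "'a::metric_space measure \<Rightarrow> real \<Rightarrow> real \<Rightarrow> (('a \<Rightarrow> real) \<times> ('a \<Rightarrow> real)) set" where
  "HB_rel \<nu> p \<theta> =
     {(f, g). f \<in> Besov \<nu> p \<theta> \<and> g \<in> Besov \<nu> p \<theta> \<and> (\<exists>c. AE x in \<nu>. f x - g x = c)}"

definition HB :: "'a::metric_space measure \<Rightarrow> real \<Rightarrow> real \<Rightarrow> ('a \<Rightarrow> real) set set" where
  "HB \<nu> p \<theta> = Besov \<nu> p \<theta> // HB_rel \<nu> p \<theta>"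

definition HB_class ::
    "'a::metric_space measure \<Rightarrow> real \<Rightarrow> real \<Rightarrow> ('a \<Rightarrow> real) \<Rightarrow> ('a \<Rightarrow> real) set" where
  "HB_class \<nu> p \<theta> f = HB_rel \<nu> p \<theta> `` {f}"

definition HB_norm :: "'a::metric_space measure \<Rightarrow> real \<Rightarrow> real \<Rightarrow> ('a \<Rightarrow> real) set \<Rightarrow> real" where
  "HB_norm \<nu> p \<theta> F = on_class (besov_norm \<nu> p \<theta>) F"

definition HB_dual ::
    "'a::metric_space measure \<Rightarrow> real \<Rightarrow> real \<Rightarrow> (('a \<Rightarrow> real) set \<Rightarrow> real) set" where
  "HB_dual \<nu> p \<theta> = {L \<in> extensional (HB \<nu> p \<theta>).
     (\<forall>f\<in>Besov \<nu> p \<theta>. \<forall>g\<in>Besov \<nu> p \<theta>. \<forall>a b.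
        L (HB_class \<nu> p \<theta> (\<lambda>x. a * f x + b * g x))
          = a * L (HB_class \<nu> p \<theta> f) + b * L (HB_class \<nu> p \<theta> g)) \<and>
     (\<exists>C. \<forall>F\<in>HB \<nu> p \<theta>. \<bar>L F\<bar> \<le> C * HB_norm \<nu> p \<theta> F)}"

definition HB_dual_norm ::
    "'a::metric_space measure \<Rightarrow> real \<Rightarrow> real \<Rightarrow> (('a \<Rightarrow> real) set \<Rightarrow> real) \<Rightarrow> real" where
  "HB_dual_norm \<nu> p \<theta> L = Sup {\<bar>L F\<bar> |F. F \<in> HB \<nu> p \<theta> \<and> HB_norm \<nu> p \<theta> F \<le> 1}"


subsection \<open>The trace operator\<close>

text \<open>Linearity and surjectivity are understood up to \<open>\<nu>\<close>-null sets.\<close>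

definition trace_operator ::
    "'a::metric_space measure \<Rightarrow> 'a measure \<Rightarrow> real \<Rightarrow> real \<Rightarrow>
     (('a \<Rightarrow> real) \<Rightarrow> 'a \<Rightarrow> real) \<Rightarrow> bool" where
  "trace_operator \<mu> \<nu> p \<theta> Tr \<longleftrightarrow>
     (\<forall>u\<in>N1p \<mu> p. Tr u \<in> Besov \<nu> p \<theta>) \<and>
     (\<forall>u\<in>N1p \<mu> p. AE \<xi> in \<nu>.
        ((\<lambda>r. (\<integral>\<^sup>+x\<in>ball \<xi> r \<inter> space \<mu>. ennreal \<bar>u x - Tr u \<xi>\<bar> \<partial>\<mu>)
                / emeasure \<mu> (ball \<xi> r \<inter> space \<mu>)) \<longlongrightarrow> 0) (at_right 0)) \<and>
     (\<forall>u\<in>N1p \<mu> p. \<forall>v\<in>N1p \<mu> p. \<forall>a b. AE \<xi> in \<nu>.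
        Tr (\<lambda>x. a * u x + b * v x) \<xi> = a * Tr u \<xi> + b * Tr v \<xi>) \<and>
     (\<exists>C::real. \<forall>u\<in>N1p \<mu> p. ennreal (besov_norm \<nu> p \<theta> (Tr u)) \<le> ennreal C * N1p_norm \<mu> p u) \<and>
     (\<forall>f\<in>Besov \<nu> p \<theta>. \<exists>u\<in>N1p \<mu> p. AE \<xi> in \<nu>. Tr u \<xi> = f \<xi>)"

definition Tr_HN ::
    "'a::metric_space measure \<Rightarrow> real \<Rightarrow> real \<Rightarrow> (('a \<Rightarrow> real) \<Rightarrow> 'a \<Rightarrow> real) \<Rightarrow>
     ('a \<Rightarrow> real) set \<Rightarrow> ('a \<Rightarrow> real) set" where
  "Tr_HN \<nu> p \<theta> Tr U = on_class (\<lambda>u. HB_class \<nu> p \<theta> (Tr u)) U"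

text \<open>The operator norm with respect to the norm \<open>\<lambda>U. (cheeger_energy \<mu> p ip grad U) powr (1 / p)\<close>
  on \<open>HN\<close>.\<close>

definition Tr_norm ::
    "'a::metric_space measure \<Rightarrow> 'a measure \<Rightarrow> real \<Rightarrow> real \<Rightarrow>
     ('a \<Rightarrow> real ^ 'n \<Rightarrow> real ^ 'n \<Rightarrow> real) \<Rightarrow> (('a \<Rightarrow> real) \<Rightarrow> 'a \<Rightarrow> real ^ 'n) \<Rightarrow>
     (('a \<Rightarrow> real) \<Rightarrow> 'a \<Rightarrow> real) \<Rightarrow> real" where
  "Tr_norm \<mu> \<nu> p \<theta> ip grad Tr =
     Sup {HB_norm \<nu> p \<theta> (Tr_HN \<nu> p \<theta> Tr U) |U.
            U \<in> HN \<mu> p \<and> cheeger_energy \<mu> p ip grad U powr (1 / p) \<le> 1}"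


subsection \<open>The Neumann problem\<close>

definition neumann_solution ::
    "'a::metric_space measure \<Rightarrow> 'a measure \<Rightarrow> real \<Rightarrow> real \<Rightarrow>
     ('a \<Rightarrow> real ^ 'n \<Rightarrow> real ^ 'n \<Rightarrow> real) \<Rightarrow> (('a \<Rightarrow> real) \<Rightarrow> 'a \<Rightarrow> real ^ 'n) \<Rightarrow>
     (('a \<Rightarrow> real) \<Rightarrow> 'a \<Rightarrow> real) \<Rightarrow> (('a \<Rightarrow> real) set \<Rightarrow> real) \<Rightarrow> ('a \<Rightarrow> real) set \<Rightarrow> bool" where
  "neumann_solution \<mu> \<nu> p \<theta> ip grad Tr L U \<longleftrightarrow>
     U \<in> HN \<mu> p \<and>
     (\<forall>V\<in>HN \<mu> p. (1 / p) * cheeger_energy \<mu> p ip grad U - L (Tr_HN \<nu> p \<theta> Tr U)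
                  \<le> (1 / p) * cheeger_energy \<mu> p ip grad V - L (Tr_HN \<nu> p \<theta> Tr V))"

definition NtD ::
    "'a::metric_space measure \<Rightarrow> 'a measure \<Rightarrow> real \<Rightarrow> real \<Rightarrow>
     ('a \<Rightarrow> real ^ 'n \<Rightarrow> real ^ 'n \<Rightarrow> real) \<Rightarrow> (('a \<Rightarrow> real) \<Rightarrow> 'a \<Rightarrow> real ^ 'n) \<Rightarrow>
     (('a \<Rightarrow> real) \<Rightarrow> 'a \<Rightarrow> real) \<Rightarrow> (('a \<Rightarrow> real) set \<Rightarrow> real) \<Rightarrow> ('a \<Rightarrow> real) set" where
  "NtD \<mu> \<nu> p \<theta> ip grad Tr L =
     Tr_HN \<nu> p \<theta> Tr (THE U. neumann_solution \<mu> \<nu> p \<theta> ip grad Tr L U)"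

text \<open>The supremum is taken in \<open>ennreal\<close>: it is \<open>0\<close> if the dual space is trivial, and it would be
  \<open>\<infinity>\<close> if the map were unbounded on the unit sphere.\<close>

definition NtD_norm ::
    "'a::metric_space measure \<Rightarrow> 'a measure \<Rightarrow> real \<Rightarrow> real \<Rightarrow>
     ('a \<Rightarrow> real ^ 'n \<Rightarrow> real ^ 'n \<Rightarrow> real) \<Rightarrow> (('a \<Rightarrow> real) \<Rightarrow> 'a \<Rightarrow> real ^ 'n) \<Rightarrow>
     (('a \<Rightarrow> real) \<Rightarrow> 'a \<Rightarrow> real) \<Rightarrow> ennreal" where
  "NtD_norm \<mu> \<nu> p \<theta> ip grad Tr =
     (SUP L\<in>{L \<in> HB_dual \<nu> p \<theta>. HB_dual_norm \<nu> p \<theta> L = 1}.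
        ennreal (HB_norm \<nu> p \<theta> (NtD \<mu> \<nu> p \<theta> ip grad Tr L)))"

end

theory Submission
  imports Defs
begin

text \<open>
  Chaining the Poincare inequality over dyadic balls gives \<open>\<integral>\<bar>u - u\<^sub>\<Omega>\<bar>\<^sup>p \<le> C \<integral>\<bar>\<nabla>u\<bar>\<^sup>p\<close> on the bounded
  space \<open>\<Omega>\<close>.  Hence the Cheeger energy controls the Newtonian norm modulo constants, the trace is
  bounded with respect to it, and the functional \<open>J u = E u / p - L (Tr u)\<close> is coercive.  The energy
  is uniformly convex, so a minimizing sequence is Cauchy and, the Newtonian space being complete,
  converges to the unique minimizer.  Comparing with \<open>0\<close>, \<open>E u / p \<le> L (Tr u) \<le> \<parallel>L\<parallel> \<parallel>Tr\<parallel> (E u)\<^sup>1\<^sup>/\<^sup>p\<close>,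
  which bounds \<open>E u\<close> and then \<open>\<parallel>Tr u\<parallel> \<le> \<parallel>Tr\<parallel> (E u)\<^sup>1\<^sup>/\<^sup>p\<close> with the constant \<open>p\<close> in place of \<open>2 p\<close>.
\<close>

subsection \<open>Curves\<close>

text \<open>Two gaps shape the work. The assumed Poincare inequality has an L^1 oscillation on its
  left side and speaks of true upper gradients, while energy and trace are measured in L^p and
  through weak ones. The gain from L^1 to L^p comes from the chain itself: each link is bounded
  pointwise by its radius times the p-th root of a mean of \<open>g powr p\<close>, averaging at a
  fixed radius is bounded on L^1 by Fubini and doubling, and the decay of the radii sums the links.
  Weak upper gradients become true ones by adding a small multiple of a function with infinite
  integral on all exceptional curves. The second gap: members of \<open>N1p\<close> are defined
  everywhere, and a change on a null set may destroy an inequality along curves. A limit in L^p is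
  too coarse for this, so a pointwise limit is taken and controlled along curves. The energy is only
  comparable with the minimal weak upper gradient, but it is built from inner products, and its
  uniform convexity comes from there.\<close>

lemma epowr_0 [simp]: "epowr 0 a = 0"
  by (simp add: epowr_def)

lemma epowr_top [simp]: "epowr top a = top"
  by (simp add: epowr_def)

lemma epowr_ennreal: "0 \<le> x \<Longrightarrow> epowr (ennreal x) a = ennreal (x powr a)"
  by (simp add: epowr_def)

lemma epowr_1 [simp]: "epowr x 1 = x"
  by (cases x) (auto simp: epowr_ennreal)

lemma epowr_eq_0_iff [simp]: "epowr x a = 0 \<longleftrightarrow> x = 0"
  by (cases x) (auto simp: epowr_ennreal)

lemma epowr_eq_top_iff [simp]: "epowr x a = top \<longleftrightarrow> x = top"
  by (cases x) (auto simp: epowr_ennreal)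

lemma epowr_less_top_iff [simp]: "epowr x a < top \<longleftrightarrow> x < top"
  by (simp add: top.not_eq_extremum[symmetric])

lemma epowr_mono: "0 \<le> a \<Longrightarrow> x \<le> y \<Longrightarrow> epowr x a \<le> epowr y a"
  by (cases x; cases y) (auto simp: epowr_ennreal top_unique intro!: ennreal_leI powr_mono2)

lemma epowr_epowr: "epowr (epowr x a) b = epowr x (a * b)"
  by (cases x) (auto simp: epowr_ennreal powr_powr)

lemma epowr_mult: "epowr (x * y) a = epowr x a * epowr y a"
proof (cases "x = top \<or> y = top")
  case True
  then show ?thesis by (auto simp: ennreal_top_mult ennreal_mult_top)
next
  case False
  then show ?thesis
    by (cases x; cases y) (auto simp: epowr_ennreal ennreal_mult[symmetric] powr_mult)
qed

text \<open>The sum is at most twice the larger term. The crude constant suffices for all finiteness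
  claims about p-th powers; the factor \<open>2 powr p\<close> in later constants comes from
  here.\<close>

lemma epowr_add_le:
  assumes "0 \<le> a"
  shows "epowr (x + y) a \<le> ennreal (2 powr a) * (epowr x a + epowr y a)"
proof -
  have "epowr (x + y) a \<le> epowr (2 * max x y) a"
    by (intro epowr_mono[OF assms]) (metis add_mono max.cobounded1 max.cobounded2 mult_2)
  also have "\<dots> = ennreal (2 powr a) * epowr (max x y) a"
    by (subst epowr_mult) (metis epowr_ennreal ennreal_numeral zero_le_numeral)
  also have "\<dots> \<le> ennreal (2 powr a) * (epowr x a + epowr y a)"
    by (intro mult_left_mono) (auto simp: max_def)
  finally show ?thesis .
qed

lemma epowr_measurable [measurable]:
  "f \<in> borel_measurable M \<Longrightarrow> (\<lambda>x. epowr (f x) a) \<in> borel_measurable M"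
proof -
  assume f [measurable]: "f \<in> borel_measurable M"
  have "{x \<in> space M. f x = top} = f -` {top} \<inter> space M" by auto
  then have "{x \<in> space M. f x = top} \<in> sets M"
    using measurable_sets[OF f, of "{top}"] by simp
  then show ?thesis
    unfolding epowr_def infinity_ennreal_def by (intro measurable_If) auto
qed

lemma le_of_epowr_le:
  assumes "0 < a" "epowr x a \<le> epowr y a"
  shows "x \<le> y"
proof -
  have "epowr (epowr x a) (1 / a) \<le> epowr (epowr y a) (1 / a)"
    by (rule epowr_mono) (use assms in auto)
  moreover have "epowr (epowr z a) (1 / a) = z" for z
    using assms(1) by (simp add: epowr_epowr)
  ultimately show ?thesis by simp
qed

lemma epowr_Lp_norm: "p \<noteq> 0 \<Longrightarrow> epowr (Lp_norm M p g) p = (\<integral>\<^sup>+x. epowr (g x) p \<partial>M)"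
  by (simp add: Lp_norm_def epowr_epowr)

lemma Lp_norm_less_top_iff: "Lp_norm M p g < top \<longleftrightarrow> (\<integral>\<^sup>+x. epowr (g x) p \<partial>M) < top"
  by (simp add: Lp_norm_def)

section \<open>Length of curves and its continuity in the endpoints\<close>

lemma curve_length_same [simp]: "curve_length \<gamma> a a = 0"
proof -
  have "(\<Sum>i<length ts - 1. ennreal (dist (\<gamma> (ts ! i)) (\<gamma> (ts ! Suc i)))) = 0"
    if "set ts \<subseteq> {a..a}" for ts
  proof (intro sum.neutral ballI)
    fix i assume "i \<in> {..<length ts - 1}"
    then have "ts ! i \<in> set ts" "ts ! Suc i \<in> set ts" by auto
    then have "ts ! i = a" "ts ! Suc i = a" using that by auto
    then show "ennreal (dist (\<gamma> (ts ! i)) (\<gamma> (ts ! Suc i))) = 0" by simp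
  qed
  then have "curve_length \<gamma> a a \<le> 0"
    unfolding curve_length_def by (intro SUP_least) auto
  then show ?thesis by simp
qed

text \<open>The inner sum of \<open>curve_length\<close>, named so that it can be unfolded link by
  link in list inductions.\<close>

definition chain_length :: "(real \<Rightarrow> 'a::metric_space) \<Rightarrow> real list \<Rightarrow> ennreal" where
  "chain_length \<gamma> ts = (\<Sum>i<length ts - 1. ennreal (dist (\<gamma> (ts ! i)) (\<gamma> (ts ! Suc i))))"

lemma chain_length_simps [simp]:
  "chain_length \<gamma> [] = 0" "chain_length \<gamma> [a] = 0"
  "chain_length \<gamma> (a # b # ts) = ennreal (dist (\<gamma> a) (\<gamma> b)) + chain_length \<gamma> (b # ts)"
proof -
  show "chain_length \<gamma> (a # b # ts) = ennreal (dist (\<gamma> a) (\<gamma> b)) + chain_length \<gamma> (b # ts)"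
    unfolding chain_length_def by (simp add: sum.lessThan_Suc_shift del: sum.lessThan_Suc)
qed (simp_all add: chain_length_def)

lemma chain_length_append:
  "chain_length \<gamma> (xs @ t # ys) = chain_length \<gamma> (xs @ [t]) + chain_length \<gamma> (t # ys)"
  by (induction xs rule: induct_list012) (auto simp: add.assoc)

text \<open>Only the link from the last point of \<open>xs\<close> to the first point of
  \<open>ys\<close> is missing on the left.\<close>

lemma chain_length_le_append:
  "chain_length \<gamma> xs + chain_length \<gamma> ys \<le> chain_length \<gamma> (xs @ ys)"
proof (induction xs rule: induct_list012)
  case (2 x)
  then show ?case by (cases ys) auto
next
  case (3 x y zs)
  then show ?case by (simp add: add.assoc add_left_mono)
qed auto

text \<open>By the triangle inequality at the inserted point; refining a partition never shortens
  the chain.\<close>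

lemma chain_length_le_insert:
  "chain_length \<gamma> (xs @ ys) \<le> chain_length \<gamma> (xs @ t # ys)"
proof (induction xs rule: induct_list012)
  case 1
  then show ?case by (cases ys) auto
next
  case (2 x)
  show ?case
  proof (cases ys)
    case (Cons y zs)
    have "ennreal (dist (\<gamma> x) (\<gamma> y)) \<le> ennreal (dist (\<gamma> x) (\<gamma> t)) + ennreal (dist (\<gamma> t) (\<gamma> y))"
      by (simp flip: ennreal_plus add: dist_triangle)
    then show ?thesis using Cons by (simp add: add.assoc[symmetric] add_right_mono)
  qed auto
next
  case (3 x y zs)
  then show ?case by (simp add: add_left_mono)
qed

lemma curve_length_alt:
  "curve_length \<gamma> a b = (SUP ts\<in>{ts. sorted ts \<and> set ts \<subseteq> {a..b}}. chain_length \<gamma> ts)"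
  unfolding curve_length_def chain_length_def ..

lemma chain_length_le_curve_length:
  "sorted ts \<Longrightarrow> set ts \<subseteq> {a..b} \<Longrightarrow> chain_length \<gamma> ts \<le> curve_length \<gamma> a b"
  unfolding curve_length_alt by (intro SUP_upper) auto

lemma curve_length_mono: "a' \<le> a \<Longrightarrow> b \<le> b' \<Longrightarrow> curve_length \<gamma> a b \<le> curve_length \<gamma> a' b'"
  unfolding curve_length_alt by (intro SUP_subset_mono) auto

lemma dist_le_curve_length:
  "a \<le> b \<Longrightarrow> ennreal (dist (\<gamma> a) (\<gamma> b)) \<le> curve_length \<gamma> a b"
  using chain_length_le_curve_length[of "[a, b]" a b \<gamma>] by simp

text \<open>Inserting \<open>b\<close> into a partition of \<open>{a..c}\<close> splits it in two
  without shortening the chain; conversely, two partitions concatenate.\<close>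

lemma curve_length_add:
  assumes "a \<le> b" "b \<le> c"
  shows "curve_length \<gamma> a b + curve_length \<gamma> b c = curve_length \<gamma> a c"
proof (rule antisym)
  show "curve_length \<gamma> a c \<le> curve_length \<gamma> a b + curve_length \<gamma> b c"
    unfolding curve_length_alt[of \<gamma> a c]
  proof (intro SUP_least)
    fix ts assume ts: "ts \<in> {ts. sorted ts \<and> set ts \<subseteq> {a..c}}"
    define xs ys where "xs = takeWhile (\<lambda>t. t \<le> b) ts" and "ys = dropWhile (\<lambda>t. t \<le> b) ts"
    have ts_eq: "ts = xs @ ys" by (simp add: xs_def ys_def)
    have xs: "sorted xs" "set xs \<subseteq> {a..b}"
      using ts by (auto simp: xs_def sorted_takeWhile dest!: set_takeWhileD)
    have ys: "sorted ys" "set ys \<subseteq> {a..c}"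
      using ts by (auto simp: ys_def sorted_dropWhile dest!: set_dropWhileD)
    have yb: "\<forall>t\<in>set ys. b \<le> t"
    proof (cases ys)
      case (Cons y zs)
      then have "\<not> y \<le> b" unfolding ys_def by (metis dropWhile_eq_Cons_conv)
      then show ?thesis using ys(1) Cons by auto
    qed auto
    have "chain_length \<gamma> ts \<le> chain_length \<gamma> (xs @ b # ys)"
      unfolding ts_eq by (rule chain_length_le_insert)
    also have "\<dots> = chain_length \<gamma> (xs @ [b]) + chain_length \<gamma> (b # ys)"
      by (rule chain_length_append)
    also have "\<dots> \<le> curve_length \<gamma> a b + curve_length \<gamma> b c"
      using xs ys yb assms
      by (intro add_mono chain_length_le_curve_length) (fastforce simp: sorted_append)+
    finally show "chain_length \<gamma> ts \<le> \<dots>" .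
  qed
  show "curve_length \<gamma> a b + curve_length \<gamma> b c \<le> curve_length \<gamma> a c"
  proof -
    have ne: "{ts. sorted ts \<and> set ts \<subseteq> {a..b}} \<noteq> ({}::real list set)" for a b :: real
      by (auto intro!: exI[of _ "[]"])
    have "chain_length \<gamma> xs + curve_length \<gamma> b c \<le> curve_length \<gamma> a c"
      if "sorted xs" "set xs \<subseteq> {a..b}" for xs
      unfolding curve_length_alt[of \<gamma> b c]
    proof (subst ennreal_SUP_add_right)
      show "(SUP ts\<in>{ts. sorted ts \<and> set ts \<subseteq> {b..c}}. chain_length \<gamma> xs + chain_length \<gamma> ts)
            \<le> curve_length \<gamma> a c"
      proof (intro SUP_least order_trans[OF chain_length_le_append])
        fix ts assume "ts \<in> {ts. sorted ts \<and> set ts \<subseteq> {b..c}}"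
        then show "chain_length \<gamma> (xs @ ts) \<le> curve_length \<gamma> a c"
          using that assms by (intro chain_length_le_curve_length) (fastforce simp: sorted_append)+
      qed
    qed (rule ne)
    then show ?thesis
      unfolding curve_length_alt[of \<gamma> a b]
      by (subst ennreal_SUP_add_left[symmetric, OF ne]) (auto intro!: SUP_least)
  qed
qed

lemma sorted_map_of_mono: "sorted ts \<Longrightarrow> mono f \<Longrightarrow> sorted (map f ts)"
  by (auto simp: sorted_iff_nth_mono mono_def)

lemma chain_length_map_tendsto:
  assumes "\<And>t. t \<in> set ts \<Longrightarrow> ((\<lambda>s. \<gamma> (f s t)) \<longlongrightarrow> \<gamma> (f s0 t)) F"
  shows "((\<lambda>s. chain_length \<gamma> (map (f s) ts)) \<longlongrightarrow> chain_length \<gamma> (map (f s0) ts)) F"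
  using assms
proof (induction ts rule: induct_list012)
  case (3 x y zs)
  then show ?case by (auto intro!: tendsto_add tendsto_ennrealI tendsto_dist)
qed auto

text \<open>With \<open>f s = min s\<close> or \<open>f s = max s\<close>, a partition of the interval ending or starting at \<open>t\<close> is moved
  into the one ending or starting at \<open>s\<close>; this shows that the length is lower semicontinuous in
  either endpoint.\<close>

lemma eventually_less_chain_length_map:
  assumes \<gamma>: "continuous_on {a..b} \<gamma>" and t: "t \<in> {a..b}"
    and f: "\<And>r. continuous_on {a..b} (\<lambda>s. f s r)" "\<And>s r. s \<in> {a..b} \<Longrightarrow> r \<in> {a..b} \<Longrightarrow> f s r \<in> {a..b}"
    and ts: "set ts \<subseteq> {a..b}" "map (f t) ts = ts" and c: "c < chain_length \<gamma> ts"
  shows "eventually (\<lambda>s. s \<in> {a..b} \<and> c < chain_length \<gamma> (map (f s) ts)) (at t within {a..b})"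
proof -
  have "((\<lambda>s. \<gamma> (f s r)) \<longlongrightarrow> \<gamma> (f t r)) (at t within {a..b})" if "r \<in> set ts" for r
  proof -
    have "continuous_on {a..b} (\<lambda>s. \<gamma> (f s r))"
      using that ts by (intro continuous_on_compose2[OF \<gamma> f(1)]) (auto intro!: f(2)[simplified])
    then show ?thesis using t by (simp add: continuous_on_def)
  qed
  then have "((\<lambda>s. chain_length \<gamma> (map (f s) ts)) \<longlongrightarrow> chain_length \<gamma> (map (f t) ts)) (at t within {a..b})"
    by (rule chain_length_map_tendsto)
  then have "eventually (\<lambda>s. c < chain_length \<gamma> (map (f s) ts)) (at t within {a..b})"
    using c ts(2) by (metis order_tendstoD(1))
  moreover have "eventually (\<lambda>s. s \<in> {a..b}) (at t within {a..b})"
    by (simp add: eventually_at_filter)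
  ultimately show ?thesis by eventually_elim simp
qed

lemma curve_length_lsc_right_end:
  assumes \<gamma>: "continuous_on {a..b} \<gamma>" and t: "t \<in> {a..b}" and c: "c < curve_length \<gamma> a t"
  shows "eventually (\<lambda>s. c < curve_length \<gamma> a s) (at t within {a..b})"
proof -
  obtain ts where ts: "sorted ts" "set ts \<subseteq> {a..t}" and cl: "c < chain_length \<gamma> ts"
    using c unfolding curve_length_alt less_SUP_iff by auto
  have "eventually (\<lambda>s. s \<in> {a..b} \<and> c < chain_length \<gamma> (map (min s) ts)) (at t within {a..b})"
    using ts t by (intro eventually_less_chain_length_map[OF \<gamma> t _ _ _ _ cl] map_idI continuous_intros)
      (auto simp: min_def)
  then show ?thesis
  proof eventually_elim
    case (elim s)
    have "chain_length \<gamma> (map (min s) ts) \<le> curve_length \<gamma> a s"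
      using ts elim by (intro chain_length_le_curve_length sorted_map_of_mono) (auto simp: mono_def min_def)
    then show ?case using elim by (meson less_le_trans)
  qed
qed

lemma curve_length_lsc_left_end:
  assumes \<gamma>: "continuous_on {a..b} \<gamma>" and t: "t \<in> {a..b}" and c: "c < curve_length \<gamma> t b"
  shows "eventually (\<lambda>s. c < curve_length \<gamma> s b) (at t within {a..b})"
proof -
  obtain ts where ts: "sorted ts" "set ts \<subseteq> {t..b}" and cl: "c < chain_length \<gamma> ts"
    using c unfolding curve_length_alt less_SUP_iff by auto
  have "eventually (\<lambda>s. s \<in> {a..b} \<and> c < chain_length \<gamma> (map (max s) ts)) (at t within {a..b})"
    using ts t by (intro eventually_less_chain_length_map[OF \<gamma> t _ _ _ _ cl] map_idI continuous_intros)
      (auto simp: max_def)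
  then show ?thesis
  proof eventually_elim
    case (elim s)
    have "chain_length \<gamma> (map (max s) ts) \<le> curve_length \<gamma> s b"
      using ts elim by (intro chain_length_le_curve_length sorted_map_of_mono) (auto simp: mono_def max_def)
    then show ?case using elim by (meson less_le_trans)
  qed
qed

text \<open>Lower semicontinuity in the right endpoint is one half. For the other half the total
  length is finite, so by additivity the length up to \<open>t\<close> is a constant minus the
  length from \<open>t\<close> to \<open>b\<close>, which is lower semicontinuous as well.\<close>

lemma continuous_on_curve_length:
  assumes \<gamma>: "continuous_on {a..b} \<gamma>" and fin: "curve_length \<gamma> a b < top"
  shows "continuous_on {a..b} (\<lambda>t. enn2real (curve_length \<gamma> a t))"
  unfolding continuous_on_def
proof
  fix t assume t: "t \<in> {a..b}"
  have fin': "curve_length \<gamma> r s < top" if "a \<le> r" "s \<le> b" for r s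
    using curve_length_mono[OF that, of \<gamma>] fin by order
  have split: "enn2real (curve_length \<gamma> a b) =
      enn2real (curve_length \<gamma> a s) + enn2real (curve_length \<gamma> s b)" if "s \<in> {a..b}" for s
    using that fin' by (subst curve_length_add[of a s b, symmetric]) (auto intro!: enn2real_plus)
  have ev: "eventually (\<lambda>s. s \<in> {a..b}) (at t within {a..b})"
    by (simp add: eventually_at_filter)
  have less: "ennreal e < x \<longleftrightarrow> e < enn2real x" if "0 \<le> e" "x < top" for e x
    using that by (cases x) (auto simp: ennreal_less_iff)
  show "((\<lambda>t. enn2real (curve_length \<gamma> a t)) \<longlongrightarrow> enn2real (curve_length \<gamma> a t)) (at t within {a..b})"
  proof (rule order_tendstoI)
    \<comment> \<open>\<open>ennreal\<close> sends negative thresholds to 0, so these are treated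
      apart; they lie below every length anyway.\<close>
    fix e assume e: "e < enn2real (curve_length \<gamma> a t)"
    show "\<forall>\<^sub>F s in at t within {a..b}. e < enn2real (curve_length \<gamma> a s)"
    proof (cases "0 \<le> e")
      case True
      have "\<forall>\<^sub>F s in at t within {a..b}. ennreal e < curve_length \<gamma> a s"
        using e t fin' True by (intro curve_length_lsc_right_end[OF \<gamma> t]) (simp add: less)
      then show ?thesis using ev by eventually_elim (use True fin' less in auto)
    qed (auto intro!: always_eventually less_le_trans[OF _ enn2real_nonneg])
  next
    fix e assume e: "enn2real (curve_length \<gamma> a t) < e"
    define e' where "e' = enn2real (curve_length \<gamma> a b) - e"
    have e'': "e' < enn2real (curve_length \<gamma> t b)" using e split[OF t] by (simp add: e'_def)
    have "\<forall>\<^sub>F s in at t within {a..b}. e' < enn2real (curve_length \<gamma> s b)"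
    proof (cases "0 \<le> e'")
      case True
      have "\<forall>\<^sub>F s in at t within {a..b}. ennreal e' < curve_length \<gamma> s b"
        using e'' t fin' True by (intro curve_length_lsc_left_end[OF \<gamma> t]) (simp add: less)
      then show ?thesis using ev by eventually_elim (use True fin' less in auto)
    qed (auto intro!: always_eventually less_le_trans[OF _ enn2real_nonneg])
    then show "\<forall>\<^sub>F s in at t within {a..b}. enn2real (curve_length \<gamma> a s) < e"
      using ev by eventually_elim (use split in \<open>auto simp: e'_def\<close>)
  qed
qed

section \<open>Rectifiable curves and their arc length parametrization\<close>

lemma curvesD:
  assumes "\<gamma> \<in> curves \<Omega>"
  shows "continuous_on {0..1} \<gamma>" "\<gamma> ` {0..1} \<subseteq> \<Omega>" "curve_length \<gamma> 0 1 < top"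
    "\<not> (\<forall>t\<in>{0..1}. \<gamma> t = \<gamma> 0)"
  using assms by (auto simp: curves_def path_def path_image_def)

lemma curve_length_pos:
  assumes "\<gamma> \<in> curves \<Omega>"
  shows "0 < curve_length \<gamma> 0 1"
proof -
  obtain t where t: "t \<in> {0..1}" "\<gamma> t \<noteq> \<gamma> 0" using curvesD(4)[OF assms] by auto
  have "0 < ennreal (dist (\<gamma> 0) (\<gamma> t))" using t by (simp add: less_le ennreal_eq_0_iff)
  also have "\<dots> \<le> curve_length \<gamma> 0 t" using t by (intro dist_le_curve_length) auto
  also have "\<dots> \<le> curve_length \<gamma> 0 1" using t by (intro curve_length_mono) auto
  finally show ?thesis .
qed

lemma curve_length_surj:
  assumes "\<gamma> \<in> curves \<Omega>" "0 \<le> s" "ennreal s \<le> curve_length \<gamma> 0 1"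
  obtains t where "t \<in> {0..1}" "curve_length \<gamma> 0 t = ennreal s"
proof -
  note c = curvesD[OF assms(1)]
  have "\<exists>t\<ge>0. t \<le> 1 \<and> enn2real (curve_length \<gamma> 0 t) = s"
  proof (rule IVT')
    show "s \<le> enn2real (curve_length \<gamma> 0 1)"
      using assms c(3) by (cases "curve_length \<gamma> 0 1") auto
  qed (use assms continuous_on_curve_length[OF c(1,3)] in auto)
  then obtain t where t: "t \<in> {0..1}" "enn2real (curve_length \<gamma> 0 t) = s" by auto
  moreover have "curve_length \<gamma> 0 t < top"
    using curve_length_mono[of 0 0 t 1 \<gamma>] t c(3) by auto
  ultimately show ?thesis using that[of t] by (metis ennreal_enn2real)
qed

text \<open>The distance of two points is at most the length of the arc between them, which is the
  difference of the two initial lengths. Both the independence of \<open>arclength_param\<close>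
  from its choice and its Lipschitz bound follow from this.\<close>

lemma dist_le_of_curve_length:
  assumes "\<gamma> \<in> curves \<Omega>" and "r \<in> {0..1}" "t \<in> {0..1}"
    and "curve_length \<gamma> 0 r = ennreal s" "curve_length \<gamma> 0 t = ennreal s'" "0 \<le> s" "0 \<le> s'"
  shows "dist (\<gamma> r) (\<gamma> t) \<le> \<bar>s - s'\<bar>"
proof -
  have *: "dist (\<gamma> r) (\<gamma> t) \<le> s' - s"
    if "r \<le> t" "r \<in> {0..1}" "t \<in> {0..1}" "0 \<le> s" "0 \<le> s'"
      "curve_length \<gamma> 0 r = ennreal s" "curve_length \<gamma> 0 t = ennreal s'" for r t s s'
  proof -
    have eq: "ennreal s + curve_length \<gamma> r t = ennreal s'"
      using curve_length_add[of 0 r t \<gamma>] that by simp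
    have "ennreal (s + dist (\<gamma> r) (\<gamma> t)) = ennreal s + ennreal (dist (\<gamma> r) (\<gamma> t))"
      using that by simp
    also have "\<dots> \<le> ennreal s'"
      unfolding eq[symmetric] using that by (intro add_left_mono dist_le_curve_length)
    finally show ?thesis using that by (simp del: ennreal_plus)
  qed
  show ?thesis
  proof (cases "r \<le> t")
    case True
    then show ?thesis using *[of r t s s'] assms by auto
  next
    case False
    then show ?thesis using *[of t r s' s] assms by (auto simp: dist_commute)
  qed
qed

lemma arclength_param_eq:
  assumes "\<gamma> \<in> curves \<Omega>" "t \<in> {0..1}" "curve_length \<gamma> 0 t = ennreal s" "0 \<le> s"
  shows "arclength_param \<gamma> s = \<gamma> t"
proof -
  define t' where "t' = (SOME t. t \<in> {0..1} \<and> curve_length \<gamma> 0 t = ennreal s)"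
  have "t' \<in> {0..1} \<and> curve_length \<gamma> 0 t' = ennreal s"
    unfolding t'_def by (rule someI[of _ t]) (use assms(2,3) in simp)
  then have "dist (\<gamma> t') (\<gamma> t) \<le> \<bar>s - s\<bar>"
    using assms by (intro dist_le_of_curve_length[OF assms(1)]) auto
  then show ?thesis by (simp add: arclength_param_def t'_def)
qed

text \<open>Rescaling maps partitions of one interval to partitions of the other; the reverse
  inequality is the same one for the factor \<open>1/r\<close>.\<close>

lemma curve_length_compose_mult:
  assumes "0 < r"
  shows "curve_length (\<lambda>s. \<gamma> (r * s)) a b = curve_length \<gamma> (r * a) (r * b)"
proof -
  have chain: "chain_length (\<lambda>s. \<gamma> (r * s)) ts = chain_length \<gamma> (map ((*) r) ts)" for ts
    by (induction ts rule: induct_list012) auto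
  have sub: "curve_length (\<lambda>s. \<gamma> (r * s)) a b \<le> curve_length \<gamma> (r * a) (r * b)"
    if "0 < r" for \<gamma> :: "real \<Rightarrow> 'a" and r a b
  proof -
    have chain: "chain_length (\<lambda>s. \<gamma> (r * s)) ts = chain_length \<gamma> (map ((*) r) ts)" for ts
      by (induction ts rule: induct_list012) auto
    have "sorted (map ((*) r) ts)" "set (map ((*) r) ts) \<subseteq> {r * a..r * b}"
      if "sorted ts" "set ts \<subseteq> {a..b}" for ts
      using that \<open>0 < r\<close> by (auto intro!: sorted_map_of_mono simp: mono_def)
    then show ?thesis
      unfolding curve_length_alt[of "\<lambda>s. \<gamma> (r * s)"] chain
      by (intro SUP_least chain_length_le_curve_length) auto
  qed
  show ?thesis
    using sub[of r \<gamma> a b] sub[of "1/r" "\<lambda>s. \<gamma> (r * s)" "r * a" "r * b"] assms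
    by (intro antisym) (auto)
qed

text \<open>Upper gradient inequalities see only the endpoints of a curve, so intermediate points
  are reached by cutting the curve at \<open>r\<close> and rescaling to the unit interval. The piece
  has the same arc length parametrization on a shorter interval, which makes its integral smaller.
  The condition \<open>\<gamma> r \<noteq> \<gamma> 0\<close> keeps it non-constant.\<close>

lemma initial_subcurve:
  assumes \<gamma>: "\<gamma> \<in> curves \<Omega>" and r: "r \<in> {0..1}" and ne: "\<gamma> r \<noteq> \<gamma> 0"
  shows "(\<lambda>s. \<gamma> (r * s)) \<in> curves \<Omega>"
    and "line_integral (\<lambda>s. \<gamma> (r * s)) g \<le> line_integral \<gamma> g"
proof -
  note c = curvesD[OF \<gamma>]
  define \<delta> where "\<delta> = (\<lambda>s. \<gamma> (r * s))"
  have r0: "0 < r" "r \<le> 1" using r ne by (auto simp: less_le)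
  have mem: "r * s \<in> {0..1}" if "s \<in> {0..1}" for s
    using that r0 by (auto simp: mult_le_one)
  have len: "curve_length \<delta> 0 s = curve_length \<gamma> 0 (r * s)" for s
    using curve_length_compose_mult[OF r0(1), of \<gamma> 0 s] by (simp add: \<delta>_def)
  have len1: "curve_length \<delta> 0 1 \<le> curve_length \<gamma> 0 1"
    unfolding len using r0 by (intro curve_length_mono) auto
  show \<delta>: "\<delta> \<in> curves \<Omega>"
    unfolding curves_def path_def path_image_def
  proof (intro CollectI conjI)
    show "continuous_on {0..1} \<delta>"
      unfolding \<delta>_def by (rule continuous_on_compose2[OF c(1)]) (use mem in \<open>auto intro!: continuous_intros\<close>)
    show "\<delta> ` {0..1} \<subseteq> \<Omega>" using mem c(2) by (auto simp: \<delta>_def)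
    show "curve_length \<delta> 0 1 < \<infinity>" using len1 c(3) by (simp add: order_le_less_trans)
    show "\<not> (\<forall>t\<in>{0..1}. \<delta> t = \<delta> 0)" using ne by (auto simp: \<delta>_def intro!: bexI[of _ 1])
  qed
  have param: "arclength_param \<delta> s = arclength_param \<gamma> s"
    if s: "s \<in> {0..enn2real (curve_length \<delta> 0 1)}" for s
  proof -
    have "ennreal s \<le> curve_length \<delta> 0 1"
      using s curvesD(3)[OF \<delta>] by (cases "curve_length \<delta> 0 1") auto
    then obtain t where t: "t \<in> {0..1}" "curve_length \<delta> 0 t = ennreal s"
      using curve_length_surj[OF \<delta>, of s] s by auto
    have "arclength_param \<delta> s = \<delta> t"
      using t s by (intro arclength_param_eq[OF \<delta>]) auto
    also have "\<dots> = arclength_param \<gamma> s"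
      unfolding \<delta>_def using t s mem by (intro arclength_param_eq[OF \<gamma>, symmetric]) (auto simp: len)
    finally show ?thesis .
  qed
  have "enn2real (curve_length \<delta> 0 1) \<le> enn2real (curve_length \<gamma> 0 1)"
    using len1 c(3) by (intro enn2real_mono) auto
  then show "line_integral \<delta> g \<le> line_integral \<gamma> g"
    unfolding line_integral_def
    by (intro nn_integral_mono) (auto simp: param indicator_def)
qed

lemma arclength_param_in:
  assumes \<gamma>: "\<gamma> \<in> curves \<Omega>" and s: "s \<in> {0..enn2real (curve_length \<gamma> 0 1)}"
  obtains t where "t \<in> {0..1}" "curve_length \<gamma> 0 t = ennreal s" "arclength_param \<gamma> s = \<gamma> t"
proof -
  have "ennreal s \<le> curve_length \<gamma> 0 1"
    using s curvesD(3)[OF \<gamma>] by (cases "curve_length \<gamma> 0 1") auto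
  then obtain t where t: "t \<in> {0..1}" "curve_length \<gamma> 0 t = ennreal s"
    using curve_length_surj[OF \<gamma>, of s] s by auto
  with arclength_param_eq[OF \<gamma> t] s that show ?thesis by auto
qed

lemma continuous_on_arclength_param:
  assumes \<gamma>: "\<gamma> \<in> curves \<Omega>"
  shows "continuous_on {0..enn2real (curve_length \<gamma> 0 1)} (arclength_param \<gamma>)"
proof (rule lipschitz_on_continuous_on)
  show "1-lipschitz_on {0..enn2real (curve_length \<gamma> 0 1)} (arclength_param \<gamma>)"
  proof (rule lipschitz_onI)
    fix s s' assume s: "s \<in> {0..enn2real (curve_length \<gamma> 0 1)}" and s': "s' \<in> {0..enn2real (curve_length \<gamma> 0 1)}"
    obtain t where t: "t \<in> {0..1}" "curve_length \<gamma> 0 t = ennreal s" "arclength_param \<gamma> s = \<gamma> t"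
      using arclength_param_in[OF \<gamma> s] .
    obtain t' where t': "t' \<in> {0..1}" "curve_length \<gamma> 0 t' = ennreal s'" "arclength_param \<gamma> s' = \<gamma> t'"
      using arclength_param_in[OF \<gamma> s'] .
    show "dist (arclength_param \<gamma> s) (arclength_param \<gamma> s') \<le> 1 * dist s s'"
      using dist_le_of_curve_length[OF \<gamma> t(1) t'(1) t(2) t'(2)] s s' t t' by (simp add: dist_real_def)
  qed simp
qed

text \<open>A Borel function composed with a continuous map. Additivity of line integrals rests on
  this measurability.\<close>

lemma line_integrand_measurable:
  fixes g :: "'a::metric_space \<Rightarrow> ennreal"
  assumes \<gamma>: "\<gamma> \<in> curves \<Omega>" and g: "g \<in> borel_measurable (restrict_space borel \<Omega>)"
  shows "(\<lambda>s. g (arclength_param \<gamma> s) * indicator {0..enn2real (curve_length \<gamma> 0 1)} s) \<in> borel_measurable lborel"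
proof -
  let ?I = "{0..enn2real (curve_length \<gamma> 0 1)}"
  have "arclength_param \<gamma> s \<in> \<Omega>" if "s \<in> ?I" for s
    using arclength_param_in[OF \<gamma> that] curvesD(2)[OF \<gamma>] by (metis image_subset_iff)
  then have "arclength_param \<gamma> \<in> measurable (restrict_space borel ?I) (restrict_space borel \<Omega>)"
    by (intro measurable_restrict_space2 borel_measurable_continuous_on_restrict
        continuous_on_arclength_param[OF \<gamma>]) (auto simp: space_restrict_space)
  from measurable_compose[OF this g] show ?thesis
    by (subst (asm) borel_measurable_restrict_space_iff_ennreal) (simp_all)
qed

section \<open>Line integrals as functionals of the integrand\<close>

lemma line_integral_mono:
  assumes "\<gamma> \<in> curves \<Omega>" "\<And>x. x \<in> \<Omega> \<Longrightarrow> g x \<le> h x"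
  shows "line_integral \<gamma> g \<le> line_integral \<gamma> h"
  unfolding line_integral_def
proof (intro nn_integral_mono)
  fix s
  show "g (arclength_param \<gamma> s) * indicator {0..enn2real (curve_length \<gamma> 0 1)} s
        \<le> h (arclength_param \<gamma> s) * indicator {0..enn2real (curve_length \<gamma> 0 1)} s"
  proof (cases "s \<in> {0..enn2real (curve_length \<gamma> 0 1)}")
    case True
    then have "arclength_param \<gamma> s \<in> \<Omega>"
      using arclength_param_in[OF assms(1) True] curvesD(2)[OF assms(1)] by (metis image_subset_iff)
    then show ?thesis using assms(2) by (simp add: mult_right_mono)
  qed simp
qed

lemma line_integral_add:
  assumes "\<gamma> \<in> curves \<Omega>" "g \<in> borel_measurable (restrict_space borel \<Omega>)"
    "h \<in> borel_measurable (restrict_space borel \<Omega>)"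
  shows "line_integral \<gamma> (\<lambda>x. g x + h x) = line_integral \<gamma> g + line_integral \<gamma> h"
  unfolding line_integral_def distrib_right
  by (intro nn_integral_add line_integrand_measurable[OF assms(1)] assms)

lemma line_integral_cmult:
  assumes "\<gamma> \<in> curves \<Omega>" "g \<in> borel_measurable (restrict_space borel \<Omega>)"
  shows "line_integral \<gamma> (\<lambda>x. c * g x) = c * line_integral \<gamma> g"
  unfolding line_integral_def mult.assoc
  by (intro nn_integral_cmult line_integrand_measurable[OF assms(1)] assms)

text \<open>A curve staying in \<open>N\<close> would have \<open>top\<close> times its positive
  length as integral. With this, the curves inside a Borel null set form an exceptional
  family.\<close>

lemma curve_leaves:
  assumes "\<gamma> \<in> curves \<Omega>" "line_integral \<gamma> (\<lambda>x. top * indicator N x) < top"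
  obtains t where "t \<in> {0..1}" "\<gamma> t \<notin> N"
proof (rule ccontr)
  assume "\<not> thesis"
  with that have N: "\<gamma> t \<in> N" if "t \<in> {0..1}" for t using that by blast
  let ?l = "enn2real (curve_length \<gamma> 0 1)"
  have l: "0 < ?l" using curve_length_pos[OF assms(1)] curvesD(3)[OF assms(1)] by (simp add: enn2real_positive_iff)
  have "line_integral \<gamma> (\<lambda>x. top * indicator N x) = (\<integral>\<^sup>+s. top * indicator {0..?l} s \<partial>lborel)"
    unfolding line_integral_def
  proof (intro nn_integral_cong)
    fix s
    show "top * indicator N (arclength_param \<gamma> s) * indicator {0..?l} s = top * (indicator {0..?l} s::ennreal)"
    proof (cases "s \<in> {0..?l}")
      case True
      then have "arclength_param \<gamma> s \<in> N"
        using arclength_param_in[OF assms(1) True] N by metis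
      then show ?thesis by simp
    qed simp
  qed
  also have "\<dots> = top" using l by (subst nn_integral_cmult_indicator) (auto simp: ennreal_top_mult ennreal_eq_0_iff)
  finally show False using assms(2) by simp
qed

subsection \<open>Weak upper gradients\<close>

text \<open>Since \<open>c k * f k \<le> Lp_majorant p c f\<close> pointwise, a geometric series bounds the sum of the \<open>f k\<close>;
  this replaces Minkowski's inequality for countable sums.\<close>

definition Lp_majorant :: "real \<Rightarrow> (nat \<Rightarrow> real) \<Rightarrow> (nat \<Rightarrow> 'a \<Rightarrow> ennreal) \<Rightarrow> 'a \<Rightarrow> ennreal" where
  "Lp_majorant p c f x = epowr (\<Sum>k. ennreal (c k powr p) * epowr (f k x) p) (1 / p)"

lemma Lp_majorant_measurable [measurable]:
  assumes [measurable]: "\<And>k. f k \<in> borel_measurable M"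
  shows "Lp_majorant p c f \<in> borel_measurable M"
  unfolding Lp_majorant_def[abs_def] by measurable

lemma nn_integral_Lp_majorant:
  assumes "0 < p" and [measurable]: "\<And>k. f k \<in> borel_measurable M"
  shows "(\<integral>\<^sup>+x. epowr (Lp_majorant p c f x) p \<partial>M) =
    (\<Sum>k. ennreal (c k powr p) * (\<integral>\<^sup>+x. epowr (f k x) p \<partial>M))"
proof -
  have "(\<integral>\<^sup>+x. epowr (Lp_majorant p c f x) p \<partial>M) =
      (\<integral>\<^sup>+x. (\<Sum>k. ennreal (c k powr p) * epowr (f k x) p) \<partial>M)"
    using assms(1) by (simp add: Lp_majorant_def epowr_epowr)
  then show ?thesis by (simp add: nn_integral_suminf nn_integral_cmult)
qed

lemma Lp_majorant_ge:
  assumes "0 < p" "0 \<le> c k"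
  shows "ennreal (c k) * f k x \<le> Lp_majorant p c f x"
proof (rule le_of_epowr_le[OF assms(1)])
  have "epowr (ennreal (c k) * f k x) p = ennreal (c k powr p) * epowr (f k x) p"
    using assms by (simp add: epowr_mult epowr_ennreal)
  also have "\<dots> \<le> (\<Sum>k. ennreal (c k powr p) * epowr (f k x) p)"
    using sum_le_suminf[of "\<lambda>k. ennreal (c k powr p) * epowr (f k x) p" "{k}"] by simp
  also have "\<dots> = epowr (Lp_majorant p c f x) p"
    using assms by (simp add: Lp_majorant_def epowr_epowr)
  finally show "epowr (ennreal (c k) * f k x) p \<le> epowr (Lp_majorant p c f x) p" .
qed

text \<open>The increments are dominated by a geometric series, whose tail from index
  \<open>n\<close> bounds the remaining distance. It is applied to values at points off a null set
  as well as to differences of values along a curve.\<close>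

lemma geometric_increments:
  fixes w :: "nat \<Rightarrow> real"
  assumes "\<And>k. \<bar>w (Suc k) - w k\<bar> \<le> (1/2)^k * A"
  shows "convergent w" and "\<bar>lim w - w n\<bar> \<le> 2 * (1/2)^n * A"
proof -
  have geo: "(\<lambda>k. (1/2)^(k+n) * A) sums (2 * (1/2)^n * A)" for n :: nat
    using sums_mult[OF geometric_sums[of "1/2::real"], of "(1/2)^n * A"] by (simp add: power_add mult_ac)
  have abs_summable: "summable (\<lambda>k. \<bar>w (Suc (k + n)) - w (k + n)\<bar>)" for n
    by (rule summable_comparison_test'[of _ 0, OF sums_summable[OF geo[of n]]]) (use assms in auto)
  have sums: "(\<lambda>k. w (Suc (k + n)) - w (k + n)) sums (suminf (\<lambda>k. w (Suc (k + n)) - w (k + n)))" for n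
    by (rule summable_sums[OF summable_rabs_cancel[OF abs_summable]])
  have lim: "(\<lambda>m. w (m + n) - w n) \<longlonglongrightarrow> (\<Sum>k. w (Suc (k + n)) - w (k + n))" for n
  proof -
    have "(\<Sum>k<m. w (Suc (k + n)) - w (k + n)) = w (m + n) - w n" for m
      using sum_lessThan_telescope[of "\<lambda>k. w (k + n)" m] by simp
    then show ?thesis using sums[of n] by (simp add: sums_def)
  qed
  from tendsto_add[OF lim[of 0] tendsto_const[of "w 0"]] show conv: "convergent w"
    by (auto simp: convergent_def)
  then have "w \<longlonglongrightarrow> lim w" by (simp add: convergent_LIMSEQ_iff)
  then have "(\<lambda>m. w (m + n) - w n) \<longlonglongrightarrow> lim w - w n"
    using tendsto_diff[OF LIMSEQ_ignore_initial_segment tendsto_const] by blast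
  from LIMSEQ_unique[OF this lim] have eq: "lim w - w n = (\<Sum>k. w (Suc (k + n)) - w (k + n))" .
  have "\<bar>lim w - w n\<bar> \<le> (\<Sum>k. \<bar>w (Suc (k + n)) - w (k + n)\<bar>)"
    unfolding eq by (rule summable_rabs[OF abs_summable])
  also have "\<dots> \<le> (\<Sum>k. (1/2)^(k+n) * A)"
    by (intro suminf_le abs_summable sums_summable[OF geo] assms)
  also have "\<dots> = 2 * (1/2)^n * A" using geo by (simp add: sums_iff)
  finally show "\<bar>lim w - w n\<bar> \<le> 2 * (1/2)^n * A" .
qed

text \<open>The exceptional family may be enlarged to all curves on which \<rho> has infinite
  integral. Exceptional families are thereby handled through functions, and a finite integral of
  \<rho> is what makes a curve good.\<close>

lemma weak_upper_gradient_iff: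
  "weak_upper_gradient \<mu> p u g \<longleftrightarrow>
     g \<in> borel_measurable (restrict_space borel (space \<mu>)) \<and>
     (\<exists>\<rho>\<in>borel_measurable (restrict_space borel (space \<mu>)). Lp_norm \<mu> p \<rho> < top \<and>
        (\<forall>\<gamma>\<in>curves (space \<mu>). line_integral \<gamma> \<rho> < top \<longrightarrow> ug_inequality u g \<gamma>))"
    (is "_ \<longleftrightarrow> ?g \<and> ?R")
proof
  assume "weak_upper_gradient \<mu> p u g"
  then show "?g \<and> ?R"
    unfolding weak_upper_gradient_def exceptional_family_def infinity_ennreal_def
    by (metis Diff_iff less_irrefl)
next
  assume R: "?g \<and> ?R"
  then obtain \<rho> where \<rho>: "\<rho> \<in> borel_measurable (restrict_space borel (space \<mu>))" "Lp_norm \<mu> p \<rho> < top"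
    "\<And>\<gamma>. \<gamma> \<in> curves (space \<mu>) \<Longrightarrow> line_integral \<gamma> \<rho> < top \<Longrightarrow> ug_inequality u g \<gamma>" by auto
  have "exceptional_family \<mu> p {\<gamma>. line_integral \<gamma> \<rho> = top}"
    unfolding exceptional_family_def infinity_ennreal_def using \<rho>(1,2) by auto
  moreover have "\<forall>\<gamma>\<in>curves (space \<mu>) - {\<gamma>. line_integral \<gamma> \<rho> = top}. ug_inequality u g \<gamma>"
    using \<rho>(3) by (auto simp: top.not_eq_extremum)
  ultimately show "weak_upper_gradient \<mu> p u g"
    unfolding weak_upper_gradient_def using R by blast
qed

lemma weak_upper_gradient_measurable:
  "weak_upper_gradient \<mu> p u g \<Longrightarrow> g \<in> borel_measurable (restrict_space borel (space \<mu>))"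
  by (simp add: weak_upper_gradient_def)

text \<open>Two notions of measurability coexist: upper gradients and exceptional functions are
  Borel, Newtonian functions only measurable for \<mu>. The inclusion of sigma-algebras allows the
  former to be integrated.\<close>

locale borel_space_measure =
  fixes \<mu> :: "'a::metric_space measure" and p :: real
  assumes p_gt_1: "1 < p"
    and borel_subset: "sets (restrict_space borel (space \<mu>)) \<subseteq> sets \<mu>"
begin

abbreviation "\<Omega> \<equiv> space \<mu>"

abbreviation "borelm \<equiv> borel_measurable (restrict_space borel (space \<mu>))"

abbreviation Lp_power :: "('a \<Rightarrow> ennreal) \<Rightarrow> ennreal" where
  "Lp_power f \<equiv> \<integral>\<^sup>+x. epowr (f x) p \<partial>\<mu>"

lemma p_pos: "0 < p" and p_ge_0: "0 \<le> p"
  using p_gt_1 by auto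

lemma borelm_imp_measurable [measurable_dest]: "g \<in> borelm \<Longrightarrow> g \<in> borel_measurable \<mu>"
  using borel_subset by (rule borel_measurable_subalgebra) (simp_all add: space_restrict_space)

text \<open>Countable unions of exceptional families are exceptional: one function with finite L^p
  norm dominates a positive multiple of every given function, hence has infinite integral wherever
  one of them does.\<close>

lemma common_exceptional_function:
  assumes \<rho>: "\<And>k::nat. \<rho> k \<in> borelm" and fin: "\<And>k. Lp_norm \<mu> p (\<rho> k) < top"
  obtains \<sigma> where "\<sigma> \<in> borelm" "Lp_norm \<mu> p \<sigma> < top"
    "\<And>\<gamma> k. \<gamma> \<in> curves \<Omega> \<Longrightarrow> line_integral \<gamma> \<sigma> < top \<Longrightarrow> line_integral \<gamma> (\<rho> k) < top"
proof
  define a where "a k = enn2real (Lp_power (\<rho> k))" for k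
  have a: "Lp_power (\<rho> k) = ennreal (a k)" "0 \<le> a k" for k
    using fin[of k] by (simp_all add: Lp_norm_less_top_iff a_def)
  \<comment> \<open>The weight cancels the size of the p-th power integral of
    \<open>\<rho> k\<close>; the 1 guards against division by zero.\<close>
  define w where "w k = (1/2)^k / (1 + a k)" for k
  have w: "0 < w k" "w k * a k \<le> (1/2)^k" for k
  proof -
    have 1: "a k / (1 + a k) \<le> 1" and 2: "0 < 1 + a k" using a(2)[of k] by auto
    show "0 < w k" using 2 by (simp add: w_def)
    have "w k * a k = (1/2)^k * (a k / (1 + a k))" by (simp add: w_def)
    also have "\<dots> \<le> (1/2)^k * 1" using 1 by (intro mult_left_mono) auto
    finally show "w k * a k \<le> (1/2)^k" by simp
  qed
  define c where "c k = w k powr (1 / p)" for k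
  have c: "0 < c k" "c k powr p = w k" for k
    using w(1)[of k] p_pos by (auto simp: c_def powr_powr)
  define \<sigma> where "\<sigma> = Lp_majorant p c \<rho>"
  show \<sigma>: "\<sigma> \<in> borelm" unfolding \<sigma>_def using \<rho> by measurable
  have "Lp_power \<sigma> = (\<Sum>k. ennreal (w k) * ennreal (a k))"
    unfolding \<sigma>_def by (subst nn_integral_Lp_majorant[OF p_pos]) (use \<rho> in \<open>auto simp: a c\<close>)
  also have "\<dots> \<le> (\<Sum>k. ennreal ((1/2)^k))"
  proof (intro suminf_le)
    show "ennreal (w k) * ennreal (a k) \<le> ennreal ((1/2)^k)" for k
      using w[of k] a(2)[of k] by (simp add: ennreal_leI flip: ennreal_mult)
  qed auto
  also have "\<dots> = ennreal (\<Sum>k. (1/2)^k)"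
    by (intro suminf_ennreal2) auto
  also have "\<dots> < top" by simp
  finally show "Lp_norm \<mu> p \<sigma> < top" by (simp add: Lp_norm_less_top_iff)
  fix \<gamma> k assume \<gamma>: "\<gamma> \<in> curves \<Omega>" "line_integral \<gamma> \<sigma> < top"
  have "ennreal (c k) * line_integral \<gamma> (\<rho> k) = line_integral \<gamma> (\<lambda>x. ennreal (c k) * \<rho> k x)"
    using \<gamma>(1) \<rho> by (simp add: line_integral_cmult)
  also have "\<dots> \<le> line_integral \<gamma> \<sigma>"
    unfolding \<sigma>_def using c(1)[of k] p_pos by (intro line_integral_mono[OF \<gamma>(1)] Lp_majorant_ge) auto
  finally have "ennreal (c k) * line_integral \<gamma> (\<rho> k) < top" using \<gamma>(2) by order
  then show "line_integral \<gamma> (\<rho> k) < top"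
    using c(1)[of k] by (auto simp: ennreal_mult_less_top)
qed

lemma weak_upper_gradient_mono:
  assumes "weak_upper_gradient \<mu> p u g" "h \<in> borelm" "\<And>x. x \<in> \<Omega> \<Longrightarrow> g x \<le> h x"
  shows "weak_upper_gradient \<mu> p u h"
proof -
  have "ug_inequality u h \<gamma>" if "\<gamma> \<in> curves \<Omega>" "ug_inequality u g \<gamma>" for \<gamma>
    using order_trans[OF _ line_integral_mono[OF that(1) assms(3)]] that(2)
    by (simp add: ug_inequality_def)
  then show ?thesis using assms(1,2) unfolding weak_upper_gradient_iff by blast
qed

lemma weak_upper_gradient_lincomb:
  assumes u: "weak_upper_gradient \<mu> p u g" and v: "weak_upper_gradient \<mu> p v h"
  shows "weak_upper_gradient \<mu> p (\<lambda>x. a * u x + b * v x + c)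
    (\<lambda>x. ennreal \<bar>a\<bar> * g x + ennreal \<bar>b\<bar> * h x)"
proof -
  obtain \<rho> \<rho>' where \<rho>: "\<rho> \<in> borelm" "Lp_norm \<mu> p \<rho> < top"
    "\<And>\<gamma>. \<gamma> \<in> curves \<Omega> \<Longrightarrow> line_integral \<gamma> \<rho> < top \<Longrightarrow> ug_inequality u g \<gamma>"
    and \<rho>': "\<rho>' \<in> borelm" "Lp_norm \<mu> p \<rho>' < top"
    "\<And>\<gamma>. \<gamma> \<in> curves \<Omega> \<Longrightarrow> line_integral \<gamma> \<rho>' < top \<Longrightarrow> ug_inequality v h \<gamma>"
    using u v unfolding weak_upper_gradient_iff by blast
  \<comment> \<open>Two functions, presented as a sequence that is constant from index 1 on.\<close>
  obtain \<sigma> where \<sigma>: "\<sigma> \<in> borelm" "Lp_norm \<mu> p \<sigma> < top"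
    "\<And>\<gamma> k. \<gamma> \<in> curves \<Omega> \<Longrightarrow> line_integral \<gamma> \<sigma> < top \<Longrightarrow>
       line_integral \<gamma> (if k = (0::nat) then \<rho> else \<rho>') < top"
    by (rule common_exceptional_function[of "\<lambda>k. if k = 0 then \<rho> else \<rho>'"]) (use \<rho> \<rho>' in auto)
  have [measurable]: "g \<in> borelm" "h \<in> borelm"
    using u v by (auto simp: weak_upper_gradient_measurable)
  have "ug_inequality (\<lambda>x. a * u x + b * v x + c) (\<lambda>x. ennreal \<bar>a\<bar> * g x + ennreal \<bar>b\<bar> * h x) \<gamma>"
    if \<gamma>: "\<gamma> \<in> curves \<Omega>" "line_integral \<gamma> \<sigma> < top" for \<gamma>
  proof -
    have 1: "ug_inequality u g \<gamma>" using \<sigma>(3)[OF \<gamma>, of 0] \<rho>(3) \<gamma> by auto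
    have 2: "ug_inequality v h \<gamma>" using \<sigma>(3)[OF \<gamma>, of 1] \<rho>'(3) \<gamma> by auto
    let ?x = "pathstart \<gamma>" and ?y = "pathfinish \<gamma>"
    have "ennreal \<bar>(a * u ?y + b * v ?y + c) - (a * u ?x + b * v ?x + c)\<bar>
      \<le> ennreal (\<bar>a\<bar> * \<bar>u ?y - u ?x\<bar> + \<bar>b\<bar> * \<bar>v ?y - v ?x\<bar>)"
    proof (rule ennreal_leI)
      have "(a * u ?y + b * v ?y + c) - (a * u ?x + b * v ?x + c) = a * (u ?y - u ?x) + b * (v ?y - v ?x)"
        by (simp add: algebra_simps)
      then show "\<bar>(a * u ?y + b * v ?y + c) - (a * u ?x + b * v ?x + c)\<bar>
        \<le> \<bar>a\<bar> * \<bar>u ?y - u ?x\<bar> + \<bar>b\<bar> * \<bar>v ?y - v ?x\<bar>"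
        by (metis abs_mult abs_triangle_ineq)
    qed
    also have "\<dots> = ennreal \<bar>a\<bar> * ennreal \<bar>u ?y - u ?x\<bar> + ennreal \<bar>b\<bar> * ennreal \<bar>v ?y - v ?x\<bar>"
      by (simp add: ennreal_mult)
    also have "\<dots> \<le> ennreal \<bar>a\<bar> * line_integral \<gamma> g + ennreal \<bar>b\<bar> * line_integral \<gamma> h"
      using 1 2 unfolding ug_inequality_def by (intro add_mono mult_left_mono) auto
    also have "\<dots> = line_integral \<gamma> (\<lambda>x. ennreal \<bar>a\<bar> * g x + ennreal \<bar>b\<bar> * h x)"
      using \<gamma>(1) by (simp add: line_integral_add line_integral_cmult)
    finally show ?thesis unfolding ug_inequality_def .
  qed
  then show ?thesis
    unfolding weak_upper_gradient_iff using \<sigma>(1,2) by auto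
qed

lemma weak_upper_gradient_const: "weak_upper_gradient \<mu> p (\<lambda>x. c) (\<lambda>x. 0)"
  unfolding weak_upper_gradient_iff using p_pos
  by (auto intro!: bexI[of _ "\<lambda>x. 0"] simp: ug_inequality_def Lp_norm_less_top_iff)

text \<open>A small multiple of the exceptional function is added: on exceptional curves its
  integral is infinite, so the inequality becomes trivial there. This brings weak upper gradients
  within reach of the Poincare inequality, which is assumed for true ones.\<close>

lemma upper_gradient_approx:
  assumes u: "weak_upper_gradient \<mu> p u g" and e: "0 < e"
  obtains h where "upper_gradient \<Omega> u h" "h \<in> borelm"
    "Lp_power h \<le> ennreal (2 powr p) * (Lp_power g + ennreal e)"
proof -
  obtain \<rho> where \<rho> [measurable]: "\<rho> \<in> borelm" and fin: "Lp_norm \<mu> p \<rho> < top"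
    and ug: "\<And>\<gamma>. \<gamma> \<in> curves \<Omega> \<Longrightarrow> line_integral \<gamma> \<rho> < top \<Longrightarrow> ug_inequality u g \<gamma>"
    using u unfolding weak_upper_gradient_iff by blast
  have [measurable]: "g \<in> borelm" using u by (auto simp: weak_upper_gradient_measurable)
  define a where "a = enn2real (Lp_power \<rho>)"
  have a: "Lp_power \<rho> = ennreal a" "0 \<le> a"
    using fin by (simp_all add: Lp_norm_less_top_iff a_def)
  define d where "d = (e / (1 + a)) powr (1 / p)"
  have d: "0 < d" "d powr p * a \<le> e"
    using e a(2) p_pos by (auto simp: d_def powr_powr field_simps)
  define h where "h = (\<lambda>x. g x + ennreal d * \<rho> x)"
  have h: "h \<in> borelm" unfolding h_def by measurable
  have "ug_inequality u h \<gamma>" if \<gamma>: "\<gamma> \<in> curves \<Omega>" for \<gamma>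
  proof (cases "line_integral \<gamma> \<rho> < top")
    case True
    have "line_integral \<gamma> g \<le> line_integral \<gamma> h"
      unfolding h_def by (intro line_integral_mono[OF \<gamma>]) auto
    then show ?thesis using ug[OF \<gamma> True] by (auto simp: ug_inequality_def)
  next
    case False
    then have "line_integral \<gamma> \<rho> = top" using top.not_eq_extremum by blast
    then have "line_integral \<gamma> h = top"
      using d(1) \<gamma> unfolding h_def by (simp add: line_integral_add line_integral_cmult ennreal_mult_top)
    then show ?thesis by (simp add: ug_inequality_def)
  qed
  then have 1: "upper_gradient \<Omega> u h" using h by (simp add: upper_gradient_def)
  have "Lp_power h \<le> (\<integral>\<^sup>+x. ennreal (2 powr p) * (epowr (g x) p + ennreal (d powr p) * epowr (\<rho> x) p) \<partial>\<mu>)"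
  proof (intro nn_integral_mono)
    fix x
    show "epowr (h x) p \<le> ennreal (2 powr p) * (epowr (g x) p + ennreal (d powr p) * epowr (\<rho> x) p)"
      using epowr_add_le[OF p_ge_0, of "g x" "ennreal d * \<rho> x"] d(1)
      by (simp add: h_def epowr_mult epowr_ennreal)
  qed
  also have "\<dots> = ennreal (2 powr p) * (Lp_power g + ennreal (d powr p) * ennreal a)"
    by (simp add: nn_integral_cmult nn_integral_add a)
  also have "\<dots> \<le> ennreal (2 powr p) * (Lp_power g + ennreal e)"
    using d a(2) by (intro mult_left_mono add_left_mono) (auto intro!: ennreal_leI simp flip: ennreal_mult)
  finally show ?thesis using that 1 h by blast
qed

text \<open>Along a curve that is not exceptional the increments of \<open>v\<close> converge, so \<open>v\<close> converges either
  at all points of the curve or at none; the latter happens only for curves inside the null set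
  \<open>N\<close>, which form an exceptional family.\<close>

lemma weak_upper_gradient_limit:
  fixes v :: "nat \<Rightarrow> 'a \<Rightarrow> real"
  assumes S: "S \<in> borelm" "Lp_norm \<mu> p S < top"
    and v: "\<And>k. weak_upper_gradient \<mu> p (\<lambda>x. v (Suc k) x - v k x) (\<lambda>x. ennreal ((1/2)^k) * S x)"
    and N: "N \<in> sets (restrict_space borel \<Omega>)" "emeasure \<mu> N = 0"
    and conv: "\<And>x. x \<in> \<Omega> - N \<Longrightarrow> convergent (\<lambda>k. v k x)"
  shows "weak_upper_gradient \<mu> p (\<lambda>x. lim (\<lambda>k. v k x) - v n x) (\<lambda>x. ennreal (2 * (1/2)^n) * S x)"
proof -
  have "\<forall>k. \<exists>\<rho>. \<rho> \<in> borelm \<and> Lp_norm \<mu> p \<rho> < top \<and> (\<forall>\<gamma>\<in>curves \<Omega>. line_integral \<gamma> \<rho> < top \<longrightarrow>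
      ug_inequality (\<lambda>x. v (Suc k) x - v k x) (\<lambda>x. ennreal ((1/2)^k) * S x) \<gamma>)"
    using v unfolding weak_upper_gradient_iff by blast
  from choice[OF this] obtain \<rho> where \<rho>_all: "\<forall>k. \<rho> k \<in> borelm \<and> Lp_norm \<mu> p (\<rho> k) < top \<and>
      (\<forall>\<gamma>\<in>curves \<Omega>. line_integral \<gamma> (\<rho> k) < top \<longrightarrow>
        ug_inequality (\<lambda>x. v (Suc k) x - v k x) (\<lambda>x. ennreal ((1/2)^k) * S x) \<gamma>)" ..
  have \<rho>: "\<rho> k \<in> borelm" "Lp_norm \<mu> p (\<rho> k) < top"
    "\<gamma> \<in> curves \<Omega> \<Longrightarrow> line_integral \<gamma> (\<rho> k) < top \<Longrightarrow>
      ug_inequality (\<lambda>x. v (Suc k) x - v k x) (\<lambda>x. ennreal ((1/2)^k) * S x) \<gamma>" for k \<gamma>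
    using \<rho>_all by blast+
  define \<rho>N where "\<rho>N = (\<lambda>x. top * (indicator N x :: ennreal))"
  have N': "N \<in> null_sets \<mu>" using N borel_subset by auto
  have \<rho>N: "\<rho>N \<in> borelm" unfolding \<rho>N_def using N(1) by measurable
  have "Lp_power \<rho>N = (\<integral>\<^sup>+x. 0 \<partial>\<mu>)"
    using AE_not_in[OF N'] by (intro nn_integral_cong_AE) (auto simp: \<rho>N_def)
  then have \<rho>N': "Lp_norm \<mu> p \<rho>N < top" by (simp add: Lp_norm_less_top_iff)
  define \<tau> where "\<tau> k = (case k of 0 \<Rightarrow> S | Suc 0 \<Rightarrow> \<rho>N | Suc (Suc j) \<Rightarrow> \<rho> j)" for k
  have \<tau>: "\<tau> 0 = S" "\<tau> 1 = \<rho>N" "\<tau> (Suc (Suc j)) = \<rho> j" for j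
    by (simp_all add: \<tau>_def)
  have "\<tau> k \<in> borelm" "Lp_norm \<mu> p (\<tau> k) < top" for k
    using S \<rho> \<rho>N \<rho>N' by (auto simp: \<tau>_def split: nat.split)
  then obtain \<sigma> where \<sigma>: "\<sigma> \<in> borelm" "Lp_norm \<mu> p \<sigma> < top"
    "\<And>\<gamma> k. \<gamma> \<in> curves \<Omega> \<Longrightarrow> line_integral \<gamma> \<sigma> < top \<Longrightarrow> line_integral \<gamma> (\<tau> k) < top"
    using common_exceptional_function[of \<tau>] by blast
  have "ug_inequality (\<lambda>x. lim (\<lambda>k. v k x) - v n x) (\<lambda>x. ennreal (2 * (1/2)^n) * S x) \<gamma>"
    if \<gamma>: "\<gamma> \<in> curves \<Omega>" "line_integral \<gamma> \<sigma> < top" for \<gamma>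
  proof -
    define A where "A = enn2real (line_integral \<gamma> S)"
    have A: "line_integral \<gamma> S = ennreal A" "0 \<le> A"
      using \<sigma>(3)[OF \<gamma>, of 0] by (simp_all add: \<tau> A_def)
    \<comment> \<open>Cutting the curve at \<open>r\<close> bounds the increment at
      \<open>\<gamma> r\<close> relative to \<open>\<gamma> 0\<close> by the integral over all of
      \<gamma>, uniformly in \<open>r\<close>.\<close>
    have incr: "\<bar>(v (Suc k) (\<gamma> r) - v (Suc k) (\<gamma> 0)) - (v k (\<gamma> r) - v k (\<gamma> 0))\<bar> \<le> (1/2)^k * A"
      if r: "r \<in> {0..1}" for r k
    proof (cases "\<gamma> r = \<gamma> 0")
      case True
      then show ?thesis using A by simp
    next
      case False
      define \<delta> where "\<delta> = (\<lambda>s. \<gamma> (r * s))"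
      note sub = initial_subcurve[OF \<gamma>(1) r False, folded \<delta>_def]
      have "line_integral \<delta> (\<rho> k) < top"
        using sub(2)[of "\<rho> k"] \<sigma>(3)[OF \<gamma>, of "Suc (Suc k)"] by (simp add: \<tau> order_le_less_trans)
      from \<rho>(3)[OF sub(1) this]
      have "ennreal \<bar>(v (Suc k) (\<gamma> r) - v k (\<gamma> r)) - (v (Suc k) (\<gamma> 0) - v k (\<gamma> 0))\<bar>
          \<le> line_integral \<delta> (\<lambda>x. ennreal ((1/2)^k) * S x)"
        by (simp add: ug_inequality_def pathstart_def pathfinish_def \<delta>_def)
      also have "\<dots> \<le> ennreal ((1/2)^k) * line_integral \<gamma> S"
        using S(1) by (subst line_integral_cmult[OF sub(1)]) (auto intro!: mult_left_mono sub(2))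
      also have "\<dots> = ennreal ((1/2)^k * A)"
        using A by (simp add: ennreal_mult)
      finally have "\<bar>(v (Suc k) (\<gamma> r) - v k (\<gamma> r)) - (v (Suc k) (\<gamma> 0) - v k (\<gamma> 0))\<bar> \<le> (1/2)^k * A"
        using A(2) by (simp add: ennreal_le_iff)
      then show ?thesis by (simp add: algebra_simps)
    qed
    note geo = geometric_increments[of "\<lambda>k. v k (\<gamma> r) - v k (\<gamma> 0)" A for r, OF incr]
    \<comment> \<open>At a point off \<open>N\<close> the sequence converges; the relative
      increments carry this to \<open>\<gamma> 0\<close>, and from there to
      \<open>\<gamma> 1\<close>.\<close>
    obtain r where r: "r \<in> {0..1}" "\<gamma> r \<notin> N"
      using curve_leaves[OF \<gamma>(1), of N] \<sigma>(3)[OF \<gamma>, of 1] unfolding \<tau>(2) \<rho>N_def by blast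
    then have "convergent (\<lambda>k. v k (\<gamma> r))"
      using curvesD(2)[OF \<gamma>(1)] by (intro conv) auto
    from convergent_diff[OF this geo(1)[OF r(1)]] have conv0: "convergent (\<lambda>k. v k (\<gamma> 0))" by simp
    from convergent_add[OF this geo(1)[of 1]] have conv1: "convergent (\<lambda>k. v k (\<gamma> 1))" by simp
    have "lim (\<lambda>k. v k (\<gamma> 1) - v k (\<gamma> 0)) = lim (\<lambda>k. v k (\<gamma> 1)) - lim (\<lambda>k. v k (\<gamma> 0))"
      using conv0 conv1 by (intro limI tendsto_diff) (simp_all add: convergent_LIMSEQ_iff)
    with geo(2)[of 1 n]
    have "\<bar>(lim (\<lambda>k. v k (\<gamma> 1)) - v n (\<gamma> 1)) - (lim (\<lambda>k. v k (\<gamma> 0)) - v n (\<gamma> 0))\<bar> \<le> 2 * (1/2)^n * A"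
      by (simp add: algebra_simps)
    then have "ennreal \<bar>(lim (\<lambda>k. v k (\<gamma> 1)) - v n (\<gamma> 1)) - (lim (\<lambda>k. v k (\<gamma> 0)) - v n (\<gamma> 0))\<bar>
      \<le> ennreal (2 * (1/2)^n) * line_integral \<gamma> S"
      unfolding A(1) using A(2) by (subst ennreal_mult[symmetric]) (auto intro!: ennreal_leI)
    then show ?thesis
      using S(1) by (simp add: ug_inequality_def pathstart_def pathfinish_def line_integral_cmult[OF \<gamma>(1)])
  qed
  then show ?thesis
    unfolding weak_upper_gradient_iff using \<sigma>(1,2) S(1) by auto
qed

end

subsection \<open>Averages over balls\<close>

text \<open>With \<open>a = 1 / p\<close> this lets a p-th root be integrated over a space of finite
  measure at the cost of an additive constant, in the role of Hoelder's inequality.\<close>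

lemma epowr_le_one_plus:
  assumes "0 \<le> a" "a \<le> 1"
  shows "epowr t a \<le> 1 + t"
proof (cases t)
  case (real r)
  have "r powr a \<le> 1 + r"
  proof (cases "r \<le> 1")
    case True
    then have "r powr a \<le> 1" using real assms by (intro powr_le1) auto
    then show ?thesis using real by simp
  next
    case False
    then have "r powr a \<le> r powr 1" using assms by (intro powr_mono) auto
    then show ?thesis using False by simp
  qed
  then have "ennreal (r powr a) \<le> ennreal (1 + r)" by (rule ennreal_leI)
  then show ?thesis using real by (simp add: epowr_ennreal)
qed simp

text \<open>Since all distances are below \<open>R\<close>, every ball of radius \<open>R\<close> is
  the whole space; the dyadic chain of balls starts there, at the global mean. The existential
  constants of the hypotheses are fixed as parameters.\<close>

locale poincare_space = borel_space_measure +
  fixes R D K c :: real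
  assumes nonempty: "space \<mu> \<noteq> {}"
    and diam: "\<And>x y. x \<in> space \<mu> \<Longrightarrow> y \<in> space \<mu> \<Longrightarrow> dist x y < R"
    and pos: "\<And>x r. x \<in> space \<mu> \<Longrightarrow> 0 < r \<Longrightarrow> 0 < emeasure \<mu> (ball x r \<inter> space \<mu>)"
    and fin: "emeasure \<mu> (space \<mu>) < top"
    and D: "0 < D"
    and dbl: "\<And>x r. x \<in> space \<mu> \<Longrightarrow> 0 < r \<Longrightarrow>
      emeasure \<mu> (ball x (2 * r) \<inter> space \<mu>) \<le> ennreal D * emeasure \<mu> (ball x r \<inter> space \<mu>)"
    and K: "0 < K" and c: "1 \<le> c"
    and poinc: "\<And>x r u g. x \<in> space \<mu> \<Longrightarrow> 0 < r \<Longrightarrow> u \<in> borel_measurable \<mu> \<Longrightarrow>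
      set_integrable \<mu> (ball x r \<inter> space \<mu>) u \<Longrightarrow> upper_gradient (space \<mu>) u g \<Longrightarrow>
      (\<integral>\<^sup>+z\<in>ball x r \<inter> space \<mu>. ennreal \<bar>u z - (LINT z:ball x r \<inter> space \<mu>|\<mu>. u z) /
          measure \<mu> (ball x r \<inter> space \<mu>)\<bar> \<partial>\<mu>) / emeasure \<mu> (ball x r \<inter> space \<mu>)
      \<le> ennreal (K * r) * epowr ((\<integral>\<^sup>+z\<in>ball x (c * r) \<inter> space \<mu>. epowr (g z) p \<partial>\<mu>) /
          emeasure \<mu> (ball x (c * r) \<inter> space \<mu>)) (1 / p)"
begin

sublocale finite_measure \<mu>
  using fin by (intro finite_measureI) auto

definition B :: "'a \<Rightarrow> real \<Rightarrow> 'a set" where "B x r = ball x r \<inter> \<Omega>"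

definition m :: "'a \<Rightarrow> real \<Rightarrow> real" where "m x r = measure \<mu> (B x r)"

lemma open_Int_space_in_sets: "open U \<Longrightarrow> U \<inter> \<Omega> \<in> sets \<mu>"
  using borel_subset by (auto simp: sets_restrict_space Int_commute)

lemma B_sets [measurable, simp]: "B x r \<in> sets \<mu>"
  by (simp add: B_def open_Int_space_in_sets)

lemma emeasure_B: "emeasure \<mu> (B x r) = ennreal (m x r)"
  by (simp add: m_def emeasure_eq_measure)

lemma m_pos: "x \<in> \<Omega> \<Longrightarrow> 0 < r \<Longrightarrow> 0 < m x r"
  using pos[of x r] by (simp add: emeasure_B flip: B_def)

lemma m_mono: "B x r \<subseteq> B y s \<Longrightarrow> m x r \<le> m y s"
  unfolding m_def by (intro finite_measure_mono) auto

lemma m_double: "x \<in> \<Omega> \<Longrightarrow> 0 < r \<Longrightarrow> m x (2 * r) \<le> D * m x r"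
  using dbl[of x r] D by (simp add: emeasure_B m_def flip: B_def ennreal_mult)

lemma R_pos: "0 < R"
  using nonempty diam by fastforce

lemma B_R: "x \<in> \<Omega> \<Longrightarrow> R \<le> r \<Longrightarrow> B x r = \<Omega>"
  using diam by (fastforce simp: B_def)

lemma m_iterate: "x \<in> \<Omega> \<Longrightarrow> 0 < r \<Longrightarrow> m x (2^k * r) \<le> D^k * m x r"
proof (induction k)
  case (Suc k)
  have "m x (2^Suc k * r) \<le> D * m x (2^k * r)"
    using m_double[of x "2^k * r"] Suc by (simp add: mult_ac)
  also have "\<dots> \<le> D * (D^k * m x r)" using Suc D by simp
  finally show ?case by (simp add: mult_ac)
qed simp

text \<open>Total boundedness from doubling: around points at mutual distance at least
  \<open>e\<close> the balls of radius \<open>e / 2\<close> are disjoint, and each has a definite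
  share of the finite total measure. The number of such points is bounded, and a separated set with
  the most points is a net.\<close>

lemma finite_net:
  assumes "0 < e"
  obtains F where "finite F" "F \<subseteq> \<Omega>" "\<And>x. x \<in> \<Omega> \<Longrightarrow> \<exists>q\<in>F. dist x q < e"
proof -
  obtain k :: nat where k: "R / (e / 2) < 2^k" using real_arch_pow[of 2] by auto
  \<comment> \<open>After \<open>k\<close> doublings a ball of radius \<open>e / 2\<close> fills the
    space, so each such ball has at least this measure.\<close>
  define \<delta> where "\<delta> = measure \<mu> \<Omega> / D^k"
  have small: "\<delta> \<le> m x (e/2)" if "x \<in> \<Omega>" for x
  proof -
    have "R \<le> 2^k * (e/2)" using k assms by (simp add: field_simps)
    then have "measure \<mu> \<Omega> = m x (2^k * (e/2))" using that by (simp add: B_R m_def)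
    also have "\<dots> \<le> D^k * m x (e/2)" using that assms by (intro m_iterate) auto
    finally show ?thesis using D by (simp add: \<delta>_def field_simps)
  qed
  obtain x0 where x0: "x0 \<in> \<Omega>" using nonempty by auto
  have "measure \<mu> \<Omega> = m x0 R" using x0 by (simp add: m_def B_R)
  then have \<delta>: "0 < \<delta>" using m_pos[OF x0 R_pos] D by (simp add: \<delta>_def)
  define P where "P F \<longleftrightarrow> finite F \<and> F \<subseteq> \<Omega> \<and> (\<forall>x\<in>F. \<forall>y\<in>F. x \<noteq> y \<longrightarrow> e \<le> dist x y)" for F
  have card_le: "real (card F) * \<delta> \<le> measure \<mu> \<Omega>" if F: "P F" for F
  proof -
    have disj: "disjoint_family_on (\<lambda>x. B x (e/2)) F"
    proof (unfold disjoint_family_on_def, safe)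
      fix x y z assume xy: "x \<in> F" "y \<in> F" "x \<noteq> y" and z: "z \<in> B x (e/2)" "z \<in> B y (e/2)"
      have "dist x y \<le> dist x z + dist y z" by (rule dist_triangle2)
      also have "\<dots> < e" using z by (simp add: B_def)
      finally have False using F xy by (force simp: P_def)
      then show "z \<in> {}" ..
    qed
    have "real (card F) * \<delta> = (\<Sum>x\<in>F. \<delta>)" by simp
    also have "\<dots> \<le> (\<Sum>x\<in>F. measure \<mu> (B x (e/2)))"
      using F by (intro sum_mono) (auto simp: P_def small simp flip: m_def)
    also have "\<dots> = measure \<mu> (\<Union>x\<in>F. B x (e/2))"
      using F disj by (intro finite_measure_finite_Union[symmetric]) (auto simp: P_def)
    also have "\<dots> \<le> measure \<mu> \<Omega>" by (rule bounded_measure)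
    finally show ?thesis .
  qed
  have bound: "\<forall>F. P F \<longrightarrow> card F < nat \<lceil>measure \<mu> \<Omega> / \<delta>\<rceil> + 1"
  proof safe
    fix F assume "P F"
    from card_le[OF this] \<delta> have "real (card F) \<le> measure \<mu> \<Omega> / \<delta>" by (simp add: field_simps)
    then have "card F \<le> nat \<lceil>measure \<mu> \<Omega> / \<delta>\<rceil>" by linarith
    then show "card F < nat \<lceil>measure \<mu> \<Omega> / \<delta>\<rceil> + 1" by simp
  qed
  have "P {}" by (simp add: P_def)
  from ex_has_greatest_nat[of P, OF this bound]
  obtain F where F: "P F" and max: "\<And>G. P G \<Longrightarrow> card G \<le> card F" by blast
  show ?thesis
  proof
    show "finite F" "F \<subseteq> \<Omega>" using F by (auto simp: P_def)
    show "\<exists>q\<in>F. dist x q < e" if x: "x \<in> \<Omega>" for x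
    proof (rule ccontr)
      assume "\<not> ?thesis"
      then have far: "e \<le> dist x q" if "q \<in> F" for q using that by force
      then have "x \<notin> F" using assms by force
      moreover have "P (insert x F)" using F x far by (auto simp: P_def dist_commute)
      ultimately show False using max[of "insert x F"] F by (simp add: P_def)
    qed
  qed
qed

lemma countable_dense:
  obtains Q where "countable Q" "Q \<subseteq> \<Omega>" "\<And>x e. x \<in> \<Omega> \<Longrightarrow> 0 < e \<Longrightarrow> \<exists>q\<in>Q. dist x q < e"
proof -
  have "\<forall>n::nat. \<exists>F. finite F \<and> F \<subseteq> \<Omega> \<and> (\<forall>x\<in>\<Omega>. \<exists>q\<in>F. dist x q < inverse (real (Suc n)))"
  proof
    fix n :: nat
    have "0 < inverse (real (Suc n))" by simp
    then obtain F where "finite F" "F \<subseteq> \<Omega>" "\<And>x. x \<in> \<Omega> \<Longrightarrow> \<exists>q\<in>F. dist x q < inverse (real (Suc n))"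
      by (rule finite_net) blast
    then show "\<exists>F. finite F \<and> F \<subseteq> \<Omega> \<and> (\<forall>x\<in>\<Omega>. \<exists>q\<in>F. dist x q < inverse (real (Suc n)))" by blast
  qed
  then obtain F where F: "\<And>n::nat. finite (F n) \<and> F n \<subseteq> \<Omega> \<and> (\<forall>x\<in>\<Omega>. \<exists>q\<in>F n. dist x q < inverse (real (Suc n)))"
    by metis
  show ?thesis
  proof
    show "countable (\<Union>n. F n)" using F by (auto intro: countable_finite)
    show "(\<Union>n. F n) \<subseteq> \<Omega>" using F by blast
    fix x e :: "_" assume x: "x \<in> \<Omega>" and e: "0 < (e::real)"
    obtain n where "inverse (real (Suc n)) < e" using reals_Archimedean[OF e] by auto
    moreover obtain q where "q \<in> F n" "dist x q < inverse (real (Suc n))" using F x by blast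
    ultimately show "\<exists>q\<in>\<Union>n. F n. dist x q < e" by force
  qed
qed

text \<open>Without separability of \<open>\<Omega>\<close> the distance need not be measurable for the product sigma-algebra.\<close>

lemma dist_measurable [measurable]: "(\<lambda>z. dist (fst z) (snd z)) \<in> borel_measurable (\<mu> \<Otimes>\<^sub>M \<mu>)"
proof (rule borel_measurableI_less)
  fix r :: real
  obtain Q where Q: "countable Q" "Q \<subseteq> \<Omega>" "\<And>x e. x \<in> \<Omega> \<Longrightarrow> 0 < e \<Longrightarrow> \<exists>q\<in>Q. dist x q < e"
    by (rule countable_dense) blast
  \<comment> \<open>Countably many rectangles: a pair is closer than \<open>r\<close> exactly when
    both points lie in balls about a common \<open>q\<close> whose radii add up to \<open>r\<close>,
    and one radius can be taken rational.\<close>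
  have "{z \<in> space (\<mu> \<Otimes>\<^sub>M \<mu>). dist (fst z) (snd z) < r} = (\<Union>q\<in>Q. \<Union>s\<in>\<rat>. B q s \<times> B q (r - s))"
  proof (intro equalityI subsetI)
    fix z assume z: "z \<in> {z \<in> space (\<mu> \<Otimes>\<^sub>M \<mu>). dist (fst z) (snd z) < r}"
    obtain x y where xy: "z = (x, y)" by (cases z)
    have x: "x \<in> \<Omega>" "y \<in> \<Omega>" "dist x y < r" using z by (auto simp: xy space_pair_measure)
    \<comment> \<open>A third of the slack: \<open>q\<close> within \<open>e\<close> of
      \<open>x\<close> and \<open>s\<close> between \<open>e\<close> and \<open>2 * e\<close> leave
      \<open>dist q y < r - s\<close>.\<close>
    define e where "e = (r - dist x y) / 3"
    have e: "0 < e" using x by (simp add: e_def)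
    obtain q where q: "q \<in> Q" "dist x q < e" using Q(3)[OF x(1) e] by blast
    obtain s where s: "s \<in> \<rat>" "e < s" "s < 2 * e" using Rats_dense_in_real[of e "2*e"] e by auto
    have "dist q y \<le> dist x q + dist x y" by (metis dist_commute dist_triangle)
    then have "dist q y < r - s" using q s by (simp add: e_def field_simps)
    then have "z \<in> B q s \<times> B q (r - s)"
      using x q s by (simp add: xy B_def dist_commute)
    then show "z \<in> (\<Union>q\<in>Q. \<Union>s\<in>\<rat>. B q s \<times> B q (r - s))"
      using q(1) s(1) by blast
  next
    fix z assume "z \<in> (\<Union>q\<in>Q. \<Union>s\<in>\<rat>. B q s \<times> B q (r - s))"
    then obtain x y q s where z: "z = (x, y)" "x \<in> B q s" "y \<in> B q (r - s)" by auto
    have "dist x y \<le> dist q x + dist q y" by (metis dist_commute dist_triangle)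
    then show "z \<in> {z \<in> space (\<mu> \<Otimes>\<^sub>M \<mu>). dist (fst z) (snd z) < r}"
      using z by (auto simp: B_def space_pair_measure)
  qed
  moreover have "(\<Union>q\<in>Q. \<Union>s\<in>\<rat>. B q s \<times> B q (r - s)) \<in> sets (\<mu> \<Otimes>\<^sub>M \<mu>)"
    using Q(1) by (intro sets.countable_UN'' countable_rat pair_measureI) auto
  ultimately show "{z \<in> space (\<mu> \<Otimes>\<^sub>M \<mu>). dist (fst z) (snd z) < r} \<in> sets (\<mu> \<Otimes>\<^sub>M \<mu>)" by simp
qed

text \<open>On \<Omega> this is the indicator of a ball, but written as a kernel: its symmetry and
  joint measurability are what Fubini needs.\<close>

definition near :: "real \<Rightarrow> 'a \<Rightarrow> 'a \<Rightarrow> real" where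
  "near r x y = (if dist x y < r then 1 else 0)"

lemma near_commute: "near r x y = near r y x"
  by (simp add: near_def dist_commute)

lemma near_measurable [measurable]:
  "(\<lambda>z. near r (fst z) (snd z)) \<in> borel_measurable (\<mu> \<Otimes>\<^sub>M \<mu>)"
  "(\<lambda>z. near r (snd z) (fst z)) \<in> borel_measurable (\<mu> \<Otimes>\<^sub>M \<mu>)"
  "x \<in> \<Omega> \<Longrightarrow> near r x \<in> borel_measurable \<mu>"
proof -
  show 1: "(\<lambda>z. near r (fst z) (snd z)) \<in> borel_measurable (\<mu> \<Otimes>\<^sub>M \<mu>)"
    unfolding near_def by measurable
  then show "(\<lambda>z. near r (snd z) (fst z)) \<in> borel_measurable (\<mu> \<Otimes>\<^sub>M \<mu>)"
    by (simp add: near_commute[of r "snd _"])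
  show "near r x \<in> borel_measurable \<mu>" if "x \<in> \<Omega>"
    using measurable_compose[OF measurable_Pair1'[OF that] 1] by simp
qed

lemma near_eq_indicator: "y \<in> \<Omega> \<Longrightarrow> near r x y = indicator (B x r) y"
  by (simp add: near_def B_def)

lemma nn_integral_B:
  "(\<integral>\<^sup>+y\<in>B x r. h y \<partial>\<mu>) = (\<integral>\<^sup>+y. ennreal (near r x y) * h y \<partial>\<mu>)"
  by (intro nn_integral_cong) (auto simp: near_eq_indicator indicator_def)

lemma integral_B:
  fixes u :: "'a \<Rightarrow> real"
  shows "(LINT y:B x r|\<mu>. u y) = (LINT y|\<mu>. near r x y * u y)"
  unfolding set_lebesgue_integral_def
  by (intro Bochner_Integration.integral_cong) (auto simp: near_eq_indicator)

lemma m_eq: "m x r = (LINT y|\<mu>. near r x y)"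
proof -
  have "m x r = (LINT y|\<mu>. indicator (B x r) y)" by (simp add: m_def)
  also have "\<dots> = (LINT y|\<mu>. near r x y)"
    by (intro Bochner_Integration.integral_cong) (auto simp: near_eq_indicator)
  finally show ?thesis .
qed

lemma m_measurable [measurable]: "(\<lambda>x. m x r) \<in> borel_measurable \<mu>"
  unfolding m_eq by (rule borel_measurable_lebesgue_integral) (simp add: case_prod_beta)

text \<open>A ball about \<open>x\<close> lies in the doubled ball about a nearby \<open>y\<close>,
  so balls of equal radius with nearby centres have comparable mass.\<close>

lemma m_inverse_le:
  assumes "x \<in> \<Omega>" "y \<in> \<Omega>" "dist x y < r" "0 < r"
  shows "1 / m y r \<le> D / m x r"
proof -
  have "B x r \<subseteq> B y (2 * r)"
  proof
    fix z assume z: "z \<in> B x r"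
    have "dist y z \<le> dist x y + dist x z" by (metis dist_commute dist_triangle)
    then show "z \<in> B y (2 * r)" using z assms by (simp add: B_def)
  qed
  then have "m x r \<le> D * m y r"
    using m_mono m_double[OF assms(2,4)] by (meson order_trans)
  then show ?thesis
    using m_pos[OF assms(1,4)] m_pos[OF assms(2,4)] by (simp add: field_simps)
qed

section \<open>Averaging at a fixed radius as an operator on nonnegative functions\<close>

definition avg :: "real \<Rightarrow> ('a \<Rightarrow> ennreal) \<Rightarrow> 'a \<Rightarrow> ennreal" where
  "avg r h x = ennreal (1 / m x r) * (\<integral>\<^sup>+y. ennreal (near r x y) * h y \<partial>\<mu>)"

lemma avg_eq:
  assumes "x \<in> \<Omega>" "0 < r"
  shows "(\<integral>\<^sup>+y\<in>B x r. h y \<partial>\<mu>) / emeasure \<mu> (B x r) = avg r h x"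
  using m_pos[OF assms]
  by (simp add: avg_def emeasure_B nn_integral_B divide_ennreal_def inverse_ennreal mult.commute inverse_eq_divide)

text \<open>Fubini with the symmetric kernel; the normalizing mass at \<open>y\<close> is traded for
  the one at \<open>x\<close> at the price of \<open>D\<close>.\<close>

lemma avg_swap:
  assumes f [measurable]: "(\<lambda>z. f (fst z) (snd z)) \<in> borel_measurable (\<mu> \<Otimes>\<^sub>M \<mu>)" and r: "0 < r"
  shows "(\<integral>\<^sup>+y. avg r (\<lambda>x. f x y) y \<partial>\<mu>) \<le> ennreal D * (\<integral>\<^sup>+x. avg r (f x) x \<partial>\<mu>)"
proof -
  interpret pair_sigma_finite \<mu> \<mu> ..
  have f1 [measurable]: "f x \<in> borel_measurable \<mu>" if "x \<in> \<Omega>" for x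
    using measurable_compose[OF measurable_Pair1'[OF that] f] by simp
  have f2 [measurable]: "(\<lambda>x. f x y) \<in> borel_measurable \<mu>" if "y \<in> \<Omega>" for y
    using measurable_compose[OF measurable_Pair2'[OF that] f] by simp
  have "(\<integral>\<^sup>+y. avg r (\<lambda>x. f x y) y \<partial>\<mu>) =
      (\<integral>\<^sup>+y. (\<integral>\<^sup>+x. ennreal (1 / m y r) * (ennreal (near r y x) * f x y) \<partial>\<mu>) \<partial>\<mu>)"
    by (intro nn_integral_cong) (simp add: avg_def nn_integral_cmult)
  also have "\<dots> = (\<integral>\<^sup>+x. (\<integral>\<^sup>+y. ennreal (1 / m y r) * (ennreal (near r y x) * f x y) \<partial>\<mu>) \<partial>\<mu>)"
    by (rule Fubini') (simp add: case_prod_beta)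
  also have "\<dots> \<le> (\<integral>\<^sup>+x. (\<integral>\<^sup>+y. ennreal (D / m x r) * (ennreal (near r x y) * f x y) \<partial>\<mu>) \<partial>\<mu>)"
  proof (intro nn_integral_mono)
    fix x y assume xy: "x \<in> \<Omega>" "y \<in> \<Omega>"
    show "ennreal (1 / m y r) * (ennreal (near r y x) * f x y)
      \<le> ennreal (D / m x r) * (ennreal (near r x y) * f x y)"
      using m_inverse_le[OF xy _ r]
      by (cases "dist x y < r") (auto simp: near_def dist_commute intro!: mult_right_mono ennreal_leI)
  qed
  also have "\<dots> = (\<integral>\<^sup>+x. ennreal D * avg r (f x) x \<partial>\<mu>)"
  proof (intro nn_integral_cong)
    fix x assume x: "x \<in> \<Omega>"
    have "ennreal (D / m x r) = ennreal D * ennreal (1 / m x r)"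
      using D m_pos[OF x r] by (simp flip: ennreal_mult)
    then show "(\<integral>\<^sup>+y. ennreal (D / m x r) * (ennreal (near r x y) * f x y) \<partial>\<mu>) = ennreal D * avg r (f x) x"
      using x by (simp add: nn_integral_cmult avg_def mult.assoc)
  qed
  also have "\<dots> = ennreal D * (\<integral>\<^sup>+x. avg r (f x) x \<partial>\<mu>)"
    unfolding avg_def by (intro nn_integral_cmult) measurable
  finally show ?thesis .
qed

lemma avg_const: "x \<in> \<Omega> \<Longrightarrow> 0 < r \<Longrightarrow> avg r (\<lambda>y. t) x = t"
proof -
  assume x: "x \<in> \<Omega>" "0 < r"
  have "(\<integral>\<^sup>+y. ennreal (near r x y) * t \<partial>\<mu>) = (\<integral>\<^sup>+y\<in>B x r. t \<partial>\<mu>)" by (simp add: nn_integral_B)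
  also have "\<dots> = t * ennreal (m x r)"
    by (subst nn_integral_cmult_indicator) (simp_all add: emeasure_B)
  also have "ennreal (1 / m x r) * \<dots> = t * ennreal (1 / m x r * m x r)"
    using m_pos[OF x] by (subst ennreal_mult) (auto simp: mult_ac)
  finally show ?thesis using m_pos[OF x] by (simp add: avg_def)
qed

lemma avg_mono: "x \<in> \<Omega> \<Longrightarrow> (\<And>y. y \<in> \<Omega> \<Longrightarrow> dist x y < r \<Longrightarrow> f y \<le> g y) \<Longrightarrow> avg r f x \<le> avg r g x"
proof -
  assume *: "x \<in> \<Omega>" "\<And>y. y \<in> \<Omega> \<Longrightarrow> dist x y < r \<Longrightarrow> f y \<le> g y"
  have "ennreal (near r x y) * f y \<le> ennreal (near r x y) * g y" if "y \<in> \<Omega>" for y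
    using *(2)[OF that] by (cases "dist x y < r") (auto simp: near_def)
  then show ?thesis unfolding avg_def by (intro mult_left_mono[OF nn_integral_mono]) auto
qed

lemma avg_add:
  "x \<in> \<Omega> \<Longrightarrow> f \<in> borel_measurable \<mu> \<Longrightarrow> g \<in> borel_measurable \<mu> \<Longrightarrow>
    avg r (\<lambda>y. f y + g y) x = avg r f x + avg r g x"
  unfolding avg_def by (simp add: distrib_left nn_integral_add)

lemma avg_measurable [measurable]:
  assumes [measurable]: "h \<in> borel_measurable \<mu>"
  shows "avg r h \<in> borel_measurable \<mu>"
  unfolding avg_def[abs_def] by measurable

text \<open>The case of \<open>avg_swap\<close> in which \<open>f\<close> depends on its first
  argument only: after the exchange a constant is averaged.\<close>

lemma nn_integral_avg_le:
  assumes [measurable]: "h \<in> borel_measurable \<mu>" and r: "0 < r"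
  shows "(\<integral>\<^sup>+y. avg r h y \<partial>\<mu>) \<le> ennreal D * (\<integral>\<^sup>+x. h x \<partial>\<mu>)"
proof -
  have "(\<integral>\<^sup>+y. avg r h y \<partial>\<mu>) \<le> ennreal D * (\<integral>\<^sup>+x. avg r (\<lambda>y. h x) x \<partial>\<mu>)"
    using avg_swap[of "\<lambda>x y. h x" r] r by simp
  also have "(\<integral>\<^sup>+x. avg r (\<lambda>y. h x) x \<partial>\<mu>) = (\<integral>\<^sup>+x. h x \<partial>\<mu>)"
    using r by (intro nn_integral_cong) (simp add: avg_const)
  finally show ?thesis .
qed

end

subsection \<open>The strong Poincare inequality on the whole space\<close>

context poincare_space
begin

text \<open>Two doublings give \<open>D^2\<close>, and the Poincare inequality is applied on a ball
  of radius twice \<open>r\<close>, whence \<open>2 * K\<close>; see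
  \<open>ball_mean_diff\<close>.\<close>

definition osc_const where "osc_const = 2 * K * D^2"

text \<open>The 3 is the sum of the powers of 2/3, the weights 3/4 enter through their p-th powers,
  and \<open>D\<close> is the bound for averaging on L^1.\<close>

definition pp_const where
  "pp_const = (3 * osc_const * R) powr p * (D / (1 - (3/4) powr p))"

lemma osc_const_pos: "0 < osc_const" using K D by (simp add: osc_const_def)

lemma pp_const_pos: "0 < pp_const"
proof -
  have "(3/4::real) powr p < (3/4) powr 0" using p_pos by (intro powr_less_mono') auto
  then show ?thesis using osc_const_pos R_pos D by (simp add: pp_const_def)
qed

section \<open>Means over balls and the chain between scales\<close>

definition mean :: "('a \<Rightarrow> real) \<Rightarrow> real" where
  "mean u = (LINT y|\<mu>. u y) / measure \<mu> \<Omega>"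

definition ball_mean :: "('a \<Rightarrow> real) \<Rightarrow> real \<Rightarrow> 'a \<Rightarrow> real" where
  "ball_mean u r x = (LINT y|\<mu>. near r x y * u y) / m x r"

lemma ball_mean_measurable [measurable]:
  assumes [measurable]: "u \<in> borel_measurable \<mu>"
  shows "ball_mean u r \<in> borel_measurable \<mu>"
  unfolding ball_mean_def[abs_def]
  by (intro borel_measurable_divide borel_measurable_lebesgue_integral) (simp_all add: case_prod_beta)

lemma ball_mean_R:
  assumes "x \<in> \<Omega>" "R \<le> r"
  shows "ball_mean u r x = mean u"
proof -
  have "(LINT y|\<mu>. near r x y * u y) = (LINT y|\<mu>. u y)"
    using assms by (intro Bochner_Integration.integral_cong) (auto simp: near_eq_indicator B_R)
  then show ?thesis using assms by (simp add: ball_mean_def mean_def m_def B_R)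
qed

lemma integrable_near:
  assumes "integrable \<mu> u"
  shows "integrable \<mu> (\<lambda>y. near r x y * u y)"
proof -
  have "integrable \<mu> (\<lambda>y. indicator (B x r) y *\<^sub>R u y)"
    using assms by (intro integrable_mult_indicator) auto
  also have "?this \<longleftrightarrow> ?thesis"
    by (intro Bochner_Integration.integrable_cong) (auto simp: near_eq_indicator)
  finally show ?thesis .
qed

lemma ball_mean_minus_const:
  assumes u: "integrable \<mu> u" and x: "x \<in> \<Omega>" "0 < r"
  shows "ennreal \<bar>ball_mean u r x - t\<bar> \<le> avg r (\<lambda>y. ennreal \<bar>u y - t\<bar>) x"
proof -
  have int: "integrable \<mu> (\<lambda>y. near r x y * (u y - t))"
    using u by (intro integrable_near) auto
  have int1: "integrable \<mu> (\<lambda>y. near r x y * 1)"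
    by (intro integrable_near) auto
  have "(LINT y|\<mu>. near r x y * (u y - t)) = (LINT y|\<mu>. near r x y * u y - t * (near r x y * 1))"
    by (simp add: algebra_simps)
  also have "\<dots> = (LINT y|\<mu>. near r x y * u y) - t * m x r"
    using integrable_near[OF u] int1 by (subst Bochner_Integration.integral_diff) (auto simp: m_eq)
  finally have "ball_mean u r x - t = (1 / m x r) * (LINT y|\<mu>. near r x y * (u y - t))"
    using m_pos[OF x] by (simp add: ball_mean_def field_simps)
  then have "\<bar>ball_mean u r x - t\<bar> = (1 / m x r) * \<bar>LINT y|\<mu>. near r x y * (u y - t)\<bar>"
    using m_pos[OF x] by (simp add: abs_mult)
  then have "ennreal \<bar>ball_mean u r x - t\<bar> = ennreal (1 / m x r) * ennreal \<bar>LINT y|\<mu>. near r x y * (u y - t)\<bar>"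
    using m_pos[OF x] by (simp only: ennreal_mult abs_ge_zero divide_nonneg_pos zero_le_one)
  also have "\<dots> \<le> ennreal (1 / m x r) * (\<integral>\<^sup>+y. ennreal (norm (near r x y * (u y - t))) \<partial>\<mu>)"
    using integral_norm_bound_ennreal[OF int] by (intro mult_left_mono) auto
  also have "\<dots> = avg r (\<lambda>y. ennreal \<bar>u y - t\<bar>) x"
    unfolding avg_def by (simp add: abs_mult near_def ennreal_mult)
  finally show ?thesis .
qed

lemma oscillation_le:
  assumes u: "integrable \<mu> u" and g: "upper_gradient \<Omega> u g" and x: "x \<in> \<Omega>" "0 < r"
  shows "avg r (\<lambda>y. ennreal \<bar>u y - ball_mean u r x\<bar>) x
    \<le> ennreal (K * r) * epowr (avg (c * r) (\<lambda>y. epowr (g y) p) x) (1 / p)"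
proof -
  have cr: "0 < c * r" using c x by simp
  have "set_integrable \<mu> (B x r) u"
    unfolding set_integrable_def using u by (intro integrable_mult_indicator) auto
  with poinc[of x r u g] u g x show ?thesis
    using avg_eq[OF x, of "\<lambda>y. ennreal \<bar>u y - ball_mean u r x\<bar>"] avg_eq[OF x(1) cr, of "\<lambda>y. epowr (g y) p"]
    by (simp add: ball_mean_def integral_B borel_measurable_integrable flip: B_def m_def)
qed

text \<open>\<open>B x r\<close> lies in \<open>B y (2 * r)\<close>, which lies in
  \<open>B x (4 * r)\<close>; the mass of the last is at most \<open>D^2\<close> times that of the
  first.\<close>

lemma avg_le_double:
  assumes "x \<in> \<Omega>" "y \<in> \<Omega>" "dist x y < r" "0 < r"
  shows "avg r h x \<le> ennreal (D^2) * avg (2 * r) h y"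
proof -
  have "B y (2 * r) \<subseteq> B x (2 * (2 * r))"
  proof
    fix z assume z: "z \<in> B y (2 * r)"
    have "dist x z \<le> dist x y + dist y z" by (rule dist_triangle)
    then show "z \<in> B x (2 * (2 * r))" using z assms by (simp add: B_def)
  qed
  then have "m y (2 * r) \<le> m x (2 * (2 * r))" by (rule m_mono)
  also have "\<dots> \<le> D * (D * m x r)"
    using m_double[of x "2 * r"] m_double[of x r] assms D by (meson mult_left_mono less_imp_le mult_pos_pos order_trans zero_less_numeral)
  finally have "1 / m x r \<le> D^2 * (1 / m y (2 * r))"
    using m_pos[OF assms(1,4)] m_pos[of y "2 * r"] assms by (simp add: field_simps power2_eq_square)
  then have w: "ennreal (1 / m x r) \<le> ennreal (D^2) * ennreal (1 / m y (2 * r))"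
    using m_pos[of y "2 * r"] assms by (simp add: ennreal_leI flip: ennreal_mult)
  have "near r x z \<le> near (2 * r) y z" for z
    using dist_triangle[of y z x] assms(3,4) by (auto simp: near_def dist_commute)
  then have "(\<integral>\<^sup>+z. ennreal (near r x z) * h z \<partial>\<mu>) \<le> (\<integral>\<^sup>+z. ennreal (near (2 * r) y z) * h z \<partial>\<mu>)"
    by (intro nn_integral_mono mult_right_mono ennreal_leI) auto
  then show ?thesis
    unfolding avg_def mult.assoc[symmetric] by (intro mult_mono w) auto
qed

text \<open>The mean over the larger ball is a constant, from which the smaller mean deviates by at
  most the average deviation of \<open>u\<close>; that average passes to the larger ball, where the
  Poincare inequality applies. With \<open>y = x\<close> this is a link of the dyadic chain, with
  other \<open>y\<close> it changes the centre.\<close>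

lemma ball_mean_diff:
  assumes u: "integrable \<mu> u" and g: "upper_gradient \<Omega> u g"
    and xy: "x \<in> \<Omega>" "y \<in> \<Omega>" "dist x y < r" "0 < r"
  shows "ennreal \<bar>ball_mean u r x - ball_mean u (2 * r) y\<bar>
    \<le> ennreal (osc_const * r) * epowr (avg (2 * c * r) (\<lambda>y. epowr (g y) p) y) (1 / p)"
proof -
  have "ennreal \<bar>ball_mean u r x - ball_mean u (2 * r) y\<bar>
      \<le> avg r (\<lambda>z. ennreal \<bar>u z - ball_mean u (2 * r) y\<bar>) x"
    using u xy by (intro ball_mean_minus_const) auto
  also have "\<dots> \<le> ennreal (D^2) * avg (2 * r) (\<lambda>z. ennreal \<bar>u z - ball_mean u (2 * r) y\<bar>) y"
    using xy by (intro avg_le_double) auto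
  also have "\<dots> \<le> ennreal (D^2) * (ennreal (K * (2 * r)) * epowr (avg (c * (2 * r)) (\<lambda>y. epowr (g y) p) y) (1 / p))"
    using xy by (intro mult_left_mono oscillation_le[OF u g]) auto
  also have "\<dots> = ennreal (D^2 * (K * (2 * r))) * epowr (avg (2 * c * r) (\<lambda>y. epowr (g y) p) y) (1 / p)"
    using K xy by (simp add: ennreal_mult mult.assoc mult.left_commute)
  finally show ?thesis by (simp add: osc_const_def mult_ac)
qed

lemma epowr_measurable_borelm [measurable]: "g \<in> borelm \<Longrightarrow> (\<lambda>y. epowr (g y) p) \<in> borel_measurable \<mu>"
  by (intro epowr_measurable borelm_imp_measurable)

text \<open>No differentiation theorem is needed to recover \<open>u\<close> from its ball means: comparing \<open>u y\<close> with
  the means over balls centred at all \<open>x\<close> near \<open>y\<close>, the Poincare inequality gives a rate of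
  convergence in the mean.\<close>

lemma nn_integral_ball_mean_dist:
  assumes u: "integrable \<mu> u" and g: "upper_gradient \<Omega> u g" "Lp_power g < top"
  obtains C where "0 \<le> C" "\<And>r. 0 < r \<Longrightarrow> (\<integral>\<^sup>+y. ennreal \<bar>u y - ball_mean u r y\<bar> \<partial>\<mu>) \<le> ennreal (C * r)"
proof -
  have [measurable]: "g \<in> borelm" "u \<in> borel_measurable \<mu>" using g u by (auto simp: upper_gradient_def)
  define G where "G = enn2real (Lp_power g)"
  have G: "Lp_power g = ennreal G" "0 \<le> G" using g(2) by (simp_all add: G_def)
  define T where "T r y = avg r (\<lambda>y. epowr (g y) p) y" for r y
  have [measurable]: "T r \<in> borel_measurable \<mu>" for r unfolding T_def by measurable
  \<comment> \<open>Bounds the integral of the p-th root of \<open>T r\<close> for every radius at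
    once: the measure pays for the 1 in \<open>1 + T r y\<close>, and \<open>D * G\<close> for the
    average.\<close>
  define A where "A = measure \<mu> \<Omega> + D * G"
  have A: "0 \<le> A" using D G by (simp add: A_def)
  have int_T: "(\<integral>\<^sup>+y. epowr (T r y) (1 / p) \<partial>\<mu>) \<le> ennreal A" if "0 < r" for r
  proof -
    have "(\<integral>\<^sup>+y. epowr (T r y) (1 / p) \<partial>\<mu>) \<le> (\<integral>\<^sup>+y. 1 + T r y \<partial>\<mu>)"
      using p_gt_1 by (intro nn_integral_mono epowr_le_one_plus) auto
    also have "\<dots> = emeasure \<mu> \<Omega> + (\<integral>\<^sup>+y. T r y \<partial>\<mu>)"
      by (simp add: nn_integral_add)
    also have "\<dots> \<le> emeasure \<mu> \<Omega> + ennreal D * ennreal G"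
      unfolding T_def G(1)[symmetric] using that by (intro add_left_mono nn_integral_avg_le) auto
    also have "\<dots> = ennreal A"
      using D G by (simp add: A_def emeasure_eq_measure flip: ennreal_mult)
    finally show ?thesis .
  qed
  define C where "C = (D * K + 2 * osc_const) * A"
  show ?thesis
  proof
    show "0 \<le> C" using D K osc_const_pos A by (simp add: C_def)
    fix r :: real assume r: "0 < r"
    have cr: "0 < c * r" "0 < 2 * c * r" using c r by auto
    let ?f = "\<lambda>x y. ennreal \<bar>u y - ball_mean u r x\<bar>"
    have f [measurable]: "(\<lambda>z. ?f (fst z) (snd z)) \<in> borel_measurable (\<mu> \<Otimes>\<^sub>M \<mu>)" by measurable
    have "(\<integral>\<^sup>+y. ennreal \<bar>u y - ball_mean u r y\<bar> \<partial>\<mu>)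
      \<le> (\<integral>\<^sup>+y. avg r (\<lambda>x. ?f x y) y + ennreal (2 * osc_const * r) * epowr (T (2 * c * r) y) (1 / p) \<partial>\<mu>)"
    proof (intro nn_integral_mono)
      fix y assume y: "y \<in> \<Omega>"
      have "ennreal \<bar>u y - ball_mean u r y\<bar> = avg r (\<lambda>x. ennreal \<bar>u y - ball_mean u r y\<bar>) y"
        using y r by (simp add: avg_const)
      \<comment> \<open>The detour from the mean at \<open>y\<close> to the mean at \<open>x\<close>
        runs through the ball of radius \<open>2 * r\<close> about \<open>y\<close>, which contains
        both balls.\<close>
      also have "\<dots> \<le> avg r (\<lambda>x. ?f x y + ennreal (2 * osc_const * r) * epowr (T (2 * c * r) y) (1 / p)) y"
      proof (intro avg_mono y)
        fix x assume x: "x \<in> \<Omega>" "dist y x < r"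
        have "ennreal \<bar>u y - ball_mean u r y\<bar> \<le> ennreal (\<bar>u y - ball_mean u r x\<bar> +
            (\<bar>ball_mean u r x - ball_mean u (2 * r) y\<bar> + \<bar>ball_mean u r y - ball_mean u (2 * r) y\<bar>))"
          by (intro ennreal_leI) linarith
        also have "\<dots> = ?f x y + (ennreal \<bar>ball_mean u r x - ball_mean u (2 * r) y\<bar> +
            ennreal \<bar>ball_mean u r y - ball_mean u (2 * r) y\<bar>)" by simp
        also have "\<dots> \<le> ?f x y + (ennreal (osc_const * r) * epowr (T (2 * c * r) y) (1 / p) +
            ennreal (osc_const * r) * epowr (T (2 * c * r) y) (1 / p))"
          unfolding T_def using x y r
          by (intro add_left_mono add_mono ball_mean_diff[OF u g(1)]) (auto simp: dist_commute)
        also have "\<dots> = ?f x y + ennreal (2 * osc_const * r) * epowr (T (2 * c * r) y) (1 / p)"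
          using osc_const_pos r by (simp add: ennreal_mult mult.assoc flip: mult_2)
        finally show "ennreal \<bar>u y - ball_mean u r y\<bar> \<le> ?f x y + ennreal (2 * osc_const * r) * epowr (T (2 * c * r) y) (1 / p)" .
      qed
      also have "\<dots> = avg r (\<lambda>x. ?f x y) y + ennreal (2 * osc_const * r) * epowr (T (2 * c * r) y) (1 / p)"
        using y r by (simp add: avg_add avg_const)
      finally show "ennreal \<bar>u y - ball_mean u r y\<bar> \<le> \<dots>" .
    qed
    also have "\<dots> = (\<integral>\<^sup>+y. avg r (\<lambda>x. ?f x y) y \<partial>\<mu>) + ennreal (2 * osc_const * r) * (\<integral>\<^sup>+y. epowr (T (2 * c * r) y) (1 / p) \<partial>\<mu>)"
    proof (subst nn_integral_add)
      show "(\<lambda>y. avg r (\<lambda>x. ?f x y) y) \<in> borel_measurable \<mu>"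
        unfolding avg_def by measurable
    qed (simp_all add: nn_integral_cmult)
    also have "\<dots> \<le> ennreal (D * (K * r) * A) + ennreal (2 * osc_const * r * A)"
    proof (intro add_mono)
      have "(\<integral>\<^sup>+y. avg r (\<lambda>x. ?f x y) y \<partial>\<mu>) \<le> ennreal D * (\<integral>\<^sup>+x. avg r (?f x) x \<partial>\<mu>)"
        by (rule avg_swap[OF f r])
      \<comment> \<open>After Fubini the inner average is the oscillation on the ball about
        \<open>x\<close>, to which the Poincare inequality applies.\<close>
      also have "\<dots> \<le> ennreal D * (\<integral>\<^sup>+x. ennreal (K * r) * epowr (T (c * r) x) (1 / p) \<partial>\<mu>)"
        unfolding T_def using r by (intro mult_left_mono nn_integral_mono oscillation_le[OF u g(1)]) auto
      also have "\<dots> = ennreal D * (ennreal (K * r) * (\<integral>\<^sup>+x. epowr (T (c * r) x) (1 / p) \<partial>\<mu>))"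
        by (simp add: nn_integral_cmult)
      also have "\<dots> \<le> ennreal D * (ennreal (K * r) * ennreal A)"
        using cr by (intro mult_left_mono int_T) auto
      also have "\<dots> = ennreal (D * (K * r) * A)"
        using D K r A by (simp add: mult.assoc flip: ennreal_mult)
      finally show "(\<integral>\<^sup>+y. avg r (\<lambda>x. ?f x y) y \<partial>\<mu>) \<le> ennreal (D * (K * r) * A)" .
      have "ennreal (2 * osc_const * r) * (\<integral>\<^sup>+y. epowr (T (2 * c * r) y) (1 / p) \<partial>\<mu>) \<le> ennreal (2 * osc_const * r) * ennreal A"
        using cr by (intro mult_left_mono int_T) auto
      also have "\<dots> = ennreal (2 * osc_const * r * A)"
        using osc_const_pos r A by (simp flip: ennreal_mult)
      finally show "ennreal (2 * osc_const * r) * (\<integral>\<^sup>+y. epowr (T (2 * c * r) y) (1 / p) \<partial>\<mu>) \<le> ennreal (2 * osc_const * r * A)" .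
    qed
    also have "\<dots> = ennreal (C * r)"
      using D K osc_const_pos r A by (simp add: C_def algebra_simps flip: ennreal_plus)
    finally show "(\<integral>\<^sup>+y. ennreal \<bar>u y - ball_mean u r y\<bar> \<partial>\<mu>) \<le> ennreal (C * r)" .
  qed
qed

text \<open>The distances in L^1 are of order \<open>R / 2^n\<close>, hence summable; the series of
  pointwise distances is then finite almost everywhere and its terms tend to 0.\<close>

lemma ball_mean_tendsto:
  assumes u: "integrable \<mu> u" and g: "upper_gradient \<Omega> u g" "Lp_power g < top"
  shows "AE y in \<mu>. (\<lambda>n. ball_mean u (R / 2^n) y) \<longlonglongrightarrow> u y"
proof -
  have [measurable]: "u \<in> borel_measurable \<mu>" using u by auto
  obtain C where C: "0 \<le> C" "\<And>r. 0 < r \<Longrightarrow> (\<integral>\<^sup>+y. ennreal \<bar>u y - ball_mean u r y\<bar> \<partial>\<mu>) \<le> ennreal (C * r)"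
    using nn_integral_ball_mean_dist[OF u g] by blast
  have "(\<integral>\<^sup>+y. (\<Sum>n. ennreal \<bar>u y - ball_mean u (R / 2^n) y\<bar>) \<partial>\<mu>) =
      (\<Sum>n. \<integral>\<^sup>+y. ennreal \<bar>u y - ball_mean u (R / 2^n) y\<bar> \<partial>\<mu>)"
    by (intro nn_integral_suminf) auto
  also have "\<dots> \<le> (\<Sum>n. ennreal (C * (R / 2^n)))"
    using R_pos by (intro suminf_le C) auto
  also have "\<dots> = ennreal (\<Sum>n. C * (R / 2^n))"
  proof (intro suminf_ennreal2)
    have "summable (\<lambda>n. C * R * (1/2)^n)" by (intro summable_mult) simp
    then show "summable (\<lambda>n. C * (R / 2^n))" by (simp add: power_one_over field_simps)
  qed (use C R_pos in auto)
  finally have "(\<integral>\<^sup>+y. (\<Sum>n. ennreal \<bar>u y - ball_mean u (R / 2^n) y\<bar>) \<partial>\<mu>) < top"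
    by (simp add: order_le_less_trans)
  then have "AE y in \<mu>. (\<Sum>n. ennreal \<bar>u y - ball_mean u (R / 2^n) y\<bar>) \<noteq> top"
    by (intro nn_integral_noteq_infinite[unfolded infinity_ennreal_def]) auto
  then show ?thesis
  proof eventually_elim
    case (elim y)
    then have "summable (\<lambda>n. \<bar>u y - ball_mean u (R / 2^n) y\<bar>)"
      by (intro summable_suminf_not_top) auto
    then have "(\<lambda>n. u y - ball_mean u (R / 2^n) y) \<longlonglongrightarrow> 0"
      by (intro tendsto_rabs_zero_cancel[OF summable_LIMSEQ_zero])
    from tendsto_diff[OF tendsto_const[of "u y"] this] show ?case by simp
  qed
qed

text \<open>The decay \<open>1 / 2^n\<close> of the links is split as (2/3)^n times (3/4)^n. The
  first factor sums the chain pointwise against the majorant \<open>S\<close>; the second provides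
  the weights of \<open>S\<close> and makes its p-th power integrable.\<close>

theorem poincare_pp:
  assumes u: "integrable \<mu> u" and g: "upper_gradient \<Omega> u g" "Lp_power g < top"
  shows "(\<integral>\<^sup>+y. epowr (ennreal \<bar>u y - mean u\<bar>) p \<partial>\<mu>) \<le> ennreal pp_const * Lp_power g"
proof -
  have [measurable]: "g \<in> borelm" "u \<in> borel_measurable \<mu>" using g u by (auto simp: upper_gradient_def)
  define r where "r n = R / 2^n" for n :: nat
  have r: "0 < r n" for n using R_pos by (simp add: r_def)
  define f where "f n x = epowr (avg (2 * c * r (Suc n)) (\<lambda>y. epowr (g y) p) x) (1 / p)" for n x
  define q :: "nat \<Rightarrow> real" where "q n = (3/4)^n" for n
  define S where "S = Lp_majorant p q f"
  have [measurable]: "f n \<in> borel_measurable \<mu>" for n unfolding f_def by measurable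
  have step: "ennreal \<bar>ball_mean u (r (Suc n)) x - ball_mean u (r n) x\<bar>
      \<le> ennreal (osc_const * R * (2/3)^n) * S x" if "x \<in> \<Omega>" for x n
  proof -
    have "ennreal \<bar>ball_mean u (r (Suc n)) x - ball_mean u (r n) x\<bar> \<le> ennreal (osc_const * r (Suc n)) * f n x"
      unfolding f_def using ball_mean_diff[OF u g(1) that that, of "r (Suc n)"] r[of "Suc n"]
      by (simp add: r_def)
    also have "\<dots> \<le> ennreal (osc_const * R * (2/3)^n) * (ennreal (q n) * f n x)"
    proof -
      have "osc_const * r (Suc n) \<le> osc_const * R * (2/3)^n * q n"
        using osc_const_pos R_pos by (simp add: r_def q_def field_simps power_divide flip: power_mult_distrib)
      then have "ennreal (osc_const * r (Suc n)) \<le> ennreal (osc_const * R * (2/3)^n) * ennreal (q n)"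
        using osc_const_pos R_pos by (simp add: q_def ennreal_leI flip: ennreal_mult)
      then show ?thesis unfolding mult.assoc[symmetric] by (intro mult_right_mono) auto
    qed
    also have "\<dots> \<le> ennreal (osc_const * R * (2/3)^n) * S x"
      unfolding S_def using p_pos by (intro mult_left_mono Lp_majorant_ge) (auto simp: q_def)
    finally show ?thesis .
  qed
  have bound: "ennreal \<bar>ball_mean u (r n) x - mean u\<bar> \<le> ennreal (3 * osc_const * R) * S x" if x: "x \<in> \<Omega>" for x n
  proof (cases "S x = top")
    case True
    then show ?thesis using osc_const_pos R_pos by (simp add: ennreal_mult_top)
  next
    case False
    then obtain s where s: "S x = ennreal s" "0 \<le> s" by (cases "S x") auto
    have step': "\<bar>ball_mean u (r (Suc n)) x - ball_mean u (r n) x\<bar> \<le> osc_const * R * (2/3)^n * s" for n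
      using step[OF x, of n] osc_const_pos R_pos s by (simp add: ennreal_le_iff flip: ennreal_mult)
    \<comment> \<open>The coefficient is the n-th partial sum of the powers of 2/3; for
      \<open>n = 0\<close> the ball is the whole space and both means agree.\<close>
    have "\<bar>ball_mean u (r n) x - mean u\<bar> \<le> (3 - 3 * (2/3)^n) * (osc_const * R * s)"
    proof (induction n)
      case 0
      then show ?case using x by (simp add: r_def ball_mean_R)
    next
      case (Suc n)
      have "\<bar>ball_mean u (r (Suc n)) x - mean u\<bar> \<le> osc_const * R * (2/3)^n * s + (3 - 3 * (2/3)^n) * (osc_const * R * s)"
        using step'[of n] Suc by linarith
      also have "\<dots> = (3 - 3 * (2/3)^Suc n) * (osc_const * R * s)" by (simp add: algebra_simps)
      finally show ?case .
    qed
    also have "\<dots> \<le> 3 * (osc_const * R * s)"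
      using osc_const_pos R_pos s by (intro mult_right_mono) auto
    finally show ?thesis
      using osc_const_pos R_pos s by (simp add: ennreal_leI mult.assoc flip: ennreal_mult)
  qed
  have ae: "AE y in \<mu>. ennreal \<bar>u y - mean u\<bar> \<le> ennreal (3 * osc_const * R) * S y"
    using ball_mean_tendsto[OF u g] AE_space
  proof eventually_elim
    case (elim y)
    have "(\<lambda>n. ennreal \<bar>ball_mean u (r n) y - mean u\<bar>) \<longlonglongrightarrow> ennreal \<bar>u y - mean u\<bar>"
      using elim(1) unfolding r_def by (intro tendsto_ennrealI tendsto_rabs tendsto_diff tendsto_const)
    then show ?case
      by (rule LIMSEQ_le_const2) (use bound[OF elim(2)] in blast)
  qed
  have q34: "(3/4::real) powr p < 1"
  proof -
    have "(3/4::real) powr p < (3/4) powr 0" using p_pos by (intro powr_less_mono') auto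
    then show ?thesis by simp
  qed
  have int_f: "Lp_power (f n) \<le> ennreal D * Lp_power g" for n
  proof -
    have "Lp_power (f n) = (\<integral>\<^sup>+x. avg (2 * c * r (Suc n)) (\<lambda>y. epowr (g y) p) x \<partial>\<mu>)"
      using p_pos by (simp add: f_def epowr_epowr)
    also have "\<dots> \<le> ennreal D * Lp_power g"
      using c r[of "Suc n"] by (intro nn_integral_avg_le) auto
    finally show ?thesis .
  qed
  have "(\<integral>\<^sup>+y. epowr (ennreal \<bar>u y - mean u\<bar>) p \<partial>\<mu>) \<le> (\<integral>\<^sup>+y. epowr (ennreal (3 * osc_const * R) * S y) p \<partial>\<mu>)"
    using ae by (intro nn_integral_mono_AE) (auto elim!: eventually_mono intro!: epowr_mono p_ge_0)
  also have "\<dots> = ennreal ((3 * osc_const * R) powr p) * Lp_power S"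
    using osc_const_pos R_pos by (simp add: epowr_mult epowr_ennreal nn_integral_cmult S_def)
  also have "Lp_power S = (\<Sum>n. ennreal (q n powr p) * Lp_power (f n))"
    unfolding S_def by (intro nn_integral_Lp_majorant p_pos) auto
  also have "\<dots> \<le> (\<Sum>n. ennreal (q n powr p) * (ennreal D * Lp_power g))"
    by (intro suminf_le mult_left_mono int_f) auto
  also have "\<dots> = (\<Sum>n. ennreal (q n powr p)) * (ennreal D * Lp_power g)"
    by (rule ennreal_suminf_multc)
  also have "(\<Sum>n. ennreal (q n powr p)) = ennreal (1 / (1 - (3/4) powr p))"
  proof -
    have "q n powr p = ((3/4) powr p)^n" for n
      by (simp add: q_def powr_power powr_powr mult.commute flip: powr_realpow)
    then show ?thesis
      using q34 by (simp add: suminf_ennreal2 summable_geometric suminf_geometric)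
  qed
  also have "ennreal ((3 * osc_const * R) powr p) * (ennreal (1 / (1 - (3/4) powr p)) * (ennreal D * Lp_power g))
      = ennreal pp_const * Lp_power g"
  proof -
    have "ennreal pp_const = ennreal ((3 * osc_const * R) powr p) * (ennreal (1 / (1 - (3/4) powr p)) * ennreal D)"
      using q34 D unfolding pp_const_def by (simp flip: ennreal_mult)
    then show ?thesis by (simp only: mult.assoc)
  qed
  finally show ?thesis by (simp add: mult_left_mono)
qed

end

subsection \<open>Uniform convexity\<close>

text \<open>The mean value theorem on either half of the interval compares the derivative at two
  points, and the derivative is strictly increasing.\<close>

lemma powr_midpoint_strict:
  fixes s t p :: real
  assumes p: "1 < p" and st: "0 \<le> s" "s < t"
  shows "((s + t) / 2) powr p < (s powr p + t powr p) / 2"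
proof -
  define m where "m = (s + t) / 2"
  have m: "s < m" "m < t" "0 < m" "m - s = t - m" using st by (auto simp: m_def field_simps)
  have mv: "\<exists>z. a < z \<and> z < b \<and> b powr p - a powr p = (b - a) * (p * z powr (p - 1))"
    if "0 \<le> a" "a < b" for a b :: real
  proof -
    have "\<exists>l z. a < z \<and> z < b \<and> DERIV (\<lambda>x. x powr p) z :> l \<and> b powr p - a powr p = (b - a) * l"
    proof (rule MVT[OF that(2)])
      show "continuous_on {a..b} (\<lambda>x. x powr p)"
        using p that by (intro continuous_on_powr' continuous_intros) auto
      show "(\<lambda>x. x powr p) differentiable (at x)" if "a < x" "x < b" for x
        using that \<open>0 \<le> a\<close> has_real_derivative_powr[of x p]
        by (auto simp: real_differentiable_def)
    qed
    then obtain l z where z: "a < z" "z < b" "DERIV (\<lambda>x. x powr p) z :> l" "b powr p - a powr p = (b - a) * l"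
      by blast
    have "DERIV (\<lambda>x. x powr p) z :> p * z powr (p - 1)"
      using z that by (intro has_real_derivative_powr) auto
    with z(3) have "l = p * z powr (p - 1)" by (rule DERIV_unique)
    then show ?thesis using z by blast
  qed
  obtain y where y: "s < y" "y < m" "m powr p - s powr p = (m - s) * (p * y powr (p - 1))"
    using mv[of s m] st m by auto
  obtain z where z: "m < z" "z < t" "t powr p - m powr p = (t - m) * (p * z powr (p - 1))"
    using mv[of m t] m by auto
  have "y powr (p - 1) < z powr (p - 1)" using y z st p by (intro powr_less_mono2) auto
  then have "(m - s) * (p * y powr (p - 1)) < (m - s) * (p * z powr (p - 1))"
    using p m by (intro mult_strict_left_mono) auto
  then show ?thesis using y(3) z(3) m(4) by (simp add: m_def field_simps)
qed

lemma powr_midpoint: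
  fixes s t p :: real
  assumes "1 < p" "0 \<le> s" "0 \<le> t"
  shows "((s + t) / 2) powr p \<le> (s powr p + t powr p) / 2"
    and "((s + t) / 2) powr p = (s powr p + t powr p) / 2 \<Longrightarrow> s = t"
proof -
  consider "s = t" | "s < t" | "t < s" by linarith
  then have "((s + t) / 2) powr p \<le> (s powr p + t powr p) / 2 \<and>
      (((s + t) / 2) powr p = (s powr p + t powr p) / 2 \<longrightarrow> s = t)"
  proof cases
    case 2
    then show ?thesis using powr_midpoint_strict[OF assms(1,2) 2] by auto
  next
    case 3
    then show ?thesis using powr_midpoint_strict[OF assms(1,3) 3] by (auto simp: add.commute)
  qed auto
  then show "((s + t) / 2) powr p \<le> (s powr p + t powr p) / 2"
    and "((s + t) / 2) powr p = (s powr p + t powr p) / 2 \<Longrightarrow> s = t" by auto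
qed

text \<open>Here \<open>s\<close>, \<open>t\<close> and \<open>c\<close> stand for the lengths and the inner product of two vectors \<open>v\<close>, \<open>w\<close>, so
  that the two square roots are the lengths of \<open>v - w\<close> and \<open>v + w\<close>.  All terms are homogeneous,
  and on the compact set \<open>s\<^sup>2 + t\<^sup>2 = 1\<close> the convexity gap vanishes only where \<open>v = w\<close>.\<close>

lemma uniform_convexity_powr:
  fixes p e :: real
  assumes p: "1 < p" and e: "0 < e"
  obtains K where "0 \<le> K"
    "\<And>s t c. 0 \<le> s \<Longrightarrow> 0 \<le> t \<Longrightarrow> \<bar>c\<bar> \<le> s * t \<Longrightarrow>
      sqrt (s^2 + t^2 - 2 * c) powr p \<le> e * (s powr p + t powr p) +
        K * ((s powr p + t powr p) / 2 - (sqrt (s^2 + t^2 + 2 * c) / 2) powr p)"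
proof -
  \<comment> \<open>In these terms the claim is \<open>F \<le> K * G\<close>: \<open>F\<close> is
    what has to be bounded, \<open>G\<close> is the convexity gap at the midpoint.\<close>
  define F where "F s t c = sqrt (s^2 + t^2 - 2 * c) powr p - e * (s powr p + t powr p)" for s t c :: real
  define G where "G s t c = (s powr p + t powr p) / 2 - (sqrt (s^2 + t^2 + 2 * c) / 2) powr p" for s t c :: real
  have abs: "0 \<le> s^2 + t^2 - 2 * c" "0 \<le> s^2 + t^2 + 2 * c" "s^2 + t^2 + 2 * c \<le> (s + t)^2"
    if "\<bar>c\<bar> \<le> s * t" for s t c :: real
  proof -
    have "0 \<le> (s - t)^2" by simp
    then show "0 \<le> s^2 + t^2 - 2 * c" "0 \<le> s^2 + t^2 + 2 * c" "s^2 + t^2 + 2 * c \<le> (s + t)^2"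
      using that by (auto simp: power2_eq_square algebra_simps abs_le_iff)
  qed
  have sqrt_le: "sqrt (s^2 + t^2 + 2 * c) / 2 \<le> (s + t) / 2" if "0 \<le> s" "0 \<le> t" "\<bar>c\<bar> \<le> s * t" for s t c :: real
    using abs(3)[OF that(3)] that(1,2) by (simp add: real_le_lsqrt abs(2))
  have G_ge: "((s + t) / 2) powr p \<ge> (sqrt (s^2 + t^2 + 2 * c) / 2) powr p"
    if "0 \<le> s" "0 \<le> t" "\<bar>c\<bar> \<le> s * t" for s t c :: real
    using sqrt_le[OF that] abs(2)[OF that(3)] p by (intro powr_mono2) auto
  have G_nonneg: "0 \<le> G s t c" if "0 \<le> s" "0 \<le> t" "\<bar>c\<bar> \<le> s * t" for s t c
    using G_ge[OF that] powr_midpoint(1)[OF p that(1,2)] by (simp add: G_def)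
  have G_0: "s = t \<and> c = s^2" if "0 \<le> s" "0 \<le> t" "\<bar>c\<bar> \<le> s * t" "G s t c = 0" for s t c
  proof -
    have eq: "((s + t) / 2) powr p = (s powr p + t powr p) / 2"
      and eq2: "(sqrt (s^2 + t^2 + 2 * c) / 2) powr p = ((s + t) / 2) powr p"
      using G_ge[OF that(1-3)] powr_midpoint(1)[OF p that(1,2)] that(4) by (auto simp: G_def)
    have st: "s = t" using powr_midpoint(2)[OF p that(1,2) eq] .
    have "sqrt (s^2 + t^2 + 2 * c) / 2 = (s + t) / 2"
    proof (rule ccontr)
      assume "\<not> ?thesis"
      then have "sqrt (s^2 + t^2 + 2 * c) / 2 < (s + t) / 2" using sqrt_le[OF that(1-3)] by linarith
      then have "(sqrt (s^2 + t^2 + 2 * c) / 2) powr p < ((s + t) / 2) powr p"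
        using p abs(2)[OF that(3)] by (intro powr_less_mono2) auto
      then show False using eq2 by simp
    qed
    then have "s^2 + t^2 + 2 * c = (s + t)^2"
      using abs(2)[OF that(3)] by (metis divide_cancel_right real_sqrt_pow2 zero_neq_numeral)
    then show ?thesis using st by (simp add: power2_eq_square algebra_simps)
  qed
  define S0 where "S0 = {z::real \<times> real \<times> real. 0 \<le> fst z \<and> 0 \<le> fst (snd z) \<and>
      (fst z)^2 + (fst (snd z))^2 = 1 \<and> \<bar>snd (snd z)\<bar> \<le> fst z * fst (snd z)}"
  \<comment> \<open>Where \<open>F\<close> is negative any nonnegative \<open>K\<close> works. Where
    it is not, \<open>G\<close> cannot vanish on the sphere, because at a zero of \<open>G\<close>
    the two vectors agree and \<open>F\<close> equals \<open>- 2 * e * s powr p\<close>.\<close>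
  define S where "S = S0 \<inter> {z. 0 \<le> F (fst z) (fst (snd z)) (snd (snd z))}"
  have "closed S0"
    unfolding S0_def by (intro closed_Collect_conj closed_Collect_le closed_Collect_eq continuous_intros)
  have "S0 \<subseteq> {0..1} \<times> {0..1} \<times> {-1..1}"
  proof
    fix z assume z: "z \<in> S0"
    obtain s t c where [simp]: "z = (s, t, c)" by (cases z)
    have st: "0 \<le> s" "0 \<le> t" "s^2 + t^2 = 1" "\<bar>c\<bar> \<le> s * t" using z by (auto simp: S0_def)
    have "s^2 \<le> 1" "t^2 \<le> 1" using st(3) zero_le_power2[of s] zero_le_power2[of t] by linarith+
    then have "s \<le> 1" "t \<le> 1" using st by (auto simp: abs_square_le_1)
    moreover from this have "s * t \<le> 1" using st by (intro mult_le_one) auto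
    ultimately show "z \<in> {0..1} \<times> {0..1} \<times> {-1..1}" using st by auto
  qed
  then have "bounded S0"
    by (rule bounded_subset[rotated]) (intro bounded_Times bounded_closed_interval)
  have cont_powr: "continuous_on S0 (\<lambda>z. f z powr p)"
    if "continuous_on S0 f" "\<And>z. z \<in> S0 \<Longrightarrow> 0 \<le> f z" for f :: "real \<times> real \<times> real \<Rightarrow> real"
    using p that by (intro continuous_on_powr'[OF that(1) continuous_on_const]) auto
  have radicand: "0 \<le> (fst z)^2 + (fst (snd z))^2 + 2 * snd (snd z)"
    "2 * snd (snd z) \<le> (fst z)^2 + (fst (snd z))^2" if "z \<in> S0" for z
    using abs[of "snd (snd z)" "fst z" "fst (snd z)"] that by (simp_all add: S0_def)
  have contF: "continuous_on S0 (\<lambda>z. F (fst z) (fst (snd z)) (snd (snd z)))"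
    unfolding F_def
  proof (intro continuous_on_diff continuous_on_mult_left continuous_on_add cont_powr)
  qed (auto intro!: continuous_intros radicand, auto simp: S0_def)
  have contG: "continuous_on S0 (\<lambda>z. G (fst z) (fst (snd z)) (snd (snd z)))"
    unfolding G_def divide_inverse
  proof (intro continuous_on_diff continuous_on_mult_right continuous_on_add cont_powr)
  qed (auto intro!: continuous_intros radicand real_sqrt_ge_zero mult_nonneg_nonneg, (auto simp: S0_def)?)
  have "closed S"
    using continuous_closed_preimage[OF contF \<open>closed S0\<close>, of "{0..}"] by (simp add: S_def vimage_def)
  then have "compact S"
    using \<open>bounded S0\<close> by (auto simp: S_def compact_eq_bounded_closed intro: bounded_subset)
  have "S \<subseteq> S0" by (auto simp: S_def)
  have G_pos: "0 < G s t c" if "(s, t, c) \<in> S" for s t c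
  proof (rule ccontr)
    assume "\<not> 0 < G s t c"
    then have "G s t c = 0" using that G_nonneg[of s t c] by (simp add: S_def S0_def)
    then have eq: "s = t" "c = s^2" using that G_0[of s t c] by (auto simp: S_def S0_def)
    then have "0 < s" using that by (auto simp: S_def S0_def less_le)
    then have "F s t c < 0" using e eq by (simp add: F_def)
    then show False using that by (simp add: S_def)
  qed
  have "\<exists>K\<ge>0. \<forall>s t c. (s, t, c) \<in> S \<longrightarrow> F s t c \<le> K * G s t c"
  proof (cases "S = {}")
    case False
    let ?q = "\<lambda>z. F (fst z) (fst (snd z)) (snd (snd z)) / G (fst z) (fst (snd z)) (snd (snd z))"
    have "continuous_on S ?q"
      using G_pos \<open>S \<subseteq> S0\<close>
      by (intro continuous_on_divide continuous_on_subset[OF contF] continuous_on_subset[OF contG]) (auto, fastforce)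
    from continuous_attains_sup[OF \<open>compact S\<close> False this]
    obtain z0 where z0: "z0 \<in> S" "\<And>z. z \<in> S \<Longrightarrow> ?q z \<le> ?q z0" by blast
    have "0 \<le> ?q z0"
      using z0(1) G_pos[of "fst z0" "fst (snd z0)" "snd (snd z0)"] by (auto simp: S_def intro!: divide_nonneg_pos)
    moreover have "F s t c \<le> ?q z0 * G s t c" if "(s, t, c) \<in> S" for s t c
      using z0(2)[OF that] G_pos[OF that] by (simp add: divide_le_eq)
    ultimately show ?thesis by blast
  qed auto
  then obtain K where K: "0 \<le> K" "\<And>s t c. (s, t, c) \<in> S \<Longrightarrow> F s t c \<le> K * G s t c" by blast
  have normalized: "F s t c \<le> K * G s t c"
    if "0 \<le> s" "0 \<le> t" "\<bar>c\<bar> \<le> s * t" "s^2 + t^2 = 1" for s t c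
  proof (cases "0 \<le> F s t c")
    case True
    then show ?thesis using K(2)[of s t c] that by (simp add: S_def S0_def)
  next
    case False
    then show ?thesis using G_nonneg[OF that(1-3)] K(1) by (meson mult_nonneg_nonneg not_le order_trans less_imp_le)
  qed
  show ?thesis
  proof (rule that[OF K(1)])
    fix s t c :: real assume stc: "0 \<le> s" "0 \<le> t" "\<bar>c\<bar> \<le> s * t"
    have "F s t c \<le> K * G s t c"
    proof (cases "s = 0 \<and> t = 0")
      case True
      then show ?thesis using stc by (simp add: F_def G_def)
    next
      case False
      \<comment> \<open>\<open>F\<close> and \<open>G\<close> are homogeneous of degree
        \<open>p\<close> when \<open>c\<close> scales quadratically, so division by \<open>r\<close>
        leads to the compact set.\<close>
      define r where "r = sqrt (s^2 + t^2)"
      have r2: "0 < s^2 + t^2" using False by (simp add: sum_power2_gt_zero_iff)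
      then have r: "0 < r" "r^2 = s^2 + t^2" by (auto simp: r_def)
      have sq: "sqrt ((s/r)^2 + (t/r)^2 + a * (c / r^2)) = sqrt (s^2 + t^2 + a * c) / r" for a
      proof -
        have "(s/r)^2 + (t/r)^2 + a * (c / r^2) = (s^2 + t^2 + a * c) / r^2"
          by (simp add: power_divide add_divide_distrib)
        then show ?thesis using r(1) by (simp add: real_sqrt_divide)
      qed
      define q where "q = inverse (r powr p)"
      have scale: "(a / r) powr p = a powr p * q" if "0 \<le> a" for a
        using powr_divide[of a r p] that r(1) unfolding q_def by (metis divide_inverse less_imp_le)
      have "sqrt (s^2 + t^2 + 2 * c) / r / 2 = sqrt (s^2 + t^2 + 2 * c) / 2 / r" by simp
      then have scale2: "(sqrt (s^2 + t^2 + 2 * c) / r / 2) powr p = (sqrt (s^2 + t^2 + 2 * c) / 2) powr p * q"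
        using scale[of "sqrt (s^2 + t^2 + 2 * c) / 2"] abs(2)[OF stc(3)] by (simp add: mult.commute[of r])
      have FG: "F (s/r) (t/r) (c/r^2) = F s t c * q" "G (s/r) (t/r) (c/r^2) = G s t c * q"
      proof -
        have 1: "sqrt ((s/r)^2 + (t/r)^2 - 2 * (c / r^2)) = sqrt (s^2 + t^2 - 2 * c) / r"
          using sq[of "-2"] by simp
        have 2: "(sqrt (s^2 + t^2 - 2 * c) / r) powr p = sqrt (s^2 + t^2 - 2 * c) powr p * q"
          using abs(1)[OF stc(3)] by (intro scale) simp
        show "F (s/r) (t/r) (c/r^2) = F s t c * q"
          unfolding F_def 1 2 scale[OF stc(1)] scale[OF stc(2)] by (simp add: algebra_simps)
        show "G (s/r) (t/r) (c/r^2) = G s t c * q"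
          unfolding G_def sq scale2 scale[OF stc(1)] scale[OF stc(2)] by (simp add: field_simps)
      qed
      have q: "0 < q" using r by (simp add: q_def)
      have "F (s/r) (t/r) (c/r^2) \<le> K * G (s/r) (t/r) (c/r^2)"
      proof (rule normalized)
        show "\<bar>c/r^2\<bar> \<le> s/r * (t/r)" using stc r by (simp add: power2_eq_square divide_right_mono)
        have "(s/r)^2 + (t/r)^2 = (s^2 + t^2) / r^2" by (simp add: power_divide add_divide_distrib)
        then show "(s/r)^2 + (t/r)^2 = 1" using r False by simp
      qed (use stc r in auto)
      then have "F s t c * q \<le> (K * G s t c) * q" unfolding FG by (simp only: mult.assoc)
      then show ?thesis using q by (rule mult_right_le_imp_le)
    qed
    then show "sqrt (s^2 + t^2 - 2 * c) powr p \<le> e * (s powr p + t powr p) +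
        K * ((s powr p + t powr p) / 2 - (sqrt (s^2 + t^2 + 2 * c) / 2) powr p)"
      by (simp add: F_def G_def)
  qed
qed

text \<open>With \<open>(1 + d) powr p = 1 + e\<close>: if \<open>t\<close> is at most
  \<open>d * s\<close> the sum is absorbed in the first term; otherwise \<open>s\<close> is at most
  \<open>t / d\<close> and the sum is bounded by a multiple of \<open>t\<close>.\<close>

lemma powr_add_le_epsilon:
  fixes p e :: real
  assumes "0 < p" "0 < e"
  obtains K where "0 \<le> K" "\<And>s t. 0 \<le> s \<Longrightarrow> 0 \<le> t \<Longrightarrow> (s + t) powr p \<le> (1 + e) * s powr p + K * t powr p"
proof -
  define d where "d = (1 + e) powr (1 / p) - 1"
  have "1 powr (1 / p) < (1 + e) powr (1 / p)" using assms by (intro powr_less_mono2) auto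
  then have d: "0 < d" by (simp add: d_def)
  have d': "(1 + d) powr p = 1 + e" using assms by (simp add: d_def powr_powr)
  show ?thesis
  proof (rule that[of "(1 + 1 / d) powr p"])
    fix s t :: real assume st: "0 \<le> s" "0 \<le> t"
    show "(s + t) powr p \<le> (1 + e) * s powr p + (1 + 1 / d) powr p * t powr p"
    proof (cases "t \<le> d * s")
      case True
      then have "(s + t) powr p \<le> ((1 + d) * s) powr p" using st assms by (intro powr_mono2) (auto simp: algebra_simps)
      also have "\<dots> = (1 + e) * s powr p" using st d by (simp add: powr_mult d')
      finally show ?thesis using st by (simp add: add_increasing2)
    next
      case False
      then have "s \<le> t / d" using d by (simp add: field_simps)
      then have "(s + t) powr p \<le> ((1 + 1 / d) * t) powr p" using st assms by (intro powr_mono2) (auto simp: algebra_simps)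
      also have "\<dots> = (1 + 1 / d) powr p * t powr p" using st d by (simp add: powr_mult)
      finally show ?thesis using st assms by (simp add: add_increasing)
    qed
  qed simp
qed

section \<open>Inner products as forms, to be used at one point of the space at a time\<close>

locale inner_form =
  fixes h :: "'b::real_vector \<Rightarrow> 'b \<Rightarrow> real"
  assumes form: "inner_product_form h"
begin

definition len where "len v = sqrt (h v v)"

lemma h_linear: "h (a *\<^sub>R v + b *\<^sub>R w) z = a * h v z + b * h w z"
  "h z (a *\<^sub>R v + b *\<^sub>R w) = a * h z v + b * h z w"
proof -
  have "linear (h z)" "linear (\<lambda>v. h v z)" for z
    using form by (auto simp: inner_product_form_def bilinear_def)
  then show "h (a *\<^sub>R v + b *\<^sub>R w) z = a * h v z + b * h w z"
    "h z (a *\<^sub>R v + b *\<^sub>R w) = a * h z v + b * h z w"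
    using linear_add[of "\<lambda>v. h v z"] linear_scale[of "\<lambda>v. h v z"] linear_add[of "h z"] linear_scale[of "h z"]
    by simp_all
qed

lemma h_commute: "h v w = h w v"
  using form by (auto simp: inner_product_form_def)

lemma h_nonneg: "0 \<le> h v v"
proof (cases "v = 0")
  case True
  then show ?thesis using h_linear(1)[of 0 0 0 0 0] by simp
next
  case False
  then show ?thesis using form by (auto simp: inner_product_form_def less_imp_le)
qed

lemma len_nonneg: "0 \<le> len v" and len_squared: "(len v)^2 = h v v"
  using h_nonneg by (auto simp: len_def)

lemma len_eq_0_imp: "len v = 0 \<Longrightarrow> v = 0"
  using form by (force simp: inner_product_form_def len_def)

lemma h_lincomb:
  "h (a *\<^sub>R v + b *\<^sub>R w) (a *\<^sub>R v + b *\<^sub>R w) = a^2 * (len v)^2 + b^2 * (len w)^2 + 2 * a * b * h v w"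
  unfolding len_squared by (simp add: h_linear h_commute[of w v] power2_eq_square algebra_simps)

lemma Cauchy_Schwarz: "\<bar>h v w\<bar> \<le> len v * len w"
proof (cases "len w = 0")
  case True
  then have "w = 0" by (rule len_eq_0_imp)
  then show ?thesis using h_linear(2)[of v 0 0 0 0] by (simp add: len_nonneg)
next
  case False
  then have w: "0 < len w" using len_nonneg[of w] by simp
  \<comment> \<open>The vector is \<open>(len w)^2\<close> times the component of \<open>v\<close>
    orthogonal to \<open>w\<close>.\<close>
  have "0 \<le> h ((len w)^2 *\<^sub>R v + (- h v w) *\<^sub>R w) ((len w)^2 *\<^sub>R v + (- h v w) *\<^sub>R w)"
    by (rule h_nonneg)
  also have "\<dots> = (len w)^2 * ((len v)^2 * (len w)^2 - (h v w)^2)"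
    unfolding h_lincomb by (simp add: power2_eq_square algebra_simps)
  finally have "(h v w)^2 \<le> (len v * len w)^2"
    using w by (simp add: zero_le_mult_iff power_mult_distrib)
  then show ?thesis
    using len_nonneg by (metis abs_le_square_iff abs_of_nonneg mult_nonneg_nonneg)
qed

lemma len_lincomb: "len (a *\<^sub>R v + b *\<^sub>R w) = sqrt (a^2 * (len v)^2 + b^2 * (len w)^2 + 2 * a * b * h v w)"
  unfolding len_def[of "a *\<^sub>R v + b *\<^sub>R w"] h_lincomb ..

lemma len_triangle: "len (1 *\<^sub>R v + 1 *\<^sub>R w) \<le> len v + len w"
  unfolding len_lincomb using Cauchy_Schwarz[of v w] len_nonneg
  by (intro real_le_lsqrt) (auto simp: power2_eq_square algebra_simps abs_le_iff)

lemma len_scale: "len (a *\<^sub>R v) = \<bar>a\<bar> * len v"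
  using len_lincomb[of a v 0 0] len_nonneg[of v] by (simp add: real_sqrt_mult)

end

subsection \<open>Newtonian functions and the Cheeger energy\<close>

context poincare_space
begin

section \<open>Newtonian functions: integrability, linear combinations, Poincare inequality\<close>

lemma N1pD:
  assumes "u \<in> N1p \<mu> p"
  shows "u \<in> borel_measurable \<mu>" "(\<integral>\<^sup>+x. epowr (ennreal \<bar>u x\<bar>) p \<partial>\<mu>) < top"
    and "\<exists>g. weak_upper_gradient \<mu> p u g \<and> Lp_norm \<mu> p g < top"
  using assms by (auto simp: N1p_def Lp_norm_less_top_iff)

lemma N1p_integrable:
  assumes "u \<in> N1p \<mu> p"
  shows "integrable \<mu> u"
proof (rule integrableI_bounded)
  note [measurable] = N1pD(1)[OF assms]
  show "u \<in> borel_measurable \<mu>" by measurable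
  have "(\<integral>\<^sup>+x. ennreal (norm (u x)) \<partial>\<mu>) \<le> (\<integral>\<^sup>+x. 1 + epowr (ennreal \<bar>u x\<bar>) p \<partial>\<mu>)"
  proof (intro nn_integral_mono)
    fix x
    show "ennreal (norm (u x)) \<le> 1 + epowr (ennreal \<bar>u x\<bar>) p"
      using epowr_le_one_plus[of "1/p" "epowr (ennreal \<bar>u x\<bar>) p"] p_gt_1 by (simp add: epowr_epowr)
  qed
  also have "\<dots> = emeasure \<mu> \<Omega> + (\<integral>\<^sup>+x. epowr (ennreal \<bar>u x\<bar>) p \<partial>\<mu>)"
    by (simp add: nn_integral_add)
  also have "\<dots> < \<infinity>" using N1pD(2)[OF assms] fin by simp
  finally show "(\<integral>\<^sup>+x. ennreal (norm (u x)) \<partial>\<mu>) < \<infinity>" .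
qed

lemma Lp_add_finite:
  assumes [measurable]: "f \<in> borel_measurable \<mu>" "g \<in> borel_measurable \<mu>"
    and "Lp_power f < top" "Lp_power g < top"
  shows "(\<integral>\<^sup>+x. epowr (f x + g x) p \<partial>\<mu>) < top"
proof -
  have "(\<integral>\<^sup>+x. epowr (f x + g x) p \<partial>\<mu>) \<le> (\<integral>\<^sup>+x. ennreal (2 powr p) * (epowr (f x) p + epowr (g x) p) \<partial>\<mu>)"
    by (intro nn_integral_mono epowr_add_le p_ge_0)
  also have "\<dots> = ennreal (2 powr p) * (Lp_power f + Lp_power g)"
    by (simp add: nn_integral_cmult nn_integral_add)
  also have "\<dots> < top" using assms by (simp add: ennreal_mult_less_top)
  finally show ?thesis .
qed

lemma Lp_cmult:
  assumes [measurable]: "f \<in> borel_measurable \<mu>" and "0 \<le> a"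
  shows "(\<integral>\<^sup>+x. epowr (ennreal a * f x) p \<partial>\<mu>) = ennreal (a powr p) * Lp_power f"
  using assms(2) by (simp add: epowr_mult epowr_ennreal nn_integral_cmult)

lemma Lp_const_finite: "t < top \<Longrightarrow> (\<integral>\<^sup>+x. epowr t p \<partial>\<mu>) < top"
  using fin by (simp add: ennreal_mult_less_top)

lemma N1p_lincomb:
  assumes u: "u \<in> N1p \<mu> p" and v: "v \<in> N1p \<mu> p"
  shows "(\<lambda>x. a * u x + b * v x + t) \<in> N1p \<mu> p"
proof -
  note [measurable] = N1pD(1)[OF u] N1pD(1)[OF v]
  obtain g h where g: "weak_upper_gradient \<mu> p u g" "Lp_norm \<mu> p g < top"
    and h: "weak_upper_gradient \<mu> p v h" "Lp_norm \<mu> p h < top"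
    using N1pD(3)[OF u] N1pD(3)[OF v] by blast
  have [measurable]: "g \<in> borel_measurable \<mu>" "h \<in> borel_measurable \<mu>"
    using g h by (auto intro!: borelm_imp_measurable weak_upper_gradient_measurable)
  have fin_scaled: "(\<integral>\<^sup>+x. epowr (ennreal \<bar>a\<bar> * f x) p \<partial>\<mu>) < top"
    if "f \<in> borel_measurable \<mu>" "Lp_power f < top" for f and a :: real
    using that by (simp add: Lp_cmult ennreal_mult_less_top)
  have "(\<integral>\<^sup>+x. epowr (ennreal \<bar>a * u x + b * v x + t\<bar>) p \<partial>\<mu>)
      \<le> (\<integral>\<^sup>+x. epowr ((ennreal \<bar>a\<bar> * ennreal \<bar>u x\<bar> + ennreal \<bar>b\<bar> * ennreal \<bar>v x\<bar>) + ennreal \<bar>t\<bar>) p \<partial>\<mu>)"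
  proof (intro nn_integral_mono epowr_mono p_ge_0)
    fix x
    have "\<bar>a * u x + b * v x + t\<bar> \<le> (\<bar>a\<bar> * \<bar>u x\<bar> + \<bar>b\<bar> * \<bar>v x\<bar>) + \<bar>t\<bar>"
      by (simp flip: abs_mult)
    from ennreal_leI[OF this]
    show "ennreal \<bar>a * u x + b * v x + t\<bar> \<le> (ennreal \<bar>a\<bar> * ennreal \<bar>u x\<bar> + ennreal \<bar>b\<bar> * ennreal \<bar>v x\<bar>) + ennreal \<bar>t\<bar>"
      by (simp add: ennreal_mult)
  qed
  also have "\<dots> < top"
    using N1pD(2)[OF u] N1pD(2)[OF v]
    by (intro Lp_add_finite fin_scaled Lp_const_finite) (auto simp del: ennreal_plus)
  finally have "(\<integral>\<^sup>+x. epowr (ennreal \<bar>a * u x + b * v x + t\<bar>) p \<partial>\<mu>) < top" .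
  moreover have "(\<integral>\<^sup>+x. epowr (ennreal \<bar>a\<bar> * g x + ennreal \<bar>b\<bar> * h x) p \<partial>\<mu>) < top"
    using g h by (intro Lp_add_finite fin_scaled) (auto simp: Lp_norm_less_top_iff)
  ultimately show ?thesis
    using weak_upper_gradient_lincomb[OF g(1) h(1), of a b t]
    by (auto simp: N1p_def Lp_norm_less_top_iff)
qed

lemma N1p_const: "(\<lambda>x. t) \<in> N1p \<mu> p"
  using Lp_const_finite[of "ennreal \<bar>t\<bar>"] weak_upper_gradient_const p_pos
  by (auto simp: N1p_def Lp_norm_less_top_iff intro!: exI[of _ "\<lambda>x. 0"])

lemma N1p_diff: "u \<in> N1p \<mu> p \<Longrightarrow> v \<in> N1p \<mu> p \<Longrightarrow> (\<lambda>x. u x - v x) \<in> N1p \<mu> p"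
  using N1p_lincomb[of u v 1 "-1" 0] by simp

lemma N1p_minus_const: "u \<in> N1p \<mu> p \<Longrightarrow> (\<lambda>x. u x - t) \<in> N1p \<mu> p"
  using N1p_lincomb[of u u 1 0 "-t"] by simp

lemma N1p_cmult: "u \<in> N1p \<mu> p \<Longrightarrow> (\<lambda>x. a * u x) \<in> N1p \<mu> p"
  using N1p_lincomb[of u u a 0 0] by simp

text \<open>A true upper gradient close to \<open>g\<close> is substituted, with the error
  \<open>e / A\<close> scaled so that \<open>e\<close> remains; \<open>2 powr p\<close> is the price
  of the approximation.\<close>

lemma poincare_weak:
  assumes u: "u \<in> N1p \<mu> p" and g: "weak_upper_gradient \<mu> p u g" "Lp_norm \<mu> p g < top"
  shows "(\<integral>\<^sup>+y. epowr (ennreal \<bar>u y - mean u\<bar>) p \<partial>\<mu>)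
    \<le> ennreal (pp_const * 2 powr p) * Lp_power g"
proof (rule ennreal_le_epsilon)
  fix e :: real assume e: "0 < e"
  define A where "A = pp_const * 2 powr p"
  have A: "0 < A" using pp_const_pos by (simp add: A_def)
  obtain h where h: "upper_gradient \<Omega> u h"
    "Lp_power h \<le> ennreal (2 powr p) * (Lp_power g + ennreal (e / A))"
    using upper_gradient_approx[OF g(1), of "e / A"] e A by auto
  have "ennreal (2 powr p) * (Lp_power g + ennreal (e / A)) < top"
    using g(2) by (simp add: ennreal_mult_less_top Lp_norm_less_top_iff)
  then have "Lp_power h < top" using h(2) by order
  then have "(\<integral>\<^sup>+y. epowr (ennreal \<bar>u y - mean u\<bar>) p \<partial>\<mu>) \<le> ennreal pp_const * Lp_power h"
    by (intro poincare_pp N1p_integrable[OF u] h)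
  also have "\<dots> \<le> ennreal pp_const * (ennreal (2 powr p) * (Lp_power g + ennreal (e / A)))"
    by (intro mult_left_mono h) auto
  also have "\<dots> = ennreal A * Lp_power g + ennreal A * ennreal (e / A)"
    using pp_const_pos by (simp add: A_def ennreal_mult distrib_left mult.assoc)
  also have "ennreal A * ennreal (e / A) = ennreal e"
    using A e by (simp flip: ennreal_mult)
  finally show "(\<integral>\<^sup>+y. epowr (ennreal \<bar>u y - mean u\<bar>) p \<partial>\<mu>)
      \<le> ennreal (pp_const * 2 powr p) * Lp_power g + ennreal e"
    by (simp add: A_def)
qed

end

section \<open>The Cheeger energy against weak upper gradients\<close>

locale cheeger_space = poincare_space +
  fixes ip :: "'a \<Rightarrow> real ^ 'n \<Rightarrow> real ^ 'n \<Rightarrow> real" and grad :: "('a \<Rightarrow> real) \<Rightarrow> 'a \<Rightarrow> real ^ 'n"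
    and C :: real
  assumes hull: "\<And>A. A \<in> sets \<mu> \<Longrightarrow>
      \<exists>B\<in>sets (restrict_space borel (space \<mu>)). A \<subseteq> B \<and> emeasure \<mu> B = emeasure \<mu> A"
    and ip_form: "\<And>x. x \<in> space \<mu> \<Longrightarrow> inner_product_form (ip x)"
    and ip_measurable: "\<And>v w. (\<lambda>x. ip x v w) \<in> borel_measurable \<mu>"
    and grad_measurable: "\<And>u. u \<in> N1p \<mu> p \<Longrightarrow> grad u \<in> borel_measurable \<mu>"
    and grad_lincomb: "\<And>u v a b. u \<in> N1p \<mu> p \<Longrightarrow> v \<in> N1p \<mu> p \<Longrightarrow>
      AE x in \<mu>. grad (\<lambda>z. a * u z + b * v z) x = a *\<^sub>R grad u x + b *\<^sub>R grad v x"
    and C: "1 \<le> C"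
    and minimal: "\<And>u. u \<in> N1p \<mu> p \<Longrightarrow> \<exists>g. minimal_weak_upper_gradient \<mu> p u g \<and>
        (AE x in \<mu>. ennreal (grad_length ip grad u x) \<le> ennreal C * g x \<and>
                    g x \<le> ennreal (C * grad_length ip grad u x))"
begin

abbreviation gl :: "('a \<Rightarrow> real) \<Rightarrow> 'a \<Rightarrow> real" where "gl \<equiv> grad_length ip grad"

definition E :: "('a \<Rightarrow> real) \<Rightarrow> real" where "E u = (LINT x|\<mu>. gl u x powr p)"

lemma inner_form: "x \<in> \<Omega> \<Longrightarrow> inner_form (ip x)"
  by (simp add: inner_form_def ip_form)

lemma gl_eq_len: "x \<in> \<Omega> \<Longrightarrow> gl u x = inner_form.len (ip x) (grad u x)"
  by (simp add: grad_length_def inner_form.len_def[OF inner_form])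

lemma gl_nonneg: "x \<in> \<Omega> \<Longrightarrow> 0 \<le> gl u x"
  by (simp add: gl_eq_len inner_form.len_nonneg[OF inner_form])

text \<open>The inner products are given as measurable for fixed arguments, so the form is expanded
  in the standard basis.\<close>

lemma gl_measurable:
  assumes u: "u \<in> N1p \<mu> p"
  shows "gl u \<in> borel_measurable \<mu>"
proof -
  note [measurable] = grad_measurable[OF u] ip_measurable
  have expand: "ip x v v = (\<Sum>i\<in>Basis. \<Sum>j\<in>Basis. (v \<bullet> i) * (v \<bullet> j) * ip x i j)" if x: "x \<in> \<Omega>" for x v
  proof -
    have bil: "bilinear (ip x)" using ip_form[OF x] by (simp add: inner_product_form_def)
    have "ip x v v = ip x (\<Sum>i\<in>Basis. (v \<bullet> i) *\<^sub>R i) (\<Sum>j\<in>Basis. (v \<bullet> j) *\<^sub>R j)"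
      by (simp add: euclidean_representation)
    also have "\<dots> = (\<Sum>(i,j)\<in>Basis \<times> Basis. ip x ((v \<bullet> i) *\<^sub>R i) ((v \<bullet> j) *\<^sub>R j))"
      by (rule bilinear_sum[OF bil])
    also have "\<dots> = (\<Sum>i\<in>Basis. \<Sum>j\<in>Basis. (v \<bullet> i) * (v \<bullet> j) * ip x i j)"
      by (simp add: sum.cartesian_product bilinear_lmul[OF bil] bilinear_rmul[OF bil] mult_ac)
    finally show ?thesis .
  qed
  have "(\<lambda>x. sqrt (\<Sum>i\<in>Basis. \<Sum>j\<in>Basis. (grad u x \<bullet> i) * (grad u x \<bullet> j) * ip x i j)) \<in> borel_measurable \<mu>"
    by measurable
  also have "?this \<longleftrightarrow> ?thesis"
    by (intro measurable_cong) (simp add: grad_length_def expand)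
  finally show ?thesis .
qed

lemma minimal_gradient:
  assumes u: "u \<in> N1p \<mu> p"
  shows "\<exists>g. weak_upper_gradient \<mu> p u g \<and> Lp_norm \<mu> p g < top \<and>
    (\<forall>h. weak_upper_gradient \<mu> p u h \<longrightarrow> Lp_norm \<mu> p h < top \<longrightarrow> (AE x in \<mu>. g x \<le> h x)) \<and>
    Lp_power g \<le> ennreal (C powr p) * (\<integral>\<^sup>+x. epowr (ennreal (gl u x)) p \<partial>\<mu>) \<and>
    (\<integral>\<^sup>+x. epowr (ennreal (gl u x)) p \<partial>\<mu>) \<le> ennreal (C powr p) * Lp_power g"
proof -
  obtain g where g: "minimal_weak_upper_gradient \<mu> p u g"
    and ae: "AE x in \<mu>. ennreal (gl u x) \<le> ennreal C * g x \<and> g x \<le> ennreal (C * gl u x)"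
    using minimal[OF u] by blast
  have g': "weak_upper_gradient \<mu> p u g" "Lp_norm \<mu> p g < top"
    "\<And>h. weak_upper_gradient \<mu> p u h \<Longrightarrow> Lp_norm \<mu> p h < top \<Longrightarrow> AE x in \<mu>. g x \<le> h x"
    using g by (auto simp: minimal_weak_upper_gradient_def)
  have [measurable]: "g \<in> borel_measurable \<mu>"
    using g'(1) by (intro borelm_imp_measurable weak_upper_gradient_measurable)
  note [measurable] = gl_measurable[OF u]
  have "Lp_power g \<le> (\<integral>\<^sup>+x. epowr (ennreal C * ennreal (gl u x)) p \<partial>\<mu>)"
  proof (intro nn_integral_mono_AE, use ae in eventually_elim)
    case (elim x)
    then show ?case using C by (intro epowr_mono p_ge_0) (simp add: ennreal_mult')
  qed
  then have 1: "Lp_power g \<le> ennreal (C powr p) * (\<integral>\<^sup>+x. epowr (ennreal (gl u x)) p \<partial>\<mu>)"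
    using C by (simp add: Lp_cmult)
  have "(\<integral>\<^sup>+x. epowr (ennreal (gl u x)) p \<partial>\<mu>) \<le> (\<integral>\<^sup>+x. epowr (ennreal C * g x) p \<partial>\<mu>)"
    by (intro nn_integral_mono_AE, use ae in eventually_elim) (intro epowr_mono p_ge_0, simp)
  then have 2: "(\<integral>\<^sup>+x. epowr (ennreal (gl u x)) p \<partial>\<mu>) \<le> ennreal (C powr p) * Lp_power g"
    using C by (simp add: Lp_cmult)
  show ?thesis
    by (intro exI[of _ g] conjI allI impI g' 1 2)
qed

lemma nn_integral_gl: "(\<integral>\<^sup>+x. epowr (ennreal (gl u x)) p \<partial>\<mu>) = (\<integral>\<^sup>+x. ennreal (gl u x powr p) \<partial>\<mu>)"
  by (intro nn_integral_cong) (simp add: epowr_ennreal gl_nonneg)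

lemma integrable_gl:
  assumes u: "u \<in> N1p \<mu> p"
  shows "integrable \<mu> (\<lambda>x. gl u x powr p)"
proof (rule integrableI_nonneg)
  note [measurable] = gl_measurable[OF u]
  show "(\<lambda>x. gl u x powr p) \<in> borel_measurable \<mu>" by measurable
  obtain g where g: "Lp_norm \<mu> p g < top"
    "(\<integral>\<^sup>+x. epowr (ennreal (gl u x)) p \<partial>\<mu>) \<le> ennreal (C powr p) * Lp_power g"
    using minimal_gradient[OF u] by blast
  have "ennreal (C powr p) * Lp_power g < top"
    using g(1) by (simp add: ennreal_mult_less_top Lp_norm_less_top_iff)
  then show "(\<integral>\<^sup>+x. ennreal (gl u x powr p) \<partial>\<mu>) < \<infinity>" using g(2) nn_integral_gl[of u] by simp
qed simp

lemma E_nonneg: "0 \<le> E u"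
  by (simp add: E_def)

lemma ennreal_E: "u \<in> N1p \<mu> p \<Longrightarrow> ennreal (E u) = (\<integral>\<^sup>+x. epowr (ennreal (gl u x)) p \<partial>\<mu>)"
  unfolding E_def nn_integral_gl by (intro nn_integral_eq_integral[symmetric] integrable_gl) auto

text \<open>The minimal weak upper gradient lies below \<open>h\<close> almost everywhere. Any
  explicit weak upper gradient thus bounds the energy from above, which is how the distance to a
  limit is estimated.\<close>

lemma E_le_weak_upper_gradient:
  assumes u: "u \<in> N1p \<mu> p" and h: "weak_upper_gradient \<mu> p u h" "Lp_norm \<mu> p h < top"
  shows "ennreal (E u) \<le> ennreal (C powr p) * Lp_power h"
proof -
  obtain g where g: "\<And>h. weak_upper_gradient \<mu> p u h \<Longrightarrow> Lp_norm \<mu> p h < top \<Longrightarrow> AE x in \<mu>. g x \<le> h x"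
    "(\<integral>\<^sup>+x. epowr (ennreal (gl u x)) p \<partial>\<mu>) \<le> ennreal (C powr p) * Lp_power g"
    using minimal_gradient[OF u] by blast
  have "Lp_power g \<le> Lp_power h"
    using g(1)[OF h] by (intro nn_integral_mono_AE) (auto elim!: eventually_mono intro!: epowr_mono p_ge_0)
  then show ?thesis
    unfolding ennreal_E[OF u] using g(2) by (meson mult_left_mono order_trans zero_le)
qed

definition "energy_const = pp_const * 2 powr p * C powr p"

lemma energy_const_pos: "0 < energy_const"
  using pp_const_pos C by (simp add: energy_const_def)

lemma poincare_energy:
  assumes u: "u \<in> N1p \<mu> p"
  shows "(\<integral>\<^sup>+y. epowr (ennreal \<bar>u y - mean u\<bar>) p \<partial>\<mu>) \<le> ennreal (energy_const * E u)"
proof -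
  obtain g where g: "weak_upper_gradient \<mu> p u g" "Lp_norm \<mu> p g < top"
    "Lp_power g \<le> ennreal (C powr p) * (\<integral>\<^sup>+x. epowr (ennreal (gl u x)) p \<partial>\<mu>)"
    using minimal_gradient[OF u] by blast
  have "(\<integral>\<^sup>+y. epowr (ennreal \<bar>u y - mean u\<bar>) p \<partial>\<mu>) \<le> ennreal (pp_const * 2 powr p) * Lp_power g"
    by (rule poincare_weak[OF u g(1,2)])
  also have "\<dots> \<le> ennreal (pp_const * 2 powr p) * (ennreal (C powr p) * ennreal (E u))"
    unfolding ennreal_E[OF u] by (intro mult_left_mono g) auto
  also have "\<dots> = ennreal (energy_const * E u)"
    using pp_const_pos C E_nonneg by (simp add: energy_const_def mult.assoc flip: ennreal_mult)
  finally show ?thesis .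
qed

text \<open>Subtracting the mean leaves weak upper gradients unchanged, and the Poincare inequality
  bounds the rest. This turns bounds by the Newtonian norm into bounds by the energy.\<close>

lemma N1p_norm_centered_le:
  assumes u: "u \<in> N1p \<mu> p"
  shows "N1p_norm \<mu> p (\<lambda>x. u x - mean u)
    \<le> ennreal ((energy_const powr (1 / p) + C) * E u powr (1 / p))"
proof -
  obtain g where g: "weak_upper_gradient \<mu> p u g"
    "Lp_power g \<le> ennreal (C powr p) * (\<integral>\<^sup>+x. epowr (ennreal (gl u x)) p \<partial>\<mu>)"
    using minimal_gradient[OF u] by blast
  have "weak_upper_gradient \<mu> p (\<lambda>x. u x - mean u) g"
    using weak_upper_gradient_lincomb[OF g(1) weak_upper_gradient_const[of 0], of 1 0 "- mean u"] by simp
  then have "(INF g\<in>{g. weak_upper_gradient \<mu> p (\<lambda>x. u x - mean u) g}. Lp_norm \<mu> p g) \<le> Lp_norm \<mu> p g"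
    by (intro INF_lower) auto
  also have "\<dots> \<le> epowr (ennreal (C powr p) * ennreal (E u)) (1 / p)"
    unfolding Lp_norm_def ennreal_E[OF u] using p_pos by (intro epowr_mono g) auto
  also have "\<dots> = ennreal (C * E u powr (1 / p))"
    using C E_nonneg p_pos by (simp add: epowr_ennreal powr_mult powr_powr flip: ennreal_mult)
  finally have 1: "(INF g\<in>{g. weak_upper_gradient \<mu> p (\<lambda>x. u x - mean u) g}. Lp_norm \<mu> p g)
      \<le> ennreal (C * E u powr (1 / p))" .
  have "Lp_norm \<mu> p (\<lambda>x. ennreal \<bar>u x - mean u\<bar>) \<le> epowr (ennreal (energy_const * E u)) (1 / p)"
    unfolding Lp_norm_def using p_pos by (intro epowr_mono poincare_energy u) auto
  also have "\<dots> = ennreal (energy_const powr (1 / p) * E u powr (1 / p))"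
    using energy_const_pos E_nonneg by (simp add: epowr_ennreal powr_mult)
  finally have "N1p_norm \<mu> p (\<lambda>x. u x - mean u)
      \<le> ennreal (energy_const powr (1 / p) * E u powr (1 / p)) + ennreal (C * E u powr (1 / p))"
    unfolding N1p_norm_def by (intro add_mono 1)
  also have "\<dots> = ennreal ((energy_const powr (1 / p) + C) * E u powr (1 / p))"
    using C by (simp add: distrib_right flip: ennreal_plus)
  finally show ?thesis .
qed

section \<open>Algebra and convexity of the energy\<close>

lemma E_cong_AE:
  assumes "u \<in> N1p \<mu> p" "v \<in> N1p \<mu> p" "AE x in \<mu>. grad u x = grad v x"
  shows "E u = E v"
proof -
  note [measurable] = gl_measurable[OF assms(1)] gl_measurable[OF assms(2)]
  show ?thesis
    unfolding E_def
  proof (rule integral_cong_AE)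
    show "AE x in \<mu>. gl u x powr p = gl v x powr p"
      using assms(3) by eventually_elim (simp add: grad_length_def)
  qed measurable
qed

lemma grad_eq_0:
  assumes u: "u \<in> N1p \<mu> p" and "E u = 0"
  shows "AE x in \<mu>. grad u x = 0"
proof -
  have "AE x in \<mu>. gl u x powr p = 0"
    using assms integral_nonneg_eq_0_iff_AE[OF integrable_gl[OF u]] by (simp add: E_def)
  then show ?thesis using AE_space
  proof eventually_elim
    case (elim x)
    then have "inner_form.len (ip x) (grad u x) = 0" by (simp add: gl_eq_len)
    then show ?case by (rule inner_form.len_eq_0_imp[OF inner_form[OF elim(2)]])
  qed
qed

lemma E_const: "E (\<lambda>x. t) = 0"
  using E_le_weak_upper_gradient[OF N1p_const weak_upper_gradient_const, of t] E_nonneg[of "\<lambda>x. t"] p_pos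
  by (simp add: Lp_norm_less_top_iff)

text \<open>\<open>grad_lincomb\<close> speaks of two functions; the constant is added as a further
  member of \<open>N1p\<close>, whose gradient vanishes because its energy does.\<close>

lemma grad_lincomb_const:
  assumes "u \<in> N1p \<mu> p" "v \<in> N1p \<mu> p"
  shows "AE x in \<mu>. grad (\<lambda>z. a * u z + b * v z + t) x = a *\<^sub>R grad u x + b *\<^sub>R grad v x"
proof -
  have "AE x in \<mu>. grad (\<lambda>z. 1 * (a * u z + b * v z) + 1 * t) x =
      1 *\<^sub>R grad (\<lambda>z. a * u z + b * v z) x + 1 *\<^sub>R grad (\<lambda>z. t) x"
    using N1p_lincomb[OF assms, of a b 0] by (intro grad_lincomb N1p_const) simp
  with grad_lincomb[OF assms, of a b] grad_eq_0[OF N1p_const E_const, of t]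
  show ?thesis by eventually_elim simp
qed

lemma E_affine:
  assumes u: "u \<in> N1p \<mu> p"
  shows "E (\<lambda>x. a * u x + t) = \<bar>a\<bar> powr p * E u"
proof -
  have ae: "AE x in \<mu>. grad (\<lambda>z. a * u z + t) x = a *\<^sub>R grad u x"
    using grad_lincomb_const[OF u u, of a 0 t] by simp
  have N: "(\<lambda>z. a * u z + t) \<in> N1p \<mu> p" using N1p_lincomb[OF u u, of a 0 t] by simp
  note [measurable] = gl_measurable[OF u] gl_measurable[OF N]
  have "E (\<lambda>x. a * u x + t) = (LINT x|\<mu>. \<bar>a\<bar> powr p * gl u x powr p)"
    unfolding E_def
  proof (rule integral_cong_AE)
    show "AE x in \<mu>. gl (\<lambda>x. a * u x + t) x powr p = \<bar>a\<bar> powr p * gl u x powr p"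
      using ae AE_space
    proof eventually_elim
      case (elim x)
      then have "gl (\<lambda>x. a * u x + t) x = \<bar>a\<bar> * gl u x"
        by (simp add: gl_eq_len inner_form.len_scale[OF inner_form])
      then show ?case using gl_nonneg[OF elim(2), of u] by (simp add: powr_mult)
    qed
  qed measurable
  then show ?thesis by (simp add: E_def)
qed

lemma E_add_const: "u \<in> N1p \<mu> p \<Longrightarrow> E (\<lambda>x. u x + t) = E u"
  using E_affine[of u 1 t] by simp

lemma E_minus_const: "u \<in> N1p \<mu> p \<Longrightarrow> E (\<lambda>x. u x - t) = E u"
  using E_affine[of u 1 "-t"] by simp

lemma E_diff_commute: "u \<in> N1p \<mu> p \<Longrightarrow> v \<in> N1p \<mu> p \<Longrightarrow> E (\<lambda>x. u x - v x) = E (\<lambda>x. v x - u x)"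
  using E_affine[of "\<lambda>x. v x - u x" "-1" 0] N1p_diff[of v u] by simp

text \<open>The pointwise inequality for \<open>ip x\<close>, integrated. It plays the role of
  Clarkson's inequalities for all \<open>p > 1\<close> at once: a small gap makes the energy of the
  difference small, up to an arbitrary share \<open>e\<close> of the total energy.\<close>

lemma E_uniformly_convex:
  assumes "0 < e"
  obtains A where "0 \<le> A" "\<And>u v. u \<in> N1p \<mu> p \<Longrightarrow> v \<in> N1p \<mu> p \<Longrightarrow>
    E (\<lambda>x. u x - v x) \<le> e * (E u + E v) + A * ((E u + E v) / 2 - E (\<lambda>x. (u x + v x) / 2))"
proof -
  obtain A where A: "0 \<le> A" "\<And>s t c. 0 \<le> s \<Longrightarrow> 0 \<le> t \<Longrightarrow> \<bar>c\<bar> \<le> s * t \<Longrightarrow>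
      sqrt (s^2 + t^2 - 2 * c) powr p \<le> e * (s powr p + t powr p) +
        A * ((s powr p + t powr p) / 2 - (sqrt (s^2 + t^2 + 2 * c) / 2) powr p)"
    using uniform_convexity_powr[OF p_gt_1 assms] by blast
  show ?thesis
  proof (rule that[OF A(1)])
    fix u v assume uv: "u \<in> N1p \<mu> p" "v \<in> N1p \<mu> p"
    have half: "(\<lambda>x. (u x + v x) / 2) = (\<lambda>x. 1/2 * u x + 1/2 * v x)" by (auto simp: field_simps)
    have N: "(\<lambda>x. u x - v x) \<in> N1p \<mu> p" "(\<lambda>x. (u x + v x) / 2) \<in> N1p \<mu> p"
      using N1p_diff[OF uv] N1p_lincomb[OF uv, of "1/2" "1/2" 0] by (simp_all add: half)
    note int = integrable_gl[OF uv(1)] integrable_gl[OF uv(2)] integrable_gl[OF N(1)] integrable_gl[OF N(2)]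
    have "E (\<lambda>x. u x - v x) \<le> (LINT x|\<mu>. e * (gl u x powr p + gl v x powr p) +
        A * ((gl u x powr p + gl v x powr p) / 2 - gl (\<lambda>x. (u x + v x) / 2) x powr p))"
      unfolding E_def
    proof (rule integral_mono_AE)
      have "AE x in \<mu>. grad (\<lambda>x. u x - v x) x = grad u x - grad v x"
        using grad_lincomb[OF uv, of 1 "-1"] by simp
      moreover have "AE x in \<mu>. grad (\<lambda>x. (u x + v x) / 2) x = (1/2) *\<^sub>R grad u x + (1/2) *\<^sub>R grad v x"
        using grad_lincomb[OF uv, of "1/2" "1/2"] by (simp add: half)
      ultimately show "AE x in \<mu>. gl (\<lambda>x. u x - v x) x powr p \<le> e * (gl u x powr p + gl v x powr p) +
        A * ((gl u x powr p + gl v x powr p) / 2 - gl (\<lambda>x. (u x + v x) / 2) x powr p)"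
        using AE_space
      proof eventually_elim
        case (elim x)
        interpret inner_form "ip x" by (rule inner_form[OF elim(3)])
        let ?s = "gl u x" and ?t = "gl v x" and ?c = "ip x (grad u x) (grad v x)"
        note gl = gl_eq_len[OF elim(3)]
        have 1: "gl (\<lambda>x. u x - v x) x = sqrt (?s^2 + ?t^2 - 2 * ?c)"
          using len_lincomb[of 1 "grad u x" "-1" "grad v x"] by (simp add: gl elim(1))
        have "(1/2)^2 * ?s^2 + (1/2)^2 * ?t^2 + 2 * (1/2) * (1/2) * ?c = (?s^2 + ?t^2 + 2 * ?c) / 2^2"
          by (simp add: field_simps power2_eq_square)
        then have 2: "gl (\<lambda>x. (u x + v x) / 2) x = sqrt (?s^2 + ?t^2 + 2 * ?c) / 2"
          using len_lincomb[of "1/2" "grad u x" "1/2" "grad v x"]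
          by (simp only: gl elim(2) real_sqrt_divide real_sqrt_pow2 real_sqrt_abs abs_numeral)
        show ?case unfolding 1 2
          by (rule A(2)) (use Cauchy_Schwarz[of "grad u x" "grad v x"] in \<open>auto simp: gl len_nonneg\<close>)
      qed
    qed (use int in auto)
    also have "\<dots> = e * (E u + E v) + A * ((E u + E v) / 2 - E (\<lambda>x. (u x + v x) / 2))"
      unfolding E_def using int by simp
    finally show "E (\<lambda>x. u x - v x) \<le> e * (E u + E v) + A * ((E u + E v) / 2 - E (\<lambda>x. (u x + v x) / 2))" .
  qed
qed

text \<open>Takes the place of the triangle inequality for the norm: it compares the energy of a
  limit with those of its approximants and makes the relation of zero energy transitive.\<close>

lemma E_le_epsilon:
  assumes "0 < e"
  obtains A where "0 \<le> A" "\<And>u v. u \<in> N1p \<mu> p \<Longrightarrow> v \<in> N1p \<mu> p \<Longrightarrow>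
    E u \<le> (1 + e) * E v + A * E (\<lambda>x. u x - v x)"
proof -
  obtain A where A: "0 \<le> A" "\<And>s t. 0 \<le> s \<Longrightarrow> 0 \<le> t \<Longrightarrow> (s + t) powr p \<le> (1 + e) * s powr p + A * t powr p"
    using powr_add_le_epsilon[OF p_pos assms] by blast
  show ?thesis
  proof (rule that[OF A(1)])
    fix u v assume uv: "u \<in> N1p \<mu> p" "v \<in> N1p \<mu> p"
    note int = integrable_gl[OF uv(1)] integrable_gl[OF uv(2)] integrable_gl[OF N1p_diff[OF uv]]
    have "E u \<le> (LINT x|\<mu>. (1 + e) * gl v x powr p + A * gl (\<lambda>x. u x - v x) x powr p)"
      unfolding E_def
    proof (rule integral_mono_AE)
      have "AE x in \<mu>. grad (\<lambda>x. u x - v x) x = grad u x - grad v x"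
        using grad_lincomb[OF uv, of 1 "-1"] by simp
      then show "AE x in \<mu>. gl u x powr p \<le> (1 + e) * gl v x powr p + A * gl (\<lambda>x. u x - v x) x powr p"
        using AE_space
      proof eventually_elim
        case (elim x)
        interpret inner_form "ip x" by (rule inner_form[OF elim(2)])
        note gl = gl_eq_len[OF elim(2)]
        have "gl u x \<le> gl v x + gl (\<lambda>x. u x - v x) x"
          using len_triangle[of "grad v x" "grad u x - grad v x"] by (simp add: gl elim(1))
        then have "gl u x powr p \<le> (gl v x + gl (\<lambda>x. u x - v x) x) powr p"
          using gl_nonneg[OF elim(2)] p_pos by (intro powr_mono2) auto
        also have "\<dots> \<le> (1 + e) * gl v x powr p + A * gl (\<lambda>x. u x - v x) x powr p"
          using gl_nonneg[OF elim(2)] by (intro A(2)) auto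
        finally show ?case .
      qed
    qed (use int in auto)
    also have "\<dots> = (1 + e) * E v + A * E (\<lambda>x. u x - v x)"
      unfolding E_def using int by simp
    finally show "E u \<le> (1 + e) * E v + A * E (\<lambda>x. u x - v x)" .
  qed
qed

section \<open>Completeness of Newtonian functions with respect to the energy\<close>

lemma null_set_hull:
  assumes "AE x in \<mu>. P x"
  obtains N where "N \<in> sets (restrict_space borel \<Omega>)" "emeasure \<mu> N = 0" "\<And>x. x \<in> \<Omega> - N \<Longrightarrow> P x"
proof -
  obtain A where A: "{x\<in>\<Omega>. \<not> P x} \<subseteq> A" "A \<in> null_sets \<mu>"
    using assms by (auto simp: eventually_ae_filter)
  obtain B where "B \<in> sets (restrict_space borel \<Omega>)" "A \<subseteq> B" "emeasure \<mu> B = emeasure \<mu> A"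
    using hull[of A] A(2) by auto
  then show ?thesis using that[of B] A by auto
qed

text \<open>Of the decay (1/4)^k the weights \<open>2^k\<close> leave (1/2)^k, whose p-th powers
  form a convergent series.\<close>

lemma Lp_majorant_geometric_finite:
  assumes f: "\<And>k. f k \<in> borel_measurable \<mu>"
    and le: "\<And>k. Lp_power (f k) \<le> ennreal (b * ((1/4)^k) powr p)" and b: "0 \<le> b"
  shows "(\<integral>\<^sup>+x. epowr (Lp_majorant p (\<lambda>k. 2^k) f x) p \<partial>\<mu>) < top"
proof -
  have "(\<integral>\<^sup>+x. epowr (Lp_majorant p (\<lambda>k. 2^k) f x) p \<partial>\<mu>) =
      (\<Sum>k. ennreal ((2^k) powr p) * Lp_power (f k))"
    by (rule nn_integral_Lp_majorant[OF p_pos f])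
  also have "\<dots> \<le> (\<Sum>k. ennreal (b * ((1/2) powr p)^k))"
  proof (intro suminf_le)
    fix k
    have eq: "(2^k) powr p * (b * ((1/4)^k) powr p) = b * ((1/2) powr p)^k"
    proof -
      have "(2^k) powr p * ((1/4)^k) powr p = ((1/2)^k) powr p"
        by (simp flip: powr_mult power_mult_distrib)
      also have "\<dots> = ((1/2) powr p)^k"
        by (simp add: powr_powr mult.commute powr_power flip: powr_realpow)
      finally show ?thesis by simp
    qed
    have "ennreal ((2^k) powr p) * Lp_power (f k) \<le> ennreal ((2^k) powr p) * ennreal (b * ((1/4)^k) powr p)"
      by (intro mult_left_mono le) auto
    then show "ennreal ((2^k) powr p) * Lp_power (f k) \<le> ennreal (b * ((1/2) powr p)^k)"
      using b by (simp add: eq flip: ennreal_mult)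
  qed auto
  also have "\<dots> = ennreal (\<Sum>k. b * ((1/2) powr p)^k)"
  proof (intro suminf_ennreal2 summable_mult summable_geometric)
    have "(1/2::real) powr p < (1/2) powr 0" using p_pos by (intro powr_less_mono') auto
    then show "norm ((1/2::real) powr p) < 1" by simp
  qed (use b in auto)
  also have "\<dots> < top" by simp
  finally show ?thesis .
qed

text \<open>Two majorants drive the limit: \<open>S\<close> for weak upper gradients of the
  increments, \<open>T\<close> for the increments themselves, which the Poincare inequality controls
  once the means are removed. Where \<open>T\<close> is finite the centred functions converge;
  \<open>S\<close> bounds the gradients of the remainders.\<close>

lemma N1p_complete_fast:
  assumes w: "\<And>k. w k \<in> N1p \<mu> p"
    and fast: "\<And>k. E (\<lambda>x. w (Suc k) x - w k x) \<le> ((1/4)^k) powr p"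
  obtains u where "u \<in> N1p \<mu> p" "(\<lambda>k. E (\<lambda>x. w k x - u x)) \<longlonglongrightarrow> 0"
proof -
  \<comment> \<open>Energies ignore constants, so they cannot make the \<open>w k\<close> themselves
    converge pointwise; removing the means gives every increment mean zero.\<close>
  define v where "v k = (\<lambda>x. w k x - mean (w k))" for k
  have v: "v k \<in> N1p \<mu> p" for k unfolding v_def using w by (rule N1p_minus_const)
  define d where "d k = (\<lambda>x. v (Suc k) x - v k x)" for k
  have d: "d k \<in> N1p \<mu> p" for k unfolding d_def using v by (intro N1p_diff)
  have E_d: "E (d k) \<le> ((1/4)^k) powr p" for k
  proof -
    have "d k = (\<lambda>x. (w (Suc k) x - w k x) - (mean (w (Suc k)) - mean (w k)))"
      by (auto simp: d_def v_def)
    then show ?thesis using fast[of k] E_minus_const[OF N1p_diff[OF w w]] by simp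
  qed
  have mean_d: "mean (d k) = 0" for k
  proof -
    have \<mu>: "measure \<mu> \<Omega> \<noteq> 0"
      using nonempty m_pos[OF _ R_pos] B_R by (metis all_not_in_conv less_irrefl m_def order_refl)
    have "mean (v k) = 0" for k
      using N1p_integrable[OF w[of k]] \<mu> by (simp add: mean_def v_def)
    then have "(LINT x|\<mu>. v k x) = 0" for k using \<mu> by (simp add: mean_def)
    then show ?thesis using N1p_integrable[OF v] by (simp add: mean_def d_def)
  qed
  have "\<exists>g. weak_upper_gradient \<mu> p (d k) g \<and>
      Lp_power g \<le> ennreal (C powr p * ((1/4)^k) powr p)" for k
  proof -
    obtain g where g: "weak_upper_gradient \<mu> p (d k) g"
      "Lp_power g \<le> ennreal (C powr p) * (\<integral>\<^sup>+x. epowr (ennreal (gl (d k) x)) p \<partial>\<mu>)"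
      using minimal_gradient[OF d[of k]] by blast
    note g(2)
    also have "ennreal (C powr p) * (\<integral>\<^sup>+x. epowr (ennreal (gl (d k) x)) p \<partial>\<mu>) = ennreal (C powr p * E (d k))"
      using E_nonneg by (simp add: ennreal_mult flip: ennreal_E[OF d])
    also have "\<dots> \<le> ennreal (C powr p * ((1/4)^k) powr p)"
      using E_d[of k] by (intro ennreal_leI mult_left_mono) auto
    finally show ?thesis using g(1) by blast
  qed
  then obtain g where g: "\<And>k. weak_upper_gradient \<mu> p (d k) (g k)"
    "\<And>k. Lp_power (g k) \<le> ennreal (C powr p * ((1/4)^k) powr p)" by metis
  have g_borel: "g k \<in> borelm" for k using g(1) by (rule weak_upper_gradient_measurable)
  define S where "S = Lp_majorant p (\<lambda>k. 2^k) g"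
  have S_borel: "S \<in> borelm" unfolding S_def using g_borel by measurable
  have S_fin: "Lp_power S < top"
    unfolding S_def using g(2) by (intro Lp_majorant_geometric_finite borelm_imp_measurable g_borel) auto
  have le_of: "t \<le> ennreal ((1/2)^k) * s" if "ennreal (2^k) * t \<le> s" for t s and k :: nat
  proof -
    have "t = ennreal ((1/2)^k) * (ennreal (2^k) * t)"
      by (simp add: power_one_over flip: mult.assoc ennreal_mult)
    also have "\<dots> \<le> ennreal ((1/2)^k) * s" using that by (rule mult_left_mono) simp
    finally show ?thesis .
  qed
  have g_le: "g k x \<le> ennreal ((1/2)^k) * S x" for k x
    unfolding S_def using p_pos by (intro le_of Lp_majorant_ge) auto
  have weak_d: "weak_upper_gradient \<mu> p (d k) (\<lambda>x. ennreal ((1/2)^k) * S x)" for k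
    using S_borel by (intro weak_upper_gradient_mono[OF g(1)] g_le) auto
  define T where "T = Lp_majorant p (\<lambda>k. 2^k) (\<lambda>k x. ennreal \<bar>d k x\<bar>)"
  note [measurable] = N1pD(1)[OF d] N1pD(1)[OF v]
  have T_meas [measurable]: "T \<in> borel_measurable \<mu>" unfolding T_def by measurable
  have T_fin: "Lp_power T < top"
    unfolding T_def
  proof (rule Lp_majorant_geometric_finite)
    fix k
    have "(\<integral>\<^sup>+x. epowr (ennreal \<bar>d k x\<bar>) p \<partial>\<mu>) \<le> ennreal (energy_const * E (d k))"
      using poincare_energy[OF d[of k]] by (simp add: mean_d)
    also have "\<dots> \<le> ennreal (energy_const * ((1/4)^k) powr p)"
      using E_d[of k] energy_const_pos by (intro ennreal_leI mult_left_mono) auto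
    finally show "(\<integral>\<^sup>+x. epowr (ennreal \<bar>d k x\<bar>) p \<partial>\<mu>) \<le> ennreal (energy_const * ((1/4)^k) powr p)" .
  qed (use energy_const_pos in auto)
  have d_le: "ennreal \<bar>d k x\<bar> \<le> ennreal ((1/2)^k) * T x" for k x
    unfolding T_def using p_pos
    by (intro le_of Lp_majorant_ge[where f="\<lambda>k x. ennreal \<bar>d k x\<bar>"]) auto
  have "AE x in \<mu>. epowr (T x) p \<noteq> top"
    using T_fin by (intro nn_integral_noteq_infinite[unfolded infinity_ennreal_def]) auto
  then have T_ae: "AE x in \<mu>. T x \<noteq> top" by simp
  have d_le': "\<bar>v (Suc k) x - v k x\<bar> \<le> (1/2)^k * enn2real (T x)" if "T x \<noteq> top" for k x
  proof -
    have "ennreal \<bar>d k x\<bar> \<le> ennreal ((1/2)^k) * ennreal (enn2real (T x))"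
      using d_le[of k x] that by (cases "T x") auto
    then show ?thesis by (simp add: d_def ennreal_le_iff flip: ennreal_mult)
  qed
  have geo: "convergent (\<lambda>k. v k x)" "\<bar>lim (\<lambda>k. v k x) - v n x\<bar> \<le> 2 * (1/2)^n * enn2real (T x)"
    if "T x \<noteq> top" for x n
    using geometric_increments[of "\<lambda>k. v k x" "enn2real (T x)"] d_le'[OF that] by auto
  \<comment> \<open>The function that is \<open>top\<close> on \<open>N\<close> and excludes curves
    has to be Borel, so the null set where \<open>T\<close> is \<open>top\<close> is enlarged to a
    Borel null set.\<close>
  obtain N where N: "N \<in> sets (restrict_space borel \<Omega>)" "emeasure \<mu> N = 0" "\<And>x. x \<in> \<Omega> - N \<Longrightarrow> T x \<noteq> top"
    using null_set_hull[OF T_ae] by blast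
  \<comment> \<open>Where the sequence diverges \<open>lim\<close> is an unspecified value; such
    points of \<Omega> lie in \<open>N\<close>. Being a limit at every point of good curves is what
    the argument along curves uses.\<close>
  define u where "u = (\<lambda>x. lim (\<lambda>k. v k x))"
  have [measurable]: "u \<in> borel_measurable \<mu>" unfolding u_def by measurable
  have weak: "weak_upper_gradient \<mu> p (\<lambda>x. u x - v n x) (\<lambda>x. ennreal (2 * (1/2)^n) * S x)" for n
    unfolding u_def
  proof (rule weak_upper_gradient_limit[OF S_borel _ _ N(1,2)])
    show "weak_upper_gradient \<mu> p (\<lambda>x. v (Suc k) x - v k x) (\<lambda>x. ennreal ((1/2)^k) * S x)" for k
      using weak_d[of k] by (simp add: d_def)
  qed (use S_fin N(3) geo(1) in \<open>auto simp: Lp_norm_less_top_iff\<close>)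
  have S_fin': "(\<integral>\<^sup>+x. epowr (ennreal (2 * (1/2)^n) * S x) p \<partial>\<mu>) = ennreal ((2 * (1/2)^n) powr p) * Lp_power S" for n
    using borelm_imp_measurable[OF S_borel] by (intro Lp_cmult) auto
  then have S_fin'': "Lp_norm \<mu> p (\<lambda>x. ennreal (2 * (1/2)^n) * S x) < top" for n
    using S_fin by (simp add: Lp_norm_less_top_iff ennreal_mult_less_top)
  have N1p_diff_v: "(\<lambda>x. u x - v n x) \<in> N1p \<mu> p" for n
  proof -
    have "(\<integral>\<^sup>+x. epowr (ennreal \<bar>u x - v n x\<bar>) p \<partial>\<mu>) \<le> (\<integral>\<^sup>+x. epowr (ennreal (2 * (1/2)^n) * T x) p \<partial>\<mu>)"
    proof (intro nn_integral_mono_AE, use T_ae in eventually_elim)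
      case (elim x)
      have "ennreal \<bar>u x - v n x\<bar> \<le> ennreal (2 * (1/2)^n * enn2real (T x))"
        unfolding u_def using geo(2)[OF elim] by (rule ennreal_leI)
      also have "\<dots> = ennreal (2 * (1/2)^n) * T x" using elim by (cases "T x") (auto simp: ennreal_mult)
      finally show ?case by (intro epowr_mono p_ge_0)
    qed
    also have "\<dots> < top" using T_fin by (simp add: Lp_cmult ennreal_mult_less_top)
    finally show ?thesis
      using weak[of n] S_fin''[of n] by (auto simp: N1p_def Lp_norm_less_top_iff)
  qed
  have u: "u \<in> N1p \<mu> p"
    using N1p_lincomb[OF N1p_diff_v[of 0] v[of 0], of 1 1 0] by simp
  define s where "s = enn2real (Lp_power S)"
  have s: "Lp_power S = ennreal s" "0 \<le> s" using S_fin by (simp_all add: s_def)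
  have E_le: "E (\<lambda>x. w n x - u x) \<le> C powr p * s * (2 * (1/2)^n) powr p" for n
  proof -
    have "E (\<lambda>x. w n x - u x) = E (\<lambda>x. u x - w n x)" by (rule E_diff_commute[OF w u])
    also have "\<dots> = E (\<lambda>x. u x - v n x)"
      using E_add_const[OF N1p_diff[OF u w], of n "mean (w n)"] by (simp add: v_def algebra_simps)
    finally have eq: "E (\<lambda>x. w n x - u x) = E (\<lambda>x. u x - v n x)" .
    have "ennreal (E (\<lambda>x. u x - v n x)) \<le> ennreal (C powr p) * (ennreal ((2 * (1/2)^n) powr p) * ennreal s)"
      using E_le_weak_upper_gradient[OF N1p_diff_v weak S_fin''] unfolding S_fin' s .
    also have "\<dots> = ennreal (C powr p * s * (2 * (1/2)^n) powr p)"
      using s by (simp add: mult_ac flip: ennreal_mult)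
    finally show ?thesis unfolding eq using s by (simp add: ennreal_le_iff)
  qed
  have "(\<lambda>n. C powr p * s * (2 * (1/2)^n) powr p) \<longlonglongrightarrow> C powr p * s * (2 * 0) powr p"
  proof -
    have "(\<lambda>n. (2 * (1/2)^n :: real) powr p) \<longlonglongrightarrow> (2 * 0) powr p"
      using p_pos by (intro tendsto_powr' tendsto_mult tendsto_const LIMSEQ_power_zero) auto
    then show ?thesis by (intro tendsto_mult tendsto_const)
  qed
  then have "(\<lambda>n. C powr p * s * (2 * (1/2)^n) powr p) \<longlonglongrightarrow> 0" by simp
  then have "(\<lambda>k. E (\<lambda>x. w k x - u x)) \<longlonglongrightarrow> 0"
    by (rule tendsto_sandwich[OF _ _ tendsto_const, rotated 2]) (auto simp: E_nonneg E_le)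
  then show ?thesis using that u by blast
qed

text \<open>A subsequence is fast enough for the previous result; its convergence is all that a
  minimizing sequence has to provide.\<close>

lemma N1p_complete:
  assumes w: "\<And>k::nat. w k \<in> N1p \<mu> p"
    and cauchy: "\<And>e. 0 < e \<Longrightarrow> \<exists>N. \<forall>m\<ge>N. \<forall>n\<ge>N. E (\<lambda>x. w m x - w n x) < e"
  obtains u r where "u \<in> N1p \<mu> p" "strict_mono r" "(\<lambda>k. E (\<lambda>x. w (r k) x - u x)) \<longlonglongrightarrow> 0"
proof -
  have "\<exists>N. \<forall>m\<ge>N. \<forall>n\<ge>N. E (\<lambda>x. w m x - w n x) < ((1/4)^k) powr p" for k :: nat
    by (intro cauchy) simp
  then obtain N where N: "\<And>k m n. N k \<le> m \<Longrightarrow> N k \<le> n \<Longrightarrow> E (\<lambda>x. w m x - w n x) < ((1/4)^k) powr p"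
    by metis
  \<comment> \<open>The recursion makes \<open>r\<close> strictly increasing and keeps
    \<open>r k\<close> at or above \<open>N k\<close>.\<close>
  define r where "r = rec_nat (N 0) (\<lambda>k m. max (Suc m) (N (Suc k)))"
  have r_Suc: "r (Suc k) = max (Suc (r k)) (N (Suc k))" for k by (simp add: r_def)
  have r_mono: "strict_mono r" by (intro strict_mono_Suc_iff[THEN iffD2] allI) (simp add: r_Suc less_Suc_eq_le)
  have r_ge: "N k \<le> r k" for k by (cases k) (auto simp: r_def)
  have "E (\<lambda>x. w (r (Suc k)) x - w (r k) x) \<le> ((1/4)^k) powr p" for k
    using N[of k "r (Suc k)" "r k"] r_ge[of k] by (simp add: r_Suc less_imp_le)
  then obtain u where "u \<in> N1p \<mu> p" "(\<lambda>k. E (\<lambda>x. w (r k) x - u x)) \<longlonglongrightarrow> 0"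
    by (rule N1p_complete_fast[of "\<lambda>k. w (r k)", OF w])
  then show ?thesis using that r_mono by blast
qed

end

subsection \<open>Minimizers of the Neumann functional\<close>

context cheeger_space
begin

text \<open>Because \<open>l\<close> is linear it cancels from the convexity gap, and the gap of
  \<open>E\<close> is \<open>p\<close> times that of \<open>J\<close>. The midpoint is a competitor,
  so its value is at least \<open>I\<close>.\<close>

lemma minimizer_gap:
  fixes l :: "('a \<Rightarrow> real) \<Rightarrow> real"
  defines "J \<equiv> \<lambda>u. E u / p - l u"
  assumes lin: "\<And>u v a b. u \<in> N1p \<mu> p \<Longrightarrow> v \<in> N1p \<mu> p \<Longrightarrow> l (\<lambda>x. a * u x + b * v x) = a * l u + b * l v"
    and lower: "\<And>v. v \<in> N1p \<mu> p \<Longrightarrow> I \<le> J v"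
    and uv: "u \<in> N1p \<mu> p" "v \<in> N1p \<mu> p"
  shows "(E u + E v) / 2 - E (\<lambda>x. (u x + v x) / 2) \<le> p * ((J u + J v) / 2 - I)"
proof -
  have half: "(\<lambda>x. (u x + v x) / 2) = (\<lambda>x. 1/2 * u x + 1/2 * v x)" by (auto simp: field_simps)
  have N: "(\<lambda>x. (u x + v x) / 2) \<in> N1p \<mu> p"
    using N1p_lincomb[OF uv, of "1/2" "1/2" 0] by (simp add: half)
  have "l (\<lambda>x. (u x + v x) / 2) = (l u + l v) / 2"
    unfolding half lin[OF uv] by simp
  then have "(E u + E v) / 2 - E (\<lambda>x. (u x + v x) / 2) = p * ((J u + J v) / 2 - J (\<lambda>x. (u x + v x) / 2))"
    using p_pos by (simp add: J_def field_simps)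
  also have "\<dots> \<le> p * ((J u + J v) / 2 - I)"
    using lower[OF N] p_pos by (intro mult_left_mono) auto
  finally show ?thesis .
qed

lemma minimizer_unique:
  fixes l :: "('a \<Rightarrow> real) \<Rightarrow> real"
  defines "J \<equiv> \<lambda>u. E u / p - l u"
  assumes lin: "\<And>u v a b. u \<in> N1p \<mu> p \<Longrightarrow> v \<in> N1p \<mu> p \<Longrightarrow> l (\<lambda>x. a * u x + b * v x) = a * l u + b * l v"
    and uv: "u \<in> N1p \<mu> p" "v \<in> N1p \<mu> p"
    and min: "\<And>w. w \<in> N1p \<mu> p \<Longrightarrow> J u \<le> J w" "\<And>w. w \<in> N1p \<mu> p \<Longrightarrow> J v \<le> J w"
  shows "E (\<lambda>x. u x - v x) = 0"
proof -
  have "J u = J v" using min(1)[OF uv(2)] min(2)[OF uv(1)] by simp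
  moreover have "(E u + E v) / 2 - E (\<lambda>x. (u x + v x) / 2) \<le> p * (((E u / p - l u) + (E v / p - l v)) / 2 - J u)"
    by (rule minimizer_gap[OF lin _ uv]) (use min(1) in \<open>simp_all add: J_def\<close>)
  moreover from calculation(1) have "((E u / p - l u) + (E v / p - l v)) / 2 - J u = 0" by (simp add: J_def)
  ultimately have gap: "(E u + E v) / 2 - E (\<lambda>x. (u x + v x) / 2) \<le> 0"
    by (simp only: mult_zero_right)
  have "E (\<lambda>x. u x - v x) \<le> 0 + e" if e: "0 < e" for e
  proof -
    \<comment> \<open>The total energy is fixed, so its share in the convexity estimate can be made
      arbitrarily small; the 1 avoids division by zero.\<close>
    define e' where "e' = e / (E u + E v + 1)"
    have pos: "0 < E u + E v + 1" using E_nonneg[of u] E_nonneg[of v] by simp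
    then have "0 < e'" using e by (simp add: e'_def)
    then obtain A where A: "0 \<le> A" "\<And>u v. u \<in> N1p \<mu> p \<Longrightarrow> v \<in> N1p \<mu> p \<Longrightarrow>
      E (\<lambda>x. u x - v x) \<le> e' * (E u + E v) + A * ((E u + E v) / 2 - E (\<lambda>x. (u x + v x) / 2))"
      using E_uniformly_convex by blast
    have "E (\<lambda>x. u x - v x) \<le> e' * (E u + E v) + A * ((E u + E v) / 2 - E (\<lambda>x. (u x + v x) / 2))"
      by (rule A(2)[OF uv])
    also have "\<dots> \<le> e' * (E u + E v) + A * 0"
      using gap A(1) by (intro add_left_mono mult_left_mono) auto
    also have "\<dots> \<le> e' * (E u + E v + 1)" using \<open>0 < e'\<close> by (simp add: algebra_simps)
    also have "\<dots> = e" using pos by (simp add: e'_def)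
    finally show ?thesis by simp
  qed
  then have "E (\<lambda>x. u x - v x) \<le> 0" by (rule field_le_epsilon)
  then show ?thesis using E_nonneg by (rule antisym)
qed

text \<open>With \<open>x = e powr (1 / p)\<close> the expression is
  \<open>x powr p / p - A * x\<close>, which is at least \<open>x\<close> once \<open>x\<close> is
  large. Hence it is bounded below and its sublevel sets are bounded.\<close>

lemma coercive:
  fixes A M :: real
  assumes A: "0 \<le> A"
  shows "\<exists>b B. \<forall>e\<ge>0. b \<le> e / p - A * e powr (1 / p) \<and> (e / p - A * e powr (1 / p) \<le> M \<longrightarrow> e \<le> B)"
proof -
  \<comment> \<open>The solution of \<open>x powr (p - 1) = p * (A + 1)\<close>; beyond it
    \<open>x powr p / p\<close> is at least \<open>(A + 1) * x\<close>.\<close>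
  define x1 where "x1 = (p * (A + 1)) powr (1 / (p - 1))"
  have x1: "0 \<le> x1" by (simp add: x1_def)
  have large: "e powr (1 / p) \<le> e / p - A * e powr (1 / p)" if e: "0 \<le> e" "x1 \<le> e powr (1 / p)" for e
  proof -
    define x where "x = e powr (1 / p)"
    have e_eq: "e = x powr p" using e p_pos by (simp add: x_def powr_powr)
    have "p * (A + 1) = x1 powr (p - 1)" using A p_gt_1 by (simp add: x1_def powr_powr)
    also have "\<dots> \<le> x powr (p - 1)" using x1 e p_gt_1 unfolding x_def by (intro powr_mono2) auto
    finally have "p * (A + 1) * x \<le> x powr (p - 1) * x" by (intro mult_right_mono) (auto simp: x_def)
    also have "x powr (p - 1) * x = x powr p"
      using powr_add[of x "p - 1" 1] by (simp add: x_def)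
    finally have "(A + 1) * x \<le> e / p" using p_pos by (simp add: e_eq field_simps)
    then show ?thesis by (simp add: x_def algebra_simps)
  qed
  show ?thesis
  proof (rule exI[of _ "- A * x1"], rule exI[of _ "max x1 M powr p"], intro allI impI conjI)
    fix e :: real assume e: "0 \<le> e"
    show "- A * x1 \<le> e / p - A * e powr (1 / p)"
    proof (cases "x1 \<le> e powr (1 / p)")
      case True
      then show ?thesis using large[OF e True] A x1 by (smt (verit) mult_nonneg_nonneg mult_minus_left powr_ge_zero)
    next
      case False
      then have "A * e powr (1 / p) \<le> A * x1" using A by (intro mult_left_mono) auto
      moreover have "0 \<le> e / p" using e p_pos by simp
      ultimately show ?thesis by simp
    qed
    assume M: "e / p - A * e powr (1 / p) \<le> M"
    have "e powr (1 / p) \<le> max x1 M"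
      using large[OF e] M by (cases "x1 \<le> e powr (1 / p)") auto
    then have "(e powr (1 / p)) powr p \<le> max x1 M powr p" using p_pos by (intro powr_mono2) auto
    then show "e \<le> max x1 M powr p" using e p_pos by (simp add: powr_powr)
  qed
qed

lemma minimizer_exists:
  fixes l :: "('a \<Rightarrow> real) \<Rightarrow> real"
  defines "J \<equiv> \<lambda>u. E u / p - l u"
  assumes lin: "\<And>u v a b. u \<in> N1p \<mu> p \<Longrightarrow> v \<in> N1p \<mu> p \<Longrightarrow> l (\<lambda>x. a * u x + b * v x) = a * l u + b * l v"
    and bound: "\<And>u. u \<in> N1p \<mu> p \<Longrightarrow> \<bar>l u\<bar> \<le> A * E u powr (1 / p)" and A: "0 \<le> A"
  shows "\<exists>u\<in>N1p \<mu> p. \<forall>v\<in>N1p \<mu> p. J u \<le> J v"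
proof -
  have J_ge: "E u / p - A * E u powr (1 / p) \<le> J u" if "u \<in> N1p \<mu> p" for u
    using bound[OF that] by (auto simp: J_def)
  obtain b where b: "\<And>e. 0 \<le> e \<Longrightarrow> b \<le> e / p - A * e powr (1 / p)"
    using coercive[OF A, of 0] by blast
  define I where "I = Inf (J ` N1p \<mu> p)"
  have bdd: "bdd_below (J ` N1p \<mu> p)"
    using b[OF E_nonneg] J_ge by (intro bdd_belowI2[of _ b]) (meson order_trans)
  have I_le: "I \<le> J v" if "v \<in> N1p \<mu> p" for v
    unfolding I_def using bdd that by (intro cInf_lower) auto
  have "\<exists>w\<in>N1p \<mu> p. J w < I + 1 / real (Suc n)" for n
  proof -
    have "\<exists>y\<in>J ` N1p \<mu> p. y < I + 1 / real (Suc n)"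
      using N1p_const unfolding I_def by (intro cInf_lessD) auto
    then show ?thesis by auto
  qed
  then obtain w where w: "\<And>n. w n \<in> N1p \<mu> p" "\<And>n. J (w n) < I + 1 / real (Suc n)" by metis
  obtain B where B: "\<And>e. 0 \<le> e \<Longrightarrow> e / p - A * e powr (1 / p) \<le> I + 1 \<Longrightarrow> e \<le> B"
    using coercive[OF A, of "I + 1"] by blast
  have E_w: "E (w n) \<le> B" for n
  proof (rule B[OF E_nonneg])
    have "1 / real (Suc n) \<le> 1" by simp
    then show "E (w n) / p - A * E (w n) powr (1 / p) \<le> I + 1"
      using J_ge[OF w(1)[of n]] w(2)[of n] by linarith
  qed
  have B0: "0 \<le> B" using E_w[of 0] E_nonneg[of "w 0"] by linarith
  have cauchy: "\<exists>N. \<forall>m\<ge>N. \<forall>n\<ge>N. E (\<lambda>x. w m x - w n x) < e" if e: "0 < e" for e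
  proof -
    \<comment> \<open>Energies along the sequence are at most \<open>B\<close>, so this choice makes
      the first term of the convexity estimate at most \<open>e / 2\<close>.\<close>
    define e' where "e' = e / (4 * (B + 1))"
    have e': "0 < e'" using e B0 by (simp add: e'_def)
    obtain K where K: "0 \<le> K" "\<And>u v. u \<in> N1p \<mu> p \<Longrightarrow> v \<in> N1p \<mu> p \<Longrightarrow>
      E (\<lambda>x. u x - v x) \<le> e' * (E u + E v) + K * ((E u + E v) / 2 - E (\<lambda>x. (u x + v x) / 2))"
      using E_uniformly_convex[OF e'] by blast
    obtain N where N: "K * p * 2 / e < real (Suc N)" using reals_Archimedean2 by (metis less_trans of_nat_less_iff lessI)
    have "E (\<lambda>x. w m x - w n x) < e" if mn: "N \<le> m" "N \<le> n" for m n
    proof -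
      have le: "1 / real (Suc k) \<le> 1 / real (Suc N)" if "N \<le> k" for k
        using that by (intro divide_left_mono) auto
      have "(J (w m) + J (w n)) / 2 - I \<le> 1 / real (Suc N)"
      proof -
        have "J (w m) < I + 1 / real (Suc N)" "J (w n) < I + 1 / real (Suc N)"
          using less_le_trans[OF w(2) add_left_mono[OF le]] mn by blast+
        then show ?thesis by argo
      qed
      then have "p * ((J (w m) + J (w n)) / 2 - I) \<le> p * (1 / real (Suc N))"
        using p_ge_0 by (rule mult_left_mono)
      moreover have "(E (w m) + E (w n)) / 2 - E (\<lambda>x. (w m x + w n x) / 2) \<le> p * ((J (w m) + J (w n)) / 2 - I)"
        unfolding J_def by (rule minimizer_gap[OF lin _ w(1) w(1)]) (use I_le in \<open>simp_all add: J_def\<close>)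
      ultimately have gap: "(E (w m) + E (w n)) / 2 - E (\<lambda>x. (w m x + w n x) / 2) \<le> p * (1 / real (Suc N))"
        by (rule order_trans[rotated])
      have "E (\<lambda>x. w m x - w n x) \<le> e' * (E (w m) + E (w n)) + K * ((E (w m) + E (w n)) / 2 - E (\<lambda>x. (w m x + w n x) / 2))"
        by (intro K(2) w)
      also have "\<dots> \<le> e' * (B + B) + K * (p * (1 / real (Suc N)))"
        using e' K(1) gap E_w by (intro add_mono mult_left_mono) auto
      also have "e' * (B + B) \<le> e / 2" using B0 e by (simp add: e'_def field_simps)
      also have "K * (p * (1 / real (Suc N))) < e / 2"
        using N e by (simp add: field_simps)
      finally show ?thesis by simp
    qed
    then show ?thesis by blast
  qed
  obtain u r where u: "u \<in> N1p \<mu> p" and r: "strict_mono r"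
    and lim: "(\<lambda>k. E (\<lambda>x. w (r k) x - u x)) \<longlonglongrightarrow> 0"
    using N1p_complete[of w, OF w(1) cauchy] by blast
  \<comment> \<open>Passing to the limit: \<open>l\<close> is controlled by the energy of the
    difference, and \<open>E u\<close> by \<open>E_le_epsilon\<close>, whose loss
    \<open>e * E (w (r k)) / p\<close> is at most \<epsilon> by the choice of
    \<open>e\<close>.\<close>
  have "J u \<le> I + \<epsilon>" if \<epsilon>: "0 < \<epsilon>" for \<epsilon>
  proof -
    define e where "e = \<epsilon> * p / (B + 1)"
    have e: "0 < e" using \<epsilon> p_pos B0 by (simp add: e_def)
    obtain K where K: "0 \<le> K" "\<And>u v. u \<in> N1p \<mu> p \<Longrightarrow> v \<in> N1p \<mu> p \<Longrightarrow>
        E u \<le> (1 + e) * E v + K * E (\<lambda>x. u x - v x)"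
      using E_le_epsilon[OF e] by blast
    define \<delta> where "\<delta> k = E (\<lambda>x. w (r k) x - u x)" for k
    have "J u \<le> I + 1 / real (Suc k) + (\<epsilon> + K / p * \<delta> k + A * \<delta> k powr (1 / p))" for k
    proof -
      have "l (\<lambda>x. w (r k) x - u x) = l (w (r k)) - l u"
        using lin[OF w(1)[of "r k"] u, of 1 "-1"] by simp
      then have 1: "- l u \<le> - l (w (r k)) + A * \<delta> k powr (1 / p)"
        using bound[OF N1p_diff[OF w(1) u], of "r k"] by (auto simp: \<delta>_def)
      have "E u \<le> (1 + e) * E (w (r k)) + K * \<delta> k"
        using K(2)[OF u w(1), of "r k"] E_diff_commute[OF u w(1), of "r k"] by (simp add: \<delta>_def)
      then have "E u / p \<le> ((1 + e) * E (w (r k)) + K * \<delta> k) / p"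
        using p_pos by (intro divide_right_mono) auto
      also have "\<dots> = E (w (r k)) / p + e * E (w (r k)) / p + K / p * \<delta> k"
        by (simp add: add_divide_distrib distrib_right)
      also have "e * E (w (r k)) / p \<le> e * (B + 1) / p"
        using E_w[of "r k"] e p_pos by (intro divide_right_mono mult_left_mono) auto
      also have "e * (B + 1) / p = \<epsilon>" using B0 p_pos by (simp add: e_def)
      finally have 2: "E u / p \<le> E (w (r k)) / p + \<epsilon> + K / p * \<delta> k" by simp
      have "1 / real (Suc (r k)) \<le> 1 / real (Suc k)"
        using seq_suble[OF r, of k] by (intro divide_left_mono) auto
      then show ?thesis using 1 2 w(2)[of "r k"] by (simp add: J_def)
    qed
    moreover have "(\<lambda>k. I + 1 / real (Suc k) + (\<epsilon> + K / p * \<delta> k + A * \<delta> k powr (1 / p))) \<longlonglongrightarrow>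
        I + 0 + (\<epsilon> + K / p * 0 + A * 0 powr (1 / p))"
    proof (intro tendsto_add tendsto_mult tendsto_const)
      show "(\<lambda>k. 1 / real (Suc k)) \<longlonglongrightarrow> 0"
        using LIMSEQ_inverse_real_of_nat by (simp add: inverse_eq_divide)
      show \<delta>: "\<delta> \<longlonglongrightarrow> 0" using lim by (simp add: \<delta>_def[abs_def])
      show "(\<lambda>k. \<delta> k powr (1 / p)) \<longlonglongrightarrow> 0 powr (1 / p)"
        using p_pos by (intro tendsto_powr' \<delta> tendsto_const) (auto simp: \<delta>_def E_nonneg)
    qed
    ultimately have "J u \<le> I + 0 + (\<epsilon> + K / p * 0 + A * 0 powr (1 / p))"
      by (intro LIMSEQ_le_const) auto
    then show ?thesis by simp
  qed
  then have "J u \<le> I" by (rule field_le_epsilon)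
  then show ?thesis using u I_le by (meson order_trans)
qed

text \<open>From zero energy the centred estimate gives norm zero. Conversely the infimum in
  \<open>N1p_norm\<close> need not be attained: were the energy positive, some weak upper gradient
  would have norm below \<open>e\<close>, contradicting the bound of the energy by any weak upper
  gradient.\<close>

lemma HN_rel_iff: "(u, v) \<in> HN_rel \<mu> p \<longleftrightarrow> u \<in> N1p \<mu> p \<and> v \<in> N1p \<mu> p \<and> E (\<lambda>x. u x - v x) = 0"
proof -
  have "E (\<lambda>x. u x - v x) = 0" if uv: "u \<in> N1p \<mu> p" "v \<in> N1p \<mu> p" and z: "N1p_norm \<mu> p (\<lambda>x. u x - v x - t) = 0" for t
  proof (rule ccontr)
    let ?z = "\<lambda>x. u x - v x - t"
    have N: "?z \<in> N1p \<mu> p" by (intro N1p_minus_const N1p_diff uv)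
    assume "E (\<lambda>x. u x - v x) \<noteq> 0"
    then have "0 < E ?z" using E_minus_const[OF N1p_diff[OF uv]] E_nonneg[of ?z] by simp
    define e where "e = E ?z powr (1 / p) / C"
    have e: "0 < e" using \<open>0 < E ?z\<close> C by (simp add: e_def)
    have "(INF g\<in>{g. weak_upper_gradient \<mu> p ?z g}. Lp_norm \<mu> p g) < ennreal e"
      using z e by (simp add: N1p_norm_def)
    then obtain h where h: "weak_upper_gradient \<mu> p ?z h" "Lp_norm \<mu> p h < ennreal e"
      by (auto simp: INF_less_iff)
    obtain s where s: "Lp_norm \<mu> p h = ennreal s" "0 \<le> s" "s < e"
      using h(2) e by (cases "Lp_norm \<mu> p h") (auto simp: ennreal_less_iff)
    have "ennreal (E ?z) \<le> ennreal (C powr p) * Lp_power h"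
      using h s by (intro E_le_weak_upper_gradient N) auto
    also have "Lp_power h = ennreal (s powr p)"
      using epowr_Lp_norm[of p \<mu> h] p_pos s by (simp add: epowr_ennreal)
    finally have "E ?z \<le> C powr p * s powr p" by (simp add: ennreal_le_iff flip: ennreal_mult)
    also have "\<dots> < C powr p * e powr p"
      using s p_pos C by (intro mult_strict_left_mono powr_less_mono2) auto
    also have "\<dots> = E ?z" using C p_pos \<open>0 < E ?z\<close> by (simp add: e_def powr_divide powr_powr)
    finally show False by simp
  qed
  moreover have "\<exists>t. N1p_norm \<mu> p (\<lambda>x. u x - v x - t) = 0"
    if uv: "u \<in> N1p \<mu> p" "v \<in> N1p \<mu> p" and "E (\<lambda>x. u x - v x) = 0"
    using N1p_norm_centered_le[OF N1p_diff[OF uv]] that(3) by auto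
  ultimately show ?thesis by (auto simp: HN_rel_def)
qed

lemma equiv_HN_rel: "equiv (N1p \<mu> p) (HN_rel \<mu> p)"
proof (rule equivI)
  show "HN_rel \<mu> p \<subseteq> N1p \<mu> p \<times> N1p \<mu> p" by (auto simp: HN_rel_iff)
  show "refl_on (N1p \<mu> p) (HN_rel \<mu> p)" by (auto simp: refl_on_def HN_rel_iff E_const)
  show "sym (HN_rel \<mu> p)"
    by (rule symI) (use E_diff_commute in \<open>fastforce simp: HN_rel_iff\<close>)
  show "trans (HN_rel \<mu> p)"
  proof (rule transI)
    fix u v w assume uvw: "(u, v) \<in> HN_rel \<mu> p" "(v, w) \<in> HN_rel \<mu> p"
    then have N: "u \<in> N1p \<mu> p" "v \<in> N1p \<mu> p" "w \<in> N1p \<mu> p" by (auto simp: HN_rel_iff)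
    \<comment> \<open>Used for \<open>u - w\<close> and \<open>v - w\<close>, whose difference is
      \<open>u - v\<close>; the value 1 is arbitrary.\<close>
    obtain A where A: "0 \<le> A"
      "\<And>u v. u \<in> N1p \<mu> p \<Longrightarrow> v \<in> N1p \<mu> p \<Longrightarrow> E u \<le> (1 + 1) * E v + A * E (\<lambda>x. u x - v x)"
      using E_le_epsilon[OF zero_less_one] by blast
    from A(2)[OF N1p_diff[OF N(1,3)] N1p_diff[OF N(2,3)]] uvw
    have "E (\<lambda>x. u x - w x) \<le> 0" by (simp add: HN_rel_iff)
    then show "(u, w) \<in> HN_rel \<mu> p" using N E_nonneg[of "\<lambda>x. u x - w x"] by (simp add: HN_rel_iff)
  qed
qed

text \<open>By the Poincare inequality a function of zero energy equals its mean almost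
  everywhere.\<close>

lemma HN_rel_AE:
  assumes "(u, v) \<in> HN_rel \<mu> p"
  obtains t where "AE x in \<mu>. u x = v x + t"
proof
  have uv: "u \<in> N1p \<mu> p" "v \<in> N1p \<mu> p" "E (\<lambda>x. u x - v x) = 0" using assms by (auto simp: HN_rel_iff)
  note [measurable] = N1pD(1)[OF uv(1)] N1pD(1)[OF uv(2)]
  let ?t = "mean (\<lambda>x. u x - v x)"
  have "(\<integral>\<^sup>+y. epowr (ennreal \<bar>u y - v y - ?t\<bar>) p \<partial>\<mu>) = 0"
    using poincare_energy[OF N1p_diff[OF uv(1,2)]] uv(3) by simp
  then have "AE y in \<mu>. epowr (ennreal \<bar>u y - v y - ?t\<bar>) p = 0"
    by (subst (asm) nn_integral_0_iff_AE) auto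
  then show "AE x in \<mu>. u x = v x + ?t" by eventually_elim (simp add: ennreal_eq_0_iff)
qed

lemma E_HN_rel:
  assumes "(u, v) \<in> HN_rel \<mu> p"
  shows "E u = E v"
proof (rule E_cong_AE)
  show uv: "u \<in> N1p \<mu> p" "v \<in> N1p \<mu> p" using assms by (auto simp: HN_rel_iff)
  have "AE x in \<mu>. grad (\<lambda>x. u x - v x) x = grad u x - grad v x"
    using grad_lincomb[OF uv, of 1 "-1"] by simp
  moreover have "AE x in \<mu>. grad (\<lambda>x. u x - v x) x = 0"
    using assms by (intro grad_eq_0 N1p_diff) (auto simp: HN_rel_iff)
  ultimately show "AE x in \<mu>. grad u x = grad v x" by eventually_elim simp
qed

end

section \<open>Besov classes and their dual norm\<close>

lemma on_class_eq:
  assumes "equiv A r" "u \<in> A" "\<And>v. (u, v) \<in> r \<Longrightarrow> F v = F u"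
  shows "on_class F (r `` {u}) = F u"
proof -
  have "(u, u) \<in> r" using assms by (auto simp: equiv_def refl_on_def)
  moreover have "F v = F u" if "v \<in> r `` {u}" for v using that by (intro assms(3)) auto
  ultimately have "F ` (r `` {u}) = {F u}" by blast
  then show ?thesis by (simp add: on_class_def)
qed

text \<open>No measurability is assumed: the integrand of \<open>besov_energy\<close> need not be measurable here.\<close>

lemma nn_integral_cmult_pos:
  fixes f :: "'a \<Rightarrow> ennreal"
  assumes "0 < a"
  shows "(\<integral>\<^sup>+x. ennreal a * f x \<partial>M) = ennreal a * (\<integral>\<^sup>+x. f x \<partial>M)"
proof -
  have ge: "ennreal a * (\<integral>\<^sup>+x. f x \<partial>M) \<le> (\<integral>\<^sup>+x. ennreal a * f x \<partial>M)" if "0 < a" for a and f :: "'a \<Rightarrow> ennreal"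
  proof -
    have ne: "{g. simple_function M g \<and> g \<le> f} \<noteq> {}"
      by (auto intro!: exI[of _ "\<lambda>x. 0"] simp: le_fun_def)
    have "ennreal a * (\<integral>\<^sup>+x. f x \<partial>M) = (SUP g\<in>{g. simple_function M g \<and> g \<le> f}. ennreal a * integral\<^sup>S M g)"
      unfolding nn_integral_def by (rule SUP_mult_left_ennreal)
    also have "\<dots> \<le> (\<integral>\<^sup>+x. ennreal a * f x \<partial>M)"
    proof (rule SUP_least)
      fix g assume g: "g \<in> {g. simple_function M g \<and> g \<le> f}"
      have "ennreal a * integral\<^sup>S M g = integral\<^sup>S M (\<lambda>x. ennreal a * g x)"
        using g by (subst simple_integral_mult) auto
      also have "\<dots> = (\<integral>\<^sup>+x. ennreal a * g x \<partial>M)"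
        using g by (intro nn_integral_eq_simple_integral[symmetric]) auto
      also have "\<dots> \<le> (\<integral>\<^sup>+x. ennreal a * f x \<partial>M)"
        using g by (intro nn_integral_mono mult_left_mono) (auto simp: le_fun_def)
      finally show "ennreal a * integral\<^sup>S M g \<le> (\<integral>\<^sup>+x. ennreal a * f x \<partial>M)" .
    qed
    finally show ?thesis .
  qed
  \<comment> \<open>The reverse inequality is \<open>ge\<close> for the inverse factor, applied to
    \<open>ennreal a * f x\<close>.\<close>
  have cancel: "ennreal a * (ennreal (1 / a) * t) = t" "ennreal (1 / a) * (ennreal a * t) = t" for t
    using assms by (simp_all add: mult.assoc[symmetric] flip: ennreal_mult)
  have "(\<integral>\<^sup>+x. ennreal a * f x \<partial>M) = ennreal a * (ennreal (1 / a) * (\<integral>\<^sup>+x. ennreal a * f x \<partial>M))"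
    by (simp add: cancel)
  also have "\<dots> \<le> ennreal a * (\<integral>\<^sup>+x. ennreal (1 / a) * (ennreal a * f x) \<partial>M)"
    using assms by (intro mult_left_mono ge) auto
  also have "\<dots> = ennreal a * (\<integral>\<^sup>+x. f x \<partial>M)" by (simp add: cancel)
  finally show ?thesis using ge[OF assms] by (rule antisym)
qed

lemma besov_energy_cong_AE:
  assumes "AE x in \<nu>. f x = g x + t"
  shows "besov_energy \<nu> p \<theta> f = besov_energy \<nu> p \<theta> g"
  unfolding besov_energy_def
proof (intro nn_integral_cong_AE, use assms in eventually_elim)
  case (elim y)
  show ?case
  proof (intro nn_integral_cong_AE, use assms in eventually_elim)
    case (elim x)
    have "f y - f x = g y - g x" using \<open>f y = g y + t\<close> elim by simp
    then show ?case by simp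
  qed
qed

lemma besov_energy_cmult:
  assumes "a \<noteq> 0"
  shows "besov_energy \<nu> p \<theta> (\<lambda>x. a * f x) = ennreal (\<bar>a\<bar> powr p) * besov_energy \<nu> p \<theta> f"
proof -
  have pos: "0 < \<bar>a\<bar> powr p" using assms by simp
  have "\<bar>a * f y - a * f x\<bar> = \<bar>a\<bar> * \<bar>f y - f x\<bar>" for x y
    by (simp flip: abs_mult right_diff_distrib)
  then have "ennreal (\<bar>a * f y - a * f x\<bar> powr p) / q = ennreal (\<bar>a\<bar> powr p) * (ennreal (\<bar>f y - f x\<bar> powr p) / q)" for x y q
    by (simp add: powr_mult ennreal_mult ennreal_times_divide)
  then show ?thesis
    unfolding besov_energy_def by (simp add: nn_integral_cmult_pos[OF pos])
qed

lemma equiv_HB_rel: "equiv (Besov \<nu> p \<theta>) (HB_rel \<nu> p \<theta>)"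
proof (rule equivI)
  show "HB_rel \<nu> p \<theta> \<subseteq> Besov \<nu> p \<theta> \<times> Besov \<nu> p \<theta>" by (auto simp: HB_rel_def)
  show "refl_on (Besov \<nu> p \<theta>) (HB_rel \<nu> p \<theta>)" by (auto simp: refl_on_def HB_rel_def)
  show "sym (HB_rel \<nu> p \<theta>)"
  proof (rule symI)
    fix f g assume "(f, g) \<in> HB_rel \<nu> p \<theta>"
    then obtain t where fg: "f \<in> Besov \<nu> p \<theta>" "g \<in> Besov \<nu> p \<theta>" "AE x in \<nu>. f x - g x = t"
      by (auto simp: HB_rel_def)
    from fg(3) have "AE x in \<nu>. g x - f x = - t" by eventually_elim simp
    then show "(g, f) \<in> HB_rel \<nu> p \<theta>" using fg by (auto simp: HB_rel_def)
  qed
  show "trans (HB_rel \<nu> p \<theta>)"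
  proof (rule transI)
    fix f g h assume "(f, g) \<in> HB_rel \<nu> p \<theta>" "(g, h) \<in> HB_rel \<nu> p \<theta>"
    then obtain s t where fgh: "f \<in> Besov \<nu> p \<theta>" "h \<in> Besov \<nu> p \<theta>"
      "AE x in \<nu>. f x - g x = s" "AE x in \<nu>. g x - h x = t"
      by (auto simp: HB_rel_def)
    from fgh(3,4) have "AE x in \<nu>. f x - h x = s + t" by eventually_elim simp
    then show "(f, h) \<in> HB_rel \<nu> p \<theta>" using fgh by (auto simp: HB_rel_def)
  qed
qed

lemma HB_class_eqI:
  assumes "f \<in> Besov \<nu> p \<theta>" "g \<in> Besov \<nu> p \<theta>" "AE x in \<nu>. f x = g x + t"
  shows "HB_class \<nu> p \<theta> f = HB_class \<nu> p \<theta> g"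
proof -
  have "AE x in \<nu>. f x - g x = t" using assms(3) by eventually_elim simp
  then have "(f, g) \<in> HB_rel \<nu> p \<theta>" using assms by (auto simp: HB_rel_def)
  then show ?thesis unfolding HB_class_def by (rule equiv_class_eq[OF equiv_HB_rel])
qed

lemma HB_iff: "F \<in> HB \<nu> p \<theta> \<longleftrightarrow> (\<exists>f\<in>Besov \<nu> p \<theta>. F = HB_class \<nu> p \<theta> f)"
  by (auto simp: HB_def HB_class_def quotient_def)

lemma HB_norm_class:
  assumes "f \<in> Besov \<nu> p \<theta>"
  shows "HB_norm \<nu> p \<theta> (HB_class \<nu> p \<theta> f) = besov_norm \<nu> p \<theta> f"
  unfolding HB_norm_def HB_class_def
proof (rule on_class_eq[OF equiv_HB_rel assms])
  fix g assume "(f, g) \<in> HB_rel \<nu> p \<theta>"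
  then obtain t where "AE x in \<nu>. f x - g x = t" by (auto simp: HB_rel_def)
  then have "AE x in \<nu>. f x = g x + t" by eventually_elim simp
  then have "besov_energy \<nu> p \<theta> f = besov_energy \<nu> p \<theta> g" by (rule besov_energy_cong_AE)
  then show "besov_norm \<nu> p \<theta> g = besov_norm \<nu> p \<theta> f" by (simp add: besov_norm_def)
qed

lemma besov_norm_nonneg: "0 \<le> besov_norm \<nu> p \<theta> f"
  by (simp add: besov_norm_def)

lemma besov_cmult:
  assumes f: "f \<in> Besov \<nu> p \<theta>" and a: "a \<noteq> 0" and p: "0 < p"
  shows "(\<lambda>x. a * f x) \<in> Besov \<nu> p \<theta>"
    and "besov_norm \<nu> p \<theta> (\<lambda>x. a * f x) = \<bar>a\<bar> * besov_norm \<nu> p \<theta> f"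
proof -
  show "(\<lambda>x. a * f x) \<in> Besov \<nu> p \<theta>"
    using f a by (auto simp: Besov_def besov_energy_cmult ennreal_mult_less_top)
  show "besov_norm \<nu> p \<theta> (\<lambda>x. a * f x) = \<bar>a\<bar> * besov_norm \<nu> p \<theta> f"
    using a p by (simp add: besov_norm_def besov_energy_cmult enn2real_mult powr_mult powr_powr)
qed

text \<open>Membership in the dual provides some bounding constant, and with it the real
  \<open>Sup\<close> in \<open>HB_dual_norm\<close> is over a bounded set. The absolute value guards
  against a negative constant.\<close>

lemma HB_dual_bdd_above:
  assumes L: "L \<in> HB_dual \<nu> p \<theta>"
  shows "\<exists>C. \<forall>f\<in>Besov \<nu> p \<theta>. \<bar>L (HB_class \<nu> p \<theta> f)\<bar> \<le> C * besov_norm \<nu> p \<theta> f"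
    and "bdd_above {\<bar>L F\<bar> |F. F \<in> HB \<nu> p \<theta> \<and> HB_norm \<nu> p \<theta> F \<le> 1}"
proof -
  obtain C where "\<forall>F\<in>HB \<nu> p \<theta>. \<bar>L F\<bar> \<le> C * HB_norm \<nu> p \<theta> F"
    using L unfolding HB_dual_def by blast
  then have C: "\<And>F. F \<in> HB \<nu> p \<theta> \<Longrightarrow> \<bar>L F\<bar> \<le> C * HB_norm \<nu> p \<theta> F" by blast
  have C': "\<bar>L (HB_class \<nu> p \<theta> f)\<bar> \<le> \<bar>C\<bar> * besov_norm \<nu> p \<theta> f" if "f \<in> Besov \<nu> p \<theta>" for f
  proof -
    have "\<bar>L (HB_class \<nu> p \<theta> f)\<bar> \<le> C * besov_norm \<nu> p \<theta> f"
      using C[of "HB_class \<nu> p \<theta> f"] that by (auto simp: HB_iff HB_norm_class)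
    also have "\<dots> \<le> \<bar>C\<bar> * besov_norm \<nu> p \<theta> f" by (intro mult_right_mono besov_norm_nonneg) auto
    finally show ?thesis .
  qed
  then show "\<exists>C. \<forall>f\<in>Besov \<nu> p \<theta>. \<bar>L (HB_class \<nu> p \<theta> f)\<bar> \<le> C * besov_norm \<nu> p \<theta> f" by blast
  show "bdd_above {\<bar>L F\<bar> |F. F \<in> HB \<nu> p \<theta> \<and> HB_norm \<nu> p \<theta> F \<le> 1}"
  proof (rule bdd_aboveI, safe)
    fix F assume "F \<in> HB \<nu> p \<theta>" "HB_norm \<nu> p \<theta> F \<le> 1"
    then obtain f where f: "f \<in> Besov \<nu> p \<theta>" "F = HB_class \<nu> p \<theta> f" "besov_norm \<nu> p \<theta> f \<le> 1"
      by (auto simp: HB_iff HB_norm_class)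
    have "\<bar>C\<bar> * besov_norm \<nu> p \<theta> f \<le> \<bar>C\<bar> * 1" using f by (intro mult_left_mono) auto
    then show "\<bar>L F\<bar> \<le> \<bar>C\<bar>" using C'[OF f(1)] f(2) by simp
  qed
qed

lemma HB_dual_norm_nonneg:
  assumes L: "L \<in> HB_dual \<nu> p \<theta>"
  shows "0 \<le> HB_dual_norm \<nu> p \<theta> L"
proof -
  have zero: "(\<lambda>x. 0) \<in> Besov \<nu> p \<theta>" "besov_norm \<nu> p \<theta> (\<lambda>x. 0) = 0"
    by (simp_all add: Besov_def besov_norm_def besov_energy_def)
  have "bdd_above {\<bar>L F\<bar> |F. F \<in> HB \<nu> p \<theta> \<and> HB_norm \<nu> p \<theta> F \<le> 1}"
    by (rule HB_dual_bdd_above(2)[OF L])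
  moreover have "HB_class \<nu> p \<theta> (\<lambda>x. 0) \<in> HB \<nu> p \<theta> \<and> HB_norm \<nu> p \<theta> (HB_class \<nu> p \<theta> (\<lambda>x. 0)) \<le> 1"
    using zero by (auto simp: HB_iff HB_norm_class)
  ultimately have "\<bar>L (HB_class \<nu> p \<theta> (\<lambda>x. 0))\<bar> \<le> HB_dual_norm \<nu> p \<theta> L"
    unfolding HB_dual_norm_def by (intro cSup_upper) blast+
  then show ?thesis by linarith
qed

text \<open>By scaling to norm one. A function of norm zero cannot be scaled; for it the bounding
  constant of the dual forces the value of \<open>L\<close> to vanish.\<close>

lemma HB_dual_bound:
  assumes L: "L \<in> HB_dual \<nu> p \<theta>" and f: "f \<in> Besov \<nu> p \<theta>" and p: "0 < p"
  shows "\<bar>L (HB_class \<nu> p \<theta> f)\<bar> \<le> HB_dual_norm \<nu> p \<theta> L * besov_norm \<nu> p \<theta> f"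
proof -
  obtain C where C': "\<And>f. f \<in> Besov \<nu> p \<theta> \<Longrightarrow> \<bar>L (HB_class \<nu> p \<theta> f)\<bar> \<le> C * besov_norm \<nu> p \<theta> f"
    using HB_dual_bdd_above(1)[OF L] by blast
  note bdd = HB_dual_bdd_above(2)[OF L]
  show ?thesis
  proof (cases "besov_norm \<nu> p \<theta> f = 0")
    case True
    then show ?thesis using C'[OF f] by simp
  next
    case False
    define s where "s = besov_norm \<nu> p \<theta> f"
    have s: "0 < s" using False besov_norm_nonneg[of \<nu> p \<theta> f] by (simp add: s_def)
    let ?g = "\<lambda>x. 1 / s * f x"
    have g: "?g \<in> Besov \<nu> p \<theta>" "besov_norm \<nu> p \<theta> ?g = 1"
      using besov_cmult[OF f _ p, of "1 / s"] s by (auto simp: s_def)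
    \<comment> \<open>Homogeneity, read off from linearity with 0 as second coefficient.\<close>
    have "L (HB_class \<nu> p \<theta> (\<lambda>x. 1 / s * f x + 0 * f x)) = 1 / s * L (HB_class \<nu> p \<theta> f) + 0 * L (HB_class \<nu> p \<theta> f)"
      using L f unfolding HB_dual_def by blast
    then have eq: "L (HB_class \<nu> p \<theta> ?g) = L (HB_class \<nu> p \<theta> f) / s" by simp
    have "HB_class \<nu> p \<theta> ?g \<in> HB \<nu> p \<theta> \<and> HB_norm \<nu> p \<theta> (HB_class \<nu> p \<theta> ?g) \<le> 1"
      using g by (auto simp: HB_iff HB_norm_class)
    then have "\<bar>L (HB_class \<nu> p \<theta> ?g)\<bar> \<le> HB_dual_norm \<nu> p \<theta> L"
      unfolding HB_dual_norm_def by (intro cSup_upper bdd) blast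
    then have "\<bar>L (HB_class \<nu> p \<theta> f) / s\<bar> \<le> HB_dual_norm \<nu> p \<theta> L" unfolding eq .
    then show ?thesis using s by (simp add: s_def[symmetric] field_simps)
  qed
qed

section \<open>The trace on the quotient space and its norm\<close>

locale trace_space = cheeger_space +
  fixes \<nu> :: "'a measure" and \<theta> :: real and Tr :: "('a \<Rightarrow> real) \<Rightarrow> 'a \<Rightarrow> real" and T :: real
  assumes boundary: "space \<nu> \<subseteq> closure (space \<mu>)"
    and Tr_Besov: "\<And>u. u \<in> N1p \<mu> p \<Longrightarrow> Tr u \<in> Besov \<nu> p \<theta>"
    and Tr_limit: "\<And>u. u \<in> N1p \<mu> p \<Longrightarrow> AE \<xi> in \<nu>.
        ((\<lambda>r. (\<integral>\<^sup>+x\<in>ball \<xi> r \<inter> space \<mu>. ennreal \<bar>u x - Tr u \<xi>\<bar> \<partial>\<mu>)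
                / emeasure \<mu> (ball \<xi> r \<inter> space \<mu>)) \<longlongrightarrow> 0) (at_right 0)"
    and Tr_lincomb: "\<And>u v a b. u \<in> N1p \<mu> p \<Longrightarrow> v \<in> N1p \<mu> p \<Longrightarrow> AE \<xi> in \<nu>.
        Tr (\<lambda>x. a * u x + b * v x) \<xi> = a * Tr u \<xi> + b * Tr v \<xi>"
    and Tr_bounded: "\<And>u. u \<in> N1p \<mu> p \<Longrightarrow> ennreal (besov_norm \<nu> p \<theta> (Tr u)) \<le> ennreal T * N1p_norm \<mu> p u"
begin

text \<open>Positivity is assumed for balls centred in \<Omega>; a ball centred in the closure
  contains one of these.\<close>

lemma emeasure_boundary_ball_pos:
  assumes "\<xi> \<in> closure \<Omega>" "0 < r"
  shows "0 < emeasure \<mu> (ball \<xi> r \<inter> \<Omega>)"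
proof -
  obtain x where x: "x \<in> \<Omega>" "dist x \<xi> < r / 2"
    using assms closure_approachable[of \<xi> \<Omega>] by (metis half_gt_zero)
  have "ball x (r / 2) \<inter> \<Omega> \<subseteq> ball \<xi> r \<inter> \<Omega>"
  proof
    fix y assume y: "y \<in> ball x (r / 2) \<inter> \<Omega>"
    have "dist \<xi> y \<le> dist x \<xi> + dist x y" by (metis dist_commute dist_triangle)
    then show "y \<in> ball \<xi> r \<inter> \<Omega>" using x y by simp
  qed
  then have "emeasure \<mu> (ball x (r / 2) \<inter> \<Omega>) \<le> emeasure \<mu> (ball \<xi> r \<inter> \<Omega>)"
    by (intro emeasure_mono open_Int_space_in_sets) auto
  then show ?thesis using pos[OF x(1), of "r / 2"] assms(2) by simp
qed

text \<open>On a small ball about \<xi> the constant \<open>Tr u \<xi> - Tr v \<xi> - t\<close> is,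
  up to sign and a null set, the difference of two deviations from the traces, and both have means
  tending to 0. Hence the trace, although given on functions, respects null sets and added
  constants.\<close>

lemma Tr_add_const_AE:
  assumes u: "u \<in> N1p \<mu> p" and v: "v \<in> N1p \<mu> p" and ae: "AE x in \<mu>. u x = v x + t"
  shows "AE \<xi> in \<nu>. Tr u \<xi> = Tr v \<xi> + t"
  using Tr_limit[OF u] Tr_limit[OF v] AE_space
proof eventually_elim
  case (elim \<xi>)
  note [measurable] = N1pD(1)[OF u] N1pD(1)[OF v]
  define q where "q w r = (\<integral>\<^sup>+x\<in>ball \<xi> r \<inter> \<Omega>. ennreal \<bar>w x - Tr w \<xi>\<bar> \<partial>\<mu>) / emeasure \<mu> (ball \<xi> r \<inter> \<Omega>)" for w r
  let ?a = "ennreal \<bar>Tr u \<xi> - Tr v \<xi> - t\<bar>"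
  have "?a \<le> q u r + q v r" if r: "0 < r" for r
  proof -
    let ?B = "ball \<xi> r \<inter> \<Omega>"
    have [measurable]: "?B \<in> sets \<mu>" by (intro open_Int_space_in_sets) simp
    have m: "0 < emeasure \<mu> ?B" "emeasure \<mu> ?B < top"
      using emeasure_boundary_ball_pos[of \<xi> r] boundary elim(3) r by (auto simp: less_top[symmetric])
    have "?a * emeasure \<mu> ?B = (\<integral>\<^sup>+x\<in>?B. ?a \<partial>\<mu>)"
      by (subst nn_integral_cmult_indicator) auto
    also have "\<dots> \<le> (\<integral>\<^sup>+x. ennreal \<bar>u x - Tr u \<xi>\<bar> * indicator ?B x + ennreal \<bar>v x - Tr v \<xi>\<bar> * indicator ?B x \<partial>\<mu>)"
    proof (intro nn_integral_mono_AE, use ae in eventually_elim)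
      case (elim x)
      have "?a \<le> ennreal (\<bar>u x - Tr u \<xi>\<bar> + \<bar>v x - Tr v \<xi>\<bar>)"
        using elim by (intro ennreal_leI) linarith
      then show ?case by (simp add: indicator_def)
    qed
    also have "\<dots> = (\<integral>\<^sup>+x\<in>?B. ennreal \<bar>u x - Tr u \<xi>\<bar> \<partial>\<mu>) + (\<integral>\<^sup>+x\<in>?B. ennreal \<bar>v x - Tr v \<xi>\<bar> \<partial>\<mu>)"
      by (intro nn_integral_add) auto
    finally have "?a * emeasure \<mu> ?B / emeasure \<mu> ?B \<le> q u r + q v r"
      unfolding q_def add_divide_distrib_ennreal[symmetric] by (rule divide_right_mono_ennreal)
    then show ?thesis using m by (simp add: ennreal_mult_divide_eq)
  qed
  then have "eventually (\<lambda>r. ?a \<le> q u r + q v r) (at_right 0)"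
    by (auto simp: eventually_at_filter)
  moreover have "((\<lambda>r. q u r + q v r) \<longlongrightarrow> 0 + 0) (at_right 0)"
    using elim(1,2) unfolding q_def by (rule tendsto_add)
  ultimately have "?a \<le> 0 + 0" by (intro tendsto_lowerbound) auto
  then show ?case by (simp add: ennreal_eq_0_iff)
qed

text \<open>A preliminary bound: it shows that the supremum \<open>Tr_norm\<close> is over a bounded
  set and settles functions of zero energy.\<close>

definition trace_const where "trace_const = \<bar>T\<bar> * (energy_const powr (1 / p) + C)"

lemma trace_const_nonneg: "0 \<le> trace_const"
  using C by (simp add: trace_const_def)

lemma besov_norm_Tr_le:
  assumes u: "u \<in> N1p \<mu> p"
  shows "besov_norm \<nu> p \<theta> (Tr u) \<le> trace_const * E u powr (1 / p)"
proof -
  let ?v = "\<lambda>x. u x - mean u"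
  have v: "?v \<in> N1p \<mu> p" using u by (rule N1p_minus_const)
  have "AE \<xi> in \<nu>. Tr u \<xi> = Tr ?v \<xi> + mean u" using u v by (rule Tr_add_const_AE) simp
  then have "ennreal (besov_norm \<nu> p \<theta> (Tr u)) = ennreal (besov_norm \<nu> p \<theta> (Tr ?v))"
    by (simp add: besov_norm_def besov_energy_cong_AE)
  also have "\<dots> \<le> ennreal T * N1p_norm \<mu> p ?v" by (rule Tr_bounded[OF v])
  also have "\<dots> \<le> ennreal \<bar>T\<bar> * ennreal ((energy_const powr (1 / p) + C) * E u powr (1 / p))"
    by (intro mult_mono N1p_norm_centered_le u ennreal_leI) auto
  also have "\<dots> = ennreal (trace_const * E u powr (1 / p))"
    using C by (simp add: trace_const_def mult.assoc flip: ennreal_mult)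
  finally show ?thesis using trace_const_nonneg by (simp add: ennreal_le_iff)
qed

abbreviation cls :: "('a \<Rightarrow> real) \<Rightarrow> ('a \<Rightarrow> real) set" where "cls u \<equiv> HN_rel \<mu> p `` {u}"

lemma HN_iff: "U \<in> HN \<mu> p \<longleftrightarrow> (\<exists>u\<in>N1p \<mu> p. U = cls u)"
  by (auto simp: HN_def quotient_def)

lemma cheeger_energy_cls: "u \<in> N1p \<mu> p \<Longrightarrow> cheeger_energy \<mu> p ip grad (cls u) = E u"
  unfolding cheeger_energy_def E_def[symmetric]
  by (rule on_class_eq[OF equiv_HN_rel]) (auto dest: E_HN_rel)

lemma Tr_HN_cls:
  assumes u: "u \<in> N1p \<mu> p"
  shows "Tr_HN \<nu> p \<theta> Tr (cls u) = HB_class \<nu> p \<theta> (Tr u)"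
  unfolding Tr_HN_def
proof (rule on_class_eq[OF equiv_HN_rel u])
  fix v assume uv: "(u, v) \<in> HN_rel \<mu> p"
  then have v: "v \<in> N1p \<mu> p" by (simp add: HN_rel_iff)
  obtain t where "AE x in \<mu>. u x = v x + t" using uv by (rule HN_rel_AE)
  then have "AE \<xi> in \<nu>. Tr u \<xi> = Tr v \<xi> + t" by (rule Tr_add_const_AE[OF u v])
  then show "HB_class \<nu> p \<theta> (Tr v) = HB_class \<nu> p \<theta> (Tr u)"
    using HB_class_eqI[OF Tr_Besov[OF u] Tr_Besov[OF v]] by simp
qed

lemma HB_norm_Tr: "u \<in> N1p \<mu> p \<Longrightarrow> HB_norm \<nu> p \<theta> (Tr_HN \<nu> p \<theta> Tr (cls u)) = besov_norm \<nu> p \<theta> (Tr u)"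
  by (simp add: Tr_HN_cls HB_norm_class Tr_Besov)

abbreviation "TrN \<equiv> Tr_norm \<mu> \<nu> p \<theta> ip grad Tr"

lemma bdd_above_Tr_norm:
  "bdd_above {HB_norm \<nu> p \<theta> (Tr_HN \<nu> p \<theta> Tr U) |U.
            U \<in> HN \<mu> p \<and> cheeger_energy \<mu> p ip grad U powr (1 / p) \<le> 1}"
proof (rule bdd_aboveI, safe)
  fix U assume U: "U \<in> HN \<mu> p" "cheeger_energy \<mu> p ip grad U powr (1 / p) \<le> 1"
  then obtain u where u: "u \<in> N1p \<mu> p" "U = cls u" by (auto simp: HN_iff)
  have "besov_norm \<nu> p \<theta> (Tr u) \<le> trace_const * E u powr (1 / p)" by (rule besov_norm_Tr_le[OF u(1)])
  also have "\<dots> \<le> trace_const * 1"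
    using U(2) u trace_const_nonneg by (intro mult_left_mono) (auto simp: cheeger_energy_cls)
  finally show "HB_norm \<nu> p \<theta> (Tr_HN \<nu> p \<theta> Tr U) \<le> trace_const"
    using u by (simp add: HB_norm_Tr)
qed

lemma Tr_norm_ge:
  assumes "u \<in> N1p \<mu> p" "E u \<le> 1"
  shows "besov_norm \<nu> p \<theta> (Tr u) \<le> TrN"
proof -
  have "E u powr (1 / p) \<le> 1" using assms(2) E_nonneg[of u] p_pos by (intro powr_le1) auto
  then have "\<exists>U. HB_norm \<nu> p \<theta> (Tr_HN \<nu> p \<theta> Tr (cls u)) = HB_norm \<nu> p \<theta> (Tr_HN \<nu> p \<theta> Tr U) \<and>
      U \<in> HN \<mu> p \<and> cheeger_energy \<mu> p ip grad U powr (1 / p) \<le> 1"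
    using assms(1) by (intro exI[of _ "cls u"]) (auto simp: HN_iff cheeger_energy_cls)
  then have "HB_norm \<nu> p \<theta> (Tr_HN \<nu> p \<theta> Tr (cls u)) \<le> TrN"
    unfolding Tr_norm_def by (intro cSup_upper bdd_above_Tr_norm) simp
  then show ?thesis by (simp add: HB_norm_Tr assms(1))
qed

lemma Tr_norm_nonneg: "0 \<le> TrN"
  using Tr_norm_ge[OF N1p_const, of 0] besov_norm_nonneg[of \<nu> p \<theta> "Tr (\<lambda>x. 0)"] by (simp add: E_const)

text \<open>By scaling to energy one; zero energy, where this fails, is covered by the preliminary
  bound.\<close>

lemma besov_norm_Tr_le_norm:
  assumes u: "u \<in> N1p \<mu> p"
  shows "besov_norm \<nu> p \<theta> (Tr u) \<le> TrN * E u powr (1 / p)"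
proof (cases "E u = 0")
  case True
  then show ?thesis using besov_norm_Tr_le[OF u] by simp
next
  case False
  define s where "s = E u powr (1 / p)"
  have Eu: "0 < E u" using False E_nonneg[of u] by simp
  then have s: "0 < s" by (simp add: s_def)
  let ?v = "\<lambda>x. 1 / s * u x"
  have v: "?v \<in> N1p \<mu> p" using u by (rule N1p_cmult)
  have "E ?v = (1 / s) powr p * E u" using E_affine[OF u, of "1 / s" 0] s by simp
  also have "\<dots> = 1" using Eu p_pos by (simp add: s_def powr_divide powr_powr)
  finally have "besov_norm \<nu> p \<theta> (Tr ?v) \<le> TrN" using v by (intro Tr_norm_ge) auto
  moreover have "AE \<xi> in \<nu>. Tr ?v \<xi> = 1 / s * Tr u \<xi> + 0"
    using Tr_lincomb[OF u u, of "1 / s" 0] by simp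
  then have "besov_norm \<nu> p \<theta> (Tr ?v) = besov_norm \<nu> p \<theta> (\<lambda>\<xi>. 1 / s * Tr u \<xi>)"
    unfolding besov_norm_def by (simp only: besov_energy_cong_AE)
  then have "besov_norm \<nu> p \<theta> (Tr ?v) = besov_norm \<nu> p \<theta> (Tr u) / s"
    using besov_cmult(2)[OF Tr_Besov[OF u] _ p_pos, of "1 / s"] s by simp
  ultimately have "besov_norm \<nu> p \<theta> (Tr u) / s \<le> TrN" by (simp only:)
  then show ?thesis using s by (simp add: s_def[symmetric] field_simps)
qed

text \<open>The trace is linear only almost everywhere, so the identity lives on classes. The
  combination of traces is in the Besov space because it has the same Besov energy as the trace of
  the combination.\<close>

lemma functional_lincomb:
  assumes L: "L \<in> HB_dual \<nu> p \<theta>" and u: "u \<in> N1p \<mu> p" and v: "v \<in> N1p \<mu> p"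
  shows "L (HB_class \<nu> p \<theta> (Tr (\<lambda>x. a * u x + b * v x))) =
    a * L (HB_class \<nu> p \<theta> (Tr u)) + b * L (HB_class \<nu> p \<theta> (Tr v))"
proof -
  let ?w = "\<lambda>x. a * u x + b * v x" and ?f = "\<lambda>\<xi>. a * Tr u \<xi> + b * Tr v \<xi>"
  have w: "?w \<in> N1p \<mu> p" using N1p_lincomb[OF u v, of a b 0] by simp
  have ae: "AE \<xi> in \<nu>. Tr ?w \<xi> = ?f \<xi> + 0" using Tr_lincomb[OF u v, of a b] by simp
  have "?f \<in> borel_measurable \<nu>" using Tr_Besov[OF u] Tr_Besov[OF v] by (auto simp: Besov_def)
  moreover have "besov_energy \<nu> p \<theta> ?f = besov_energy \<nu> p \<theta> (Tr ?w)"
    using besov_energy_cong_AE[OF ae] by (rule sym)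
  ultimately have "?f \<in> Besov \<nu> p \<theta>" using Tr_Besov[OF w] by (simp add: Besov_def)
  then have "HB_class \<nu> p \<theta> (Tr ?w) = HB_class \<nu> p \<theta> ?f"
    by (rule HB_class_eqI[OF Tr_Besov[OF w] _ ae])
  then show ?thesis using L Tr_Besov[OF u] Tr_Besov[OF v] unfolding HB_dual_def by simp
qed

lemma functional_bound:
  assumes L: "L \<in> HB_dual \<nu> p \<theta>" and u: "u \<in> N1p \<mu> p"
  shows "\<bar>L (HB_class \<nu> p \<theta> (Tr u))\<bar> \<le> HB_dual_norm \<nu> p \<theta> L * TrN * E u powr (1 / p)"
proof -
  have "\<bar>L (HB_class \<nu> p \<theta> (Tr u))\<bar> \<le> HB_dual_norm \<nu> p \<theta> L * besov_norm \<nu> p \<theta> (Tr u)"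
    by (rule HB_dual_bound[OF L Tr_Besov[OF u] p_pos])
  also have "\<dots> \<le> HB_dual_norm \<nu> p \<theta> L * (TrN * E u powr (1 / p))"
    by (intro mult_left_mono besov_norm_Tr_le_norm u HB_dual_norm_nonneg L)
  finally show ?thesis by (simp add: mult.assoc)
qed

section \<open>Solutions of the Neumann problem and their traces\<close>

lemma neumann_solution_cls:
  assumes "u \<in> N1p \<mu> p"
  shows "neumann_solution \<mu> \<nu> p \<theta> ip grad Tr L (cls u) \<longleftrightarrow>
    (\<forall>v\<in>N1p \<mu> p. E u / p - L (HB_class \<nu> p \<theta> (Tr u)) \<le> E v / p - L (HB_class \<nu> p \<theta> (Tr v)))"
proof -
  have "HN \<mu> p = cls ` N1p \<mu> p" by (auto simp: HN_iff)
  then have "(\<forall>V\<in>HN \<mu> p. P V) \<longleftrightarrow> (\<forall>v\<in>N1p \<mu> p. P (cls v))" for P by simp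
  moreover have "cls u \<in> HN \<mu> p" using assms by (auto simp: HN_iff)
  ultimately show ?thesis
    using assms unfolding neumann_solution_def by (simp add: cheeger_energy_cls Tr_HN_cls)
qed

lemma neumann_solution_unique:
  assumes L: "L \<in> HB_dual \<nu> p \<theta>"
  shows "\<exists>!U. neumann_solution \<mu> \<nu> p \<theta> ip grad Tr L U"
proof (rule ex_ex1I)
  let ?l = "\<lambda>u. L (HB_class \<nu> p \<theta> (Tr u))"
  have "\<exists>u\<in>N1p \<mu> p. \<forall>v\<in>N1p \<mu> p. E u / p - ?l u \<le> E v / p - ?l v"
    by (rule minimizer_exists[OF functional_lincomb[OF L] functional_bound[OF L]])
      (auto simp: Tr_norm_nonneg HB_dual_norm_nonneg L)
  then show "\<exists>U. neumann_solution \<mu> \<nu> p \<theta> ip grad Tr L U" using neumann_solution_cls by blast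
  fix U V assume UV: "neumann_solution \<mu> \<nu> p \<theta> ip grad Tr L U" "neumann_solution \<mu> \<nu> p \<theta> ip grad Tr L V"
  then obtain u v where uv: "u \<in> N1p \<mu> p" "U = cls u" "v \<in> N1p \<mu> p" "V = cls v"
    unfolding neumann_solution_def HN_iff by blast
  have min: "\<forall>w\<in>N1p \<mu> p. E u / p - ?l u \<le> E w / p - ?l w" "\<forall>w\<in>N1p \<mu> p. E v / p - ?l v \<le> E w / p - ?l w"
    using UV uv by (simp_all add: neumann_solution_cls)
  have "E (\<lambda>x. u x - v x) = 0"
    by (rule minimizer_unique[where l = ?l, OF functional_lincomb[OF L] uv(1,3)])
      (use min in blast)+
  then have "(u, v) \<in> HN_rel \<mu> p" using uv by (simp add: HN_rel_iff)
  then show "U = V" unfolding uv by (rule equiv_class_eq[OF equiv_HN_rel])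
qed

text \<open>The norm of \<open>L\<close> is kept as a parameter: the estimate grows with its power
  \<open>1 / (p - 1)\<close>, and so bounds the map on every ball of the dual as well as on the unit
  sphere.\<close>

lemma NtD_bound:
  assumes L: "L \<in> HB_dual \<nu> p \<theta>"
  shows "NtD \<mu> \<nu> p \<theta> ip grad Tr L \<in> HB \<nu> p \<theta>"
    and "HB_norm \<nu> p \<theta> (NtD \<mu> \<nu> p \<theta> ip grad Tr L)
      \<le> TrN * (p * (HB_dual_norm \<nu> p \<theta> L * TrN)) powr (1 / (p - 1))"
proof -
  have "neumann_solution \<mu> \<nu> p \<theta> ip grad Tr L (THE U. neumann_solution \<mu> \<nu> p \<theta> ip grad Tr L U)"
    by (rule theI'[OF neumann_solution_unique[OF L]])
  moreover from this obtain u where u: "u \<in> N1p \<mu> p"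
    and eq: "(THE U. neumann_solution \<mu> \<nu> p \<theta> ip grad Tr L U) = cls u"
    unfolding neumann_solution_def HN_iff by blast
  ultimately have min: "E u / p - L (HB_class \<nu> p \<theta> (Tr u)) \<le> E v / p - L (HB_class \<nu> p \<theta> (Tr v))"
    if "v \<in> N1p \<mu> p" for v using that by (simp add: neumann_solution_cls)
  have NtD: "NtD \<mu> \<nu> p \<theta> ip grad Tr L = HB_class \<nu> p \<theta> (Tr u)"
    by (simp add: NtD_def eq Tr_HN_cls u)
  then show "NtD \<mu> \<nu> p \<theta> ip grad Tr L \<in> HB \<nu> p \<theta>" using Tr_Besov[OF u] by (auto simp: HB_iff)
  define A where "A = HB_dual_norm \<nu> p \<theta> L * TrN"
  have A: "0 \<le> A" using Tr_norm_nonneg HB_dual_norm_nonneg[OF L] by (simp add: A_def)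
  define x where "x = E u powr (1 / p)"
  have x: "0 \<le> x" "E u = x powr p" using E_nonneg p_pos by (simp_all add: x_def powr_powr)
  have "L (HB_class \<nu> p \<theta> (Tr (\<lambda>x. 0))) = 0"
    using functional_lincomb[OF L u u, of 0 0] by simp
  then have "E u / p \<le> L (HB_class \<nu> p \<theta> (Tr u))"
    using min[OF N1p_const, of 0] by (simp add: E_const)
  also have "\<dots> \<le> A * x" using functional_bound[OF L u] by (auto simp: A_def x_def)
  finally have "x powr p \<le> p * A * x" using p_pos by (simp add: x field_simps)
  have "x \<le> (p * A) powr (1 / (p - 1))"
  proof (cases "x = 0")
    case False
    then have x0: "0 < x" using x by simp
    have "x powr p = x powr (p - 1) * x" using powr_add[of x "p - 1" 1] x0 by simp
    then have "x powr (p - 1) \<le> p * A" using \<open>x powr p \<le> p * A * x\<close> x0 by simp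
    then have "(x powr (p - 1)) powr (1 / (p - 1)) \<le> (p * A) powr (1 / (p - 1))"
      using p_gt_1 by (intro powr_mono2) auto
    then show ?thesis using x0 p_gt_1 by (simp add: powr_powr)
  qed simp
  then have "TrN * x \<le> TrN * (p * A) powr (1 / (p - 1))"
    using Tr_norm_nonneg by (rule mult_left_mono)
  then show "HB_norm \<nu> p \<theta> (NtD \<mu> \<nu> p \<theta> ip grad Tr L) \<le> TrN * (p * (HB_dual_norm \<nu> p \<theta> L * TrN)) powr (1 / (p - 1))"
    using besov_norm_Tr_le_norm[OF u] by (simp add: NtD HB_norm_class Tr_Besov[OF u] x_def A_def)
qed

end

text \<open>The exponents match by \<open>p / (p - 1) = 1 + 1 / (p - 1)\<close>; enlarging
  \<open>p\<close> to \<open>2 * p\<close> and adding a nonnegative term reaches the stated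
  constant.\<close>

lemma powr_Neumann_bound:
  fixes p t :: real
  assumes "1 < p" "0 \<le> t"
  shows "t * (p * t) powr (1 / (p - 1))
    \<le> ((2 * p) powr (1 / (p - 1)) + 2 * (p - 1) / p) * t powr (p / (p - 1))"
proof (cases "t = 0")
  case False
  then have t: "0 < t" using assms by simp
  have exp: "p / (p - 1) = 1 + 1 / (p - 1)" using assms by (simp add: field_simps)
  have "t * (p * t) powr (1 / (p - 1)) = p powr (1 / (p - 1)) * (t * t powr (1 / (p - 1)))"
    using assms t by (simp add: powr_mult)
  also have "t * t powr (1 / (p - 1)) = t powr (p / (p - 1))"
    unfolding exp using t by (simp add: powr_add)
  also have "p powr (1 / (p - 1)) * t powr (p / (p - 1))
      \<le> ((2 * p) powr (1 / (p - 1)) + 2 * (p - 1) / p) * t powr (p / (p - 1))"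
  proof (intro mult_right_mono)
    have "p powr (1 / (p - 1)) \<le> (2 * p) powr (1 / (p - 1))" using assms by (intro powr_mono2) auto
    moreover have "0 \<le> 2 * (p - 1) / p" using assms by simp
    ultimately show "p powr (1 / (p - 1)) \<le> (2 * p) powr (1 / (p - 1)) + 2 * (p - 1) / p" by linarith
  qed simp
  finally show ?thesis .
qed simp

text \<open>The map need not be linear when \<open>p\<close> differs from 2, so boundedness is
  expressed on every ball of the dual, next to the bound on the unit sphere.\<close>

theorem corollary4p5:
  fixes \<Omega> :: "'a::complete_space set"
    and \<mu> \<nu> :: "'a measure"
    and p \<Theta> \<theta> :: real
    and I :: "nat set"
    and patch :: "nat \<Rightarrow> 'a set"
    and chart :: "nat \<Rightarrow> 'a \<Rightarrow> real ^ 'n"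
    and ip :: "'a \<Rightarrow> real ^ 'n \<Rightarrow> real ^ 'n \<Rightarrow> real"
    and grad :: "('a \<Rightarrow> real) \<Rightarrow> 'a \<Rightarrow> real ^ 'n"
    and Tr :: "('a \<Rightarrow> real) \<Rightarrow> 'a \<Rightarrow> real"
  assumes "1 < p"
    and "bounded \<Omega>" and "locally compact \<Omega>" and "\<not> complete \<Omega>"
    and "uniform_domain \<Omega>"
    and "borel_regular_on \<Omega> \<mu>" and "finite_positive_on_balls \<mu>" and "doubling \<mu>"
    and "poincare_inequality \<mu> p"
    and "borel_regular_on (bdry \<Omega>) \<nu>" and "codimensional \<Theta> \<nu> \<mu>"
    and "0 < \<Theta>" and "\<Theta> < p" and "\<theta> = 1 - \<Theta> / p"
    and "cheeger_structure \<mu> p I patch chart ip grad"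
    and "trace_operator \<mu> \<nu> p \<theta> Tr"
  shows "(\<forall>L\<in>HB_dual \<nu> p \<theta>. \<exists>!U. neumann_solution \<mu> \<nu> p \<theta> ip grad Tr L U) \<and>
         NtD \<mu> \<nu> p \<theta> ip grad Tr \<in> HB_dual \<nu> p \<theta> \<rightarrow> HB \<nu> p \<theta> \<and>
         (\<forall>R. \<exists>M. \<forall>L\<in>HB_dual \<nu> p \<theta>. HB_dual_norm \<nu> p \<theta> L \<le> R \<longrightarrow>
                  HB_norm \<nu> p \<theta> (NtD \<mu> \<nu> p \<theta> ip grad Tr L) \<le> M) \<and>
         NtD_norm \<mu> \<nu> p \<theta> ip grad Tr
           \<le> ennreal (((2 * p) powr (1 / (p - 1)) + 2 * (p - 1) / p)
                        * Tr_norm \<mu> \<nu> p \<theta> ip grad Tr powr (p / (p - 1)))"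
proof -
  have space: "space \<mu> = \<Omega>" and space_\<nu>: "space \<nu> = bdry \<Omega>"
    and borel: "sets (restrict_space borel \<Omega>) \<subseteq> sets \<mu>"
    and hull: "\<And>A. A \<in> sets \<mu> \<Longrightarrow> \<exists>B\<in>sets (restrict_space borel \<Omega>). A \<subseteq> B \<and> emeasure \<mu> B = emeasure \<mu> A"
    using assms(6,10) by (auto simp: borel_regular_on_def)
  \<comment> \<open>The empty set would be complete.\<close>
  have ne: "\<Omega> \<noteq> {}" using assms(4) by (auto simp: complete_def)
  obtain x0 e where x0: "\<And>y. y \<in> \<Omega> \<Longrightarrow> dist x0 y \<le> e" using assms(2) by (auto simp: bounded_def)
  \<comment> \<open>Twice the radius bounds all distances; the added 1 makes the inequality
    strict.\<close>
  define R where "R = 2 * e + 1"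
  have diam: "dist x y < R" if "x \<in> \<Omega>" "y \<in> \<Omega>" for x y
    using dist_triangle3[of x y x0] x0[OF that(1)] x0[OF that(2)] by (simp add: R_def)
  have R: "0 < R" using ne diam by fastforce
  have pos: "0 < emeasure \<mu> (ball x r \<inter> \<Omega>)" and fin: "emeasure \<mu> (ball x r \<inter> \<Omega>) < top"
    if "x \<in> \<Omega>" "0 < r" for x r
    using assms(7) that by (auto simp: finite_positive_on_balls_def space)
  have fin_\<Omega>: "emeasure \<mu> \<Omega> < top"
  proof -
    obtain x where x: "x \<in> \<Omega>" using ne by auto
    then have "ball x R \<inter> \<Omega> = \<Omega>" using diam by auto
    then show ?thesis using fin[OF x R] by simp
  qed
  obtain D where D: "0 < D" "\<And>x r. x \<in> \<Omega> \<Longrightarrow> 0 < r \<Longrightarrow>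
      emeasure \<mu> (ball x (2 * r) \<inter> \<Omega>) \<le> ennreal D * emeasure \<mu> (ball x r \<inter> \<Omega>)"
    using assms(8) unfolding doubling_def space by blast
  obtain K c where Kc: "0 < K" "1 \<le> c" and poinc:
    "\<And>x r u g. x \<in> \<Omega> \<Longrightarrow> 0 < r \<Longrightarrow> u \<in> borel_measurable \<mu> \<Longrightarrow>
      set_integrable \<mu> (ball x r \<inter> \<Omega>) u \<Longrightarrow> upper_gradient \<Omega> u g \<Longrightarrow>
      (\<integral>\<^sup>+z\<in>ball x r \<inter> \<Omega>. ennreal \<bar>u z - (LINT z:ball x r \<inter> \<Omega>|\<mu>. u z) /
          measure \<mu> (ball x r \<inter> \<Omega>)\<bar> \<partial>\<mu>) / emeasure \<mu> (ball x r \<inter> \<Omega>)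
      \<le> ennreal (K * r) * epowr ((\<integral>\<^sup>+z\<in>ball x (c * r) \<inter> \<Omega>. epowr (g z) p \<partial>\<mu>) /
          emeasure \<mu> (ball x (c * r) \<inter> \<Omega>)) (1 / p)"
    using assms(9) unfolding poincare_inequality_def Let_def space by blast
  note ch = assms(15)[unfolded cheeger_structure_def]
  obtain C where C: "1 \<le> C" "\<And>u. u \<in> N1p \<mu> p \<Longrightarrow> \<exists>g. minimal_weak_upper_gradient \<mu> p u g \<and>
        (AE x in \<mu>. ennreal (grad_length ip grad u x) \<le> ennreal C * g x \<and>
                    g x \<le> ennreal (C * grad_length ip grad u x))"
    using ch by blast
  note tr = assms(16)[unfolded trace_operator_def]
  obtain T where T: "\<And>u. u \<in> N1p \<mu> p \<Longrightarrow> ennreal (besov_norm \<nu> p \<theta> (Tr u)) \<le> ennreal T * N1p_norm \<mu> p u"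
    using tr by blast
  interpret borel_space_measure \<mu> p
    by unfold_locales (simp_all add: assms(1) borel space)
  interpret poincare_space \<mu> p R D K c
    by unfold_locales (simp_all add: space ne diam pos fin_\<Omega> D Kc poinc)
  interpret cheeger_space \<mu> p R D K c ip grad C
  proof unfold_locales
    show "\<exists>B\<in>sets (restrict_space borel (space \<mu>)). A \<subseteq> B \<and> emeasure \<mu> B = emeasure \<mu> A" if "A \<in> sets \<mu>" for A
      using hull[OF that] by (simp add: space)
  qed (use ch C in blast)+
  interpret trace_space \<mu> p R D K c ip grad C \<nu> \<theta> Tr T
  proof unfold_locales
    show "space \<nu> \<subseteq> closure (space \<mu>)" by (auto simp: space space_\<nu> bdry_def)
  qed (use tr T in blast)+
  have "NtD_norm \<mu> \<nu> p \<theta> ip grad Tr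
      \<le> ennreal (((2 * p) powr (1 / (p - 1)) + 2 * (p - 1) / p) * TrN powr (p / (p - 1)))"
    unfolding NtD_norm_def
  proof (rule SUP_least, rule ennreal_leI)
    fix L assume "L \<in> {L \<in> HB_dual \<nu> p \<theta>. HB_dual_norm \<nu> p \<theta> L = 1}"
    then have "HB_norm \<nu> p \<theta> (NtD \<mu> \<nu> p \<theta> ip grad Tr L) \<le> TrN * (p * TrN) powr (1 / (p - 1))"
      using NtD_bound(2)[of L] by simp
    also have "\<dots> \<le> ((2 * p) powr (1 / (p - 1)) + 2 * (p - 1) / p) * TrN powr (p / (p - 1))"
      by (rule powr_Neumann_bound[OF assms(1) Tr_norm_nonneg])
    finally show "HB_norm \<nu> p \<theta> (NtD \<mu> \<nu> p \<theta> ip grad Tr L) \<le> \<dots>" .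
  qed
  moreover have "\<exists>M. \<forall>L\<in>HB_dual \<nu> p \<theta>. HB_dual_norm \<nu> p \<theta> L \<le> r \<longrightarrow>
      HB_norm \<nu> p \<theta> (NtD \<mu> \<nu> p \<theta> ip grad Tr L) \<le> M" for r
  proof (intro exI ballI impI)
    fix L assume L: "L \<in> HB_dual \<nu> p \<theta>" "HB_dual_norm \<nu> p \<theta> L \<le> r"
    have "HB_norm \<nu> p \<theta> (NtD \<mu> \<nu> p \<theta> ip grad Tr L)
        \<le> TrN * (p * (HB_dual_norm \<nu> p \<theta> L * TrN)) powr (1 / (p - 1))"
      by (rule NtD_bound(2)[OF L(1)])
    also have "\<dots> \<le> TrN * (p * (\<bar>r\<bar> * TrN)) powr (1 / (p - 1))"
      using assms(1) L(2) Tr_norm_nonneg HB_dual_norm_nonneg[OF L(1)]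
      by (intro mult_left_mono powr_mono2 mult_right_mono) auto
    finally show "HB_norm \<nu> p \<theta> (NtD \<mu> \<nu> p \<theta> ip grad Tr L) \<le> \<dots>" .
  qed
  ultimately show ?thesis
    using neumann_solution_unique NtD_bound(1) by blast
qed

end
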